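(* Let $G$ be a one-based group. Then for any positive integer $m$: $$\mathrm{dp}(G^m)=\mathrm{vc}^{\mathrm{Th}(G)}(m).$$ Furthermore, if both are finite, then they agree with the breadth of the semilattice of commensurability classes of the $\mathrm{acl}^{\mathrm{eq}}(\emptyset)$-definable subgroups of $G^m$.
   Context: Work in a complete theory with infinite models, inside a sufficiently saturated model. A group $G$ (possibly with additional structure) is one-based if for every $m$ any definable subset of $G^m$ is a finite boolean combination of cosets of $\mathrm{acl}^{\mathrm{eq}}(\emptyset)$-definable subgroups of $G^m$. The theory of a one-based group is stable. dp-rank. An inp-pattern of depth $\kappa$ for a partial type $\pi(x)$ is a sequence of formulas $(\varphi^\alpha(x,y^\alpha))_{\alpha<\kappa}$ together with natural numbers $(k^\alpha)_{\alpha<\kappa}$ such that there is an array of tuples $(b_i^\alpha)_{\alpha<\kappa,i<\omega}$ for which each row $\{\varphi^\alpha(x,b_i^\alpha)\}_{i<\omega}$ is $k^\alpha$-inconsistent, while for every $\eta:\kappa\to\omega$ the path $\pi(x)\cup\{\varphi^\alpha(x,b^\alpha_{\eta(\alpha)})\}_{\alpha<\kappa}$ is consistent. In a stable theory the dp-rank of $\pi$ is the supremum of the cardinals $\kappa$ for which there is an inp-pattern of depth $\kappa$ for $\pi$. $\mathrm{dp}(G^m)$ is the dp-rank of $\{x=x\}$ with $x$ an $m$-tuple of variables. vc-density. For a class $\mathcal S$ of subsets of a set $X$, the shatter function is $\pi_{\mathcal S}(n)=\max\{|\{C\cap A:C\in\mathcal S\}|: A\subseteq X,|A|=n\}$, and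 $\mathrm{vc}(\mathcal S)$ is the infimum of the reals $r\ge0$ with $\pi_{\mathcal S}(n)=O(n^r)$ ($\infty$ if there is none). For a formula $\varphi(x;y)$ with object variables $x$ and parameter variables $y$, $\mathcal S_\varphi=\{\varphi(\mathbb M;b):b\in\mathbb M^{|y|}\}$ for $\mathbb M$ a sufficiently saturated model of $T$. The vc-density of $T$ is the function $\mathrm{vc}^T:\mathbb N\to\mathbb R^{\ge0}\cup\{\infty\}$, $\mathrm{vc}^T(n)=\sup\{\mathrm{vc}(\mathcal S_\varphi):\varphi(x;y)\text{ a formula of }T\text{ with }|y|=n\}$. The equality of dp-rank and vc-density means that either both are infinite or both are finite and equal. Commensurability and breadth. Two subgroups $H,N$ of a group are commensurable if $H\cap N$ has finite index in both $H$ and $N$. Commensurability classes of $\mathrm{acl}^{\mathrm{eq}}(\emptyset)$-definable subgroups form a semilattice, the meet of the classes of $H$ and $N$ being the class of $H\cap N$. The breadth of a semilattice $L$ is the smallest integer $d$, if it exists, such that for all $x_1,\dots,x_n\in L$ with $n>d$ there are $1\le i_1<\dots<i_d\le n$ with $x_1\wedge\dots\wedge x_n=x_{i_1}\wedge\dots\wedge x_{i_d}$ (the empty intersection of subgroups being the whole group). *)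

theory Defs
  imports
    "HOL-Algebra.Product_Groups"
    "HOL-Library.Equipollence"
    "HOL-Library.Extended_Real"
    "HOL-Library.Landau_Symbols"
begin

section \<open>First-order logic\<close>

text \<open>A language is given by sets of pairs (symbol, arity).\<close>

record ('f, 'r) lang =
  funs :: "('f \<times> nat) set"
  rels :: "('r \<times> nat) set"

datatype 'f tm = Var nat | Fn 'f "'f tm list"

datatype ('f, 'r) fm =
    Equal "'f tm" "'f tm"
  | Atom 'r "'f tm list"
  | Neg "('f, 'r) fm"
  | Conj "('f, 'r) fm" "('f, 'r) fm"
  | Exists nat "('f, 'r) fm"

fun wf_tm :: "('f, 'r, 'z) lang_scheme \<Rightarrow> 'f tm \<Rightarrow> bool" where
  "wf_tm L (Var i) \<longleftrightarrow> True"
| "wf_tm L (Fn f ts) \<longleftrightarrow> (f, length ts) \<in> funs L \<and> (\<forall>t \<in> set ts. wf_tm L t)"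

fun wf_fm :: "('f, 'r, 'z) lang_scheme \<Rightarrow> ('f, 'r) fm \<Rightarrow> bool" where
  "wf_fm L (Equal s t) \<longleftrightarrow> wf_tm L s \<and> wf_tm L t"
| "wf_fm L (Atom r ts) \<longleftrightarrow> (r, length ts) \<in> rels L \<and> (\<forall>t \<in> set ts. wf_tm L t)"
| "wf_fm L (Neg \<phi>) \<longleftrightarrow> wf_fm L \<phi>"
| "wf_fm L (Conj \<phi> \<psi>) \<longleftrightarrow> wf_fm L \<phi> \<and> wf_fm L \<psi>"
| "wf_fm L (Exists i \<phi>) \<longleftrightarrow> wf_fm L \<phi>"

fun fv_tm :: "'f tm \<Rightarrow> nat set" where
  "fv_tm (Var i) = {i}"
| "fv_tm (Fn f ts) = (\<Union>t \<in> set ts. fv_tm t)"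

fun fv :: "('f, 'r) fm \<Rightarrow> nat set" where
  "fv (Equal s t) = fv_tm s \<union> fv_tm t"
| "fv (Atom r ts) = (\<Union>t \<in> set ts. fv_tm t)"
| "fv (Neg \<phi>) = fv \<phi>"
| "fv (Conj \<phi> \<psi>) = fv \<phi> \<union> fv \<psi>"
| "fv (Exists i \<phi>) = fv \<phi> - {i}"

record ('a, 'f, 'r) fo_struct = "'a partial_object" +
  fn :: "'f \<Rightarrow> 'a list \<Rightarrow> 'a"
  rel :: "'r \<Rightarrow> 'a list \<Rightarrow> bool"

definition is_struct :: "('f, 'r, 'z) lang_scheme \<Rightarrow> ('a, 'f, 'r, 'y) fo_struct_scheme \<Rightarrow> bool" where
  "is_struct L M \<longleftrightarrow> carrier M \<noteq> {} \<and>
     (\<forall>(f, n) \<in> funs L. \<forall>xs. set xs \<subseteq> carrier M \<and> length xs = n \<longrightarrow> fn M f xs \<in> carrier M)"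

fun tm_val :: "('a, 'f, 'r, 'y) fo_struct_scheme \<Rightarrow> (nat \<Rightarrow> 'a) \<Rightarrow> 'f tm \<Rightarrow> 'a" where
  "tm_val M e (Var i) = e i"
| "tm_val M e (Fn f ts) = fn M f (map (tm_val M e) ts)"

fun sat :: "('a, 'f, 'r, 'y) fo_struct_scheme \<Rightarrow> (nat \<Rightarrow> 'a) \<Rightarrow> ('f, 'r) fm \<Rightarrow> bool" where
  "sat M e (Equal s t) \<longleftrightarrow> tm_val M e s = tm_val M e t"
| "sat M e (Atom r ts) \<longleftrightarrow> rel M r (map (tm_val M e) ts)"
| "sat M e (Neg \<phi>) \<longleftrightarrow> \<not> sat M e \<phi>"
| "sat M e (Conj \<phi> \<psi>) \<longleftrightarrow> sat M e \<phi> \<and> sat M e \<psi>"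
| "sat M e (Exists i \<phi>) \<longleftrightarrow> (\<exists>a \<in> carrier M. sat M (e(i := a)) \<phi>)"

text \<open>
  The \<open>k\<close>-tuples from \<open>A\<close> are the extensional functions on \<open>{..<k}\<close>, so that \<open>tuples (carrier G) k\<close>
  is the carrier of the library's product group \<open>product_group {..<k} (\<lambda>_. G)\<close>.
\<close>

abbreviation tuples :: "'a set \<Rightarrow> nat \<Rightarrow> (nat \<Rightarrow> 'a) set" where
  "tuples A k \<equiv> {..<k} \<rightarrow>\<^sub>E A"

definition tcat :: "nat \<Rightarrow> (nat \<Rightarrow> 'a) \<Rightarrow> (nat \<Rightarrow> 'a) \<Rightarrow> (nat \<Rightarrow> 'a)" where
  "tcat k x y = (\<lambda>i. if i < k then x i else y (i - k))"

text \<open>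
  Formulas \<open>\<phi>(x; y)\<close> with \<open>|x| = k\<close> and \<open>|y| = n\<close>: the variables \<open>0, \<dots>, k - 1\<close> form \<open>x\<close> and the
  variables \<open>k, \<dots>, k + n - 1\<close> form \<open>y\<close>.
\<close>

definition formulas :: "('f, 'r, 'z) lang_scheme \<Rightarrow> nat \<Rightarrow> nat \<Rightarrow> ('f, 'r) fm set" where
  "formulas L k n = {\<phi>. wf_fm L \<phi> \<and> fv \<phi> \<subseteq> {..<k + n}}"

definition solset ::
  "('a, 'f, 'r, 'y) fo_struct_scheme \<Rightarrow> nat \<Rightarrow> ('f, 'r) fm \<Rightarrow> (nat \<Rightarrow> 'a) \<Rightarrow> (nat \<Rightarrow> 'a) set" where
  "solset M k \<phi> b = {x \<in> tuples (carrier M) k. sat M (tcat k x b) \<phi>}"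

definition definable ::
  "('f, 'r, 'z) lang_scheme \<Rightarrow> ('a, 'f, 'r, 'y) fo_struct_scheme \<Rightarrow> 'a set \<Rightarrow> nat \<Rightarrow> (nat \<Rightarrow> 'a) set \<Rightarrow> bool"
  where
  "definable L M A k D \<longleftrightarrow>
     (\<exists>n. \<exists>\<phi> \<in> formulas L k n. \<exists>b \<in> tuples A n. D = solset M k \<phi> b)"

definition acl ::
  "('f, 'r, 'z) lang_scheme \<Rightarrow> ('a, 'f, 'r, 'y) fo_struct_scheme \<Rightarrow> 'a set \<Rightarrow> 'a set" where
  "acl L M A = {a. \<exists>D. definable L M A 1 D \<and> finite D \<and> (\<lambda>i\<in>{..<1}. a) \<in> D}"

section \<open>Partial types and saturation\<close>

text \<open>
  A formula over \<open>A\<close> in \<open>k\<close> variables is a pair consisting of a formula \<open>\<phi>(x; y)\<close> with \<open>|x| = k\<close> and a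
  tuple from \<open>A\<close> substituted for \<open>y\<close>.  A set of formulas over the model is consistent (with the
  elementary diagram of the model) iff it is finitely satisfiable in the model.
\<close>

definition formulas_over ::
  "('f, 'r, 'z) lang_scheme \<Rightarrow> 'a set \<Rightarrow> nat \<Rightarrow> (('f, 'r) fm \<times> (nat \<Rightarrow> 'a)) set" where
  "formulas_over L A k = (\<Union>n. formulas L k n \<times> tuples A n)"

definition realizes ::
  "('a, 'f, 'r, 'y) fo_struct_scheme \<Rightarrow> nat \<Rightarrow> (nat \<Rightarrow> 'a) \<Rightarrow> (('f, 'r) fm \<times> (nat \<Rightarrow> 'a)) set \<Rightarrow> bool" where
  "realizes M k x P \<longleftrightarrow> (\<forall>(\<phi>, b) \<in> P. sat M (tcat k x b) \<phi>)"

definition consistent ::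
  "('a, 'f, 'r, 'y) fo_struct_scheme \<Rightarrow> nat \<Rightarrow> (('f, 'r) fm \<times> (nat \<Rightarrow> 'a)) set \<Rightarrow> bool" where
  "consistent M k P \<longleftrightarrow>
     (\<forall>F \<subseteq> P. finite F \<longrightarrow> (\<exists>x \<in> tuples (carrier M) k. realizes M k x F))"

text \<open>
  The saturation required is \<open>|T|\<^sup>+\<close>-saturation, where \<open>|T| = max(|L|, \<aleph>\<^sub>0)\<close> is the number of
  \<open>L\<close>-formulas: types over sets of at most that many parameters are realized.
\<close>

definition sufficiently_saturated ::
  "('f, 'r, 'z) lang_scheme \<Rightarrow> ('a, 'f, 'r, 'y) fo_struct_scheme \<Rightarrow> bool" where
  "sufficiently_saturated L M \<longleftrightarrow>
     (\<forall>k A P. A \<subseteq> carrier M \<and> A \<lesssim> {\<phi> :: ('f, 'r) fm. wf_fm L \<phi>} \<and>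
        P \<subseteq> formulas_over L A k \<and> consistent M k P \<longrightarrow>
        (\<exists>x \<in> tuples (carrier M) k. realizes M k x P))"

section \<open>Imaginaries\<close>

text \<open>
  \<open>M\<^sup>e\<^sup>q\<close> is rendered, following Shelah, as a one-sorted structure on the disjoint union of all sorts: the
  home sort and, for every \<open>\<emptyset>\<close>-definable equivalence relation \<open>E\<close> on \<open>M\<^sup>k\<close>, the sort \<open>M\<^sup>k/E\<close>, where \<open>E\<close>
  is recorded by \<open>k\<close> and a formula \<open>\<epsilon>\<close> defining it.  Its relations are those of \<open>M\<close>, the graphs of the
  functions of \<open>M\<close> and the graphs of the projections \<open>M\<^sup>k \<rightarrow> M\<^sup>k/E\<close>.  The sorts are domains and ranges
  of projections, so no separate predicates are needed for them.
\<close>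

definition def_rel ::
  "('a, 'f, 'r, 'y) fo_struct_scheme \<Rightarrow> nat \<Rightarrow> ('f, 'r) fm \<Rightarrow> ((nat \<Rightarrow> 'a) \<times> (nat \<Rightarrow> 'a)) set" where
  "def_rel M k \<epsilon> =
     {(x, y). x \<in> tuples (carrier M) k \<and> y \<in> tuples (carrier M) k \<and> sat M (tcat k x y) \<epsilon>}"

definition imag_sorts ::
  "('f, 'r, 'z) lang_scheme \<Rightarrow> ('a, 'f, 'r, 'y) fo_struct_scheme \<Rightarrow> (nat \<times> ('f, 'r) fm) set" where
  "imag_sorts L M =
     {(k, \<epsilon>). \<epsilon> \<in> formulas L k k \<and> equiv (tuples (carrier M) k) (def_rel M k \<epsilon>)}"

datatype ('a, 'f, 'r) eq_elem = Home 'a | Imag nat "('f, 'r) fm" "(nat \<Rightarrow> 'a) set"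

datatype ('f, 'r) eq_rel = Old_Rel 'r | Graph 'f | Proj nat "('f, 'r) fm"

definition eq_lang ::
  "('f, 'r, 'z) lang_scheme \<Rightarrow> ('a, 'f, 'r, 'y) fo_struct_scheme \<Rightarrow> ('f, ('f, 'r) eq_rel) lang" where
  "eq_lang L M =
     \<lparr>funs = {},
      rels = {(Old_Rel r, n) | r n. (r, n) \<in> rels L}
           \<union> {(Graph f, Suc n) | f n. (f, n) \<in> funs L}
           \<union> {(Proj k \<epsilon>, Suc k) | k \<epsilon>. (k, \<epsilon>) \<in> imag_sorts L M}\<rparr>"

fun eq_holds ::
  "('a, 'f, 'r, 'y) fo_struct_scheme \<Rightarrow> ('f, 'r) eq_rel \<Rightarrow> ('a, 'f, 'r) eq_elem list \<Rightarrow> bool" where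
  "eq_holds M (Old_Rel r) us \<longleftrightarrow> (\<exists>xs. us = map Home xs \<and> rel M r xs)"
| "eq_holds M (Graph f) us \<longleftrightarrow> (\<exists>xs. us = map Home xs @ [Home (fn M f xs)])"
| "eq_holds M (Proj k \<epsilon>) us \<longleftrightarrow>
     (\<exists>xs. length xs = k \<and>
        us = map Home xs @ [Imag k \<epsilon> (def_rel M k \<epsilon> `` {\<lambda>i\<in>{..<k}. xs ! i})])"

definition eq_struct ::
  "('f, 'r, 'z) lang_scheme \<Rightarrow> ('a, 'f, 'r, 'y) fo_struct_scheme \<Rightarrow>
   (('a, 'f, 'r) eq_elem, 'f, ('f, 'r) eq_rel) fo_struct" where
  "eq_struct L M =
     \<lparr>carrier = Home ` carrier M
              \<union> {Imag k \<epsilon> C | k \<epsilon> C. (k, \<epsilon>) \<in> imag_sorts L M \<and>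
                                    C \<in> tuples (carrier M) k // def_rel M k \<epsilon>},
      fn = (\<lambda>_ _. undefined),
      rel = eq_holds M\<rparr>"

definition acleq0 ::
  "('f, 'r, 'z) lang_scheme \<Rightarrow> ('a, 'f, 'r, 'y) fo_struct_scheme \<Rightarrow> ('a, 'f, 'r) eq_elem set" where
  "acleq0 L M = acl (eq_lang L M) (eq_struct L M) {}"

definition acleq0_definable ::
  "('f, 'r, 'z) lang_scheme \<Rightarrow> ('a, 'f, 'r, 'y) fo_struct_scheme \<Rightarrow> nat \<Rightarrow> (nat \<Rightarrow> 'a) set \<Rightarrow> bool" where
  "acleq0_definable L M k D \<longleftrightarrow> D \<subseteq> tuples (carrier M) k \<and>
     definable (eq_lang L M) (eq_struct L M) (acleq0 L M) k ((\<lambda>x. \<lambda>i\<in>{..<k}. Home (x i)) ` D)"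

section \<open>One-based groups\<close>

definition group_struct ::
  "('f, 'r, 'z) lang_scheme \<Rightarrow> 'f \<Rightarrow> ('a, 'f, 'r, 'y) fo_struct_scheme \<Rightarrow> ('a, 'x) monoid_scheme \<Rightarrow> bool"
  where
  "group_struct L mu M G \<longleftrightarrow>
     is_struct L M \<and> group G \<and> carrier G = carrier M \<and> (mu, 2) \<in> funs L \<and>
     (\<forall>x \<in> carrier G. \<forall>y \<in> carrier G. fn M mu [x, y] = x \<otimes>\<^bsub>G\<^esub> y)"

abbreviation group_pow :: "('a, 'x) monoid_scheme \<Rightarrow> nat \<Rightarrow> (nat \<Rightarrow> 'a) monoid" where
  "group_pow G m \<equiv> product_group {..<m} (\<lambda>_. G)"

definition acleq0_subgroups ::
  "('f, 'r, 'z) lang_scheme \<Rightarrow> ('a, 'f, 'r, 'y) fo_struct_scheme \<Rightarrow> ('a, 'x) monoid_scheme \<Rightarrow> nat \<Rightarrow>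
   (nat \<Rightarrow> 'a) set set" where
  "acleq0_subgroups L M G m = {H. subgroup H (group_pow G m) \<and> acleq0_definable L M m H}"

inductive_set bool_combs :: "'b set \<Rightarrow> 'b set set \<Rightarrow> 'b set set" for X \<S> where
  base: "S \<in> \<S> \<Longrightarrow> S \<in> bool_combs X \<S>"
| empty: "{} \<in> bool_combs X \<S>"
| compl: "S \<in> bool_combs X \<S> \<Longrightarrow> X - S \<in> bool_combs X \<S>"
| union: "S \<in> bool_combs X \<S> \<Longrightarrow> S' \<in> bool_combs X \<S> \<Longrightarrow> S \<union> S' \<in> bool_combs X \<S>"

text \<open>
  Cosets are left cosets; as definable sets and subgroups are closed under inversion, right cosets
  give the same notion.
\<close>

definition one_based ::
  "('f, 'r, 'z) lang_scheme \<Rightarrow> ('a, 'f, 'r, 'y) fo_struct_scheme \<Rightarrow> ('a, 'x) monoid_scheme \<Rightarrow> bool" where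
  "one_based L M G \<longleftrightarrow>
     (\<forall>m D. definable L M (carrier M) m D \<longrightarrow>
        D \<in> bool_combs (carrier (group_pow G m))
              {a <#\<^bsub>group_pow G m\<^esub> H | a H.
                 a \<in> carrier (group_pow G m) \<and> H \<in> acleq0_subgroups L M G m})"

section \<open>dp-rank\<close>

text \<open>
  The depth of a pattern is the cardinality of the index set \<open>K\<close> of its rows.  In the
  \<open>k\<close>-inconsistency of a row, the \<open>k\<close> instances are chosen by distinct indices, not as distinct formulas.
\<close>

definition inp_pattern ::
  "('f, 'r, 'z) lang_scheme \<Rightarrow> ('a, 'f, 'r, 'y) fo_struct_scheme \<Rightarrow> nat \<Rightarrow>
   (('f, 'r) fm \<times> (nat \<Rightarrow> 'a)) set \<Rightarrow> 'i set \<Rightarrow> bool" where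
  "inp_pattern L M n P K \<longleftrightarrow>
     (\<exists>(\<phi> :: 'i \<Rightarrow> ('f, 'r) fm) (l :: 'i \<Rightarrow> nat) (k :: 'i \<Rightarrow> nat) (b :: 'i \<Rightarrow> nat \<Rightarrow> nat \<Rightarrow> 'a).
        (\<forall>\<alpha> \<in> K. \<phi> \<alpha> \<in> formulas L n (l \<alpha>) \<and> (\<forall>i. b \<alpha> i \<in> tuples (carrier M) (l \<alpha>))) \<and>
        (\<forall>\<alpha> \<in> K. \<forall>I. finite I \<and> card I = k \<alpha> \<longrightarrow> \<not> consistent M n ((\<lambda>i. (\<phi> \<alpha>, b \<alpha> i)) ` I)) \<and>
        (\<forall>\<eta> :: 'i \<Rightarrow> nat. consistent M n (P \<union> (\<lambda>\<alpha>. (\<phi> \<alpha>, b \<alpha> (\<eta> \<alpha>))) ` K)))"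

text \<open>
  Infinite cardinals are not distinguished: an infinite depth counts as \<open>\<infinity>\<close>.  For this it is enough to
  look at index sets of natural numbers, since a pattern restricts to any subset of its rows.
\<close>

definition dp_rank ::
  "('f, 'r, 'z) lang_scheme \<Rightarrow> ('a, 'f, 'r, 'y) fo_struct_scheme \<Rightarrow> nat \<Rightarrow>
   (('f, 'r) fm \<times> (nat \<Rightarrow> 'a)) set \<Rightarrow> enat" where
  "dp_rank L M n P =
     Sup {if finite K then enat (card K) else \<infinity> | K :: nat set. inp_pattern L M n P K}"

lemma consistent_mono: "consistent M n Q \<Longrightarrow> P \<subseteq> Q \<Longrightarrow> consistent M n P"
  unfolding consistent_def by (meson subset_trans)

lemma inp_pattern_reindex:
  fixes h :: "'j \<Rightarrow> 'i"
  assumes "inp_pattern L M n P K" "inj_on h J" "h ` J \<subseteq> K"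
  shows "inp_pattern L M n P J"
proof -
  obtain \<phi> l k b where
    wf: "\<forall>\<alpha> \<in> K. \<phi> \<alpha> \<in> formulas L n (l \<alpha>) \<and> (\<forall>i. b \<alpha> i \<in> tuples (carrier M) (l \<alpha>))" and
    row: "\<forall>\<alpha> \<in> K. \<forall>I. finite I \<and> card I = k \<alpha> \<longrightarrow> \<not> consistent M n ((\<lambda>i. (\<phi> \<alpha>, b \<alpha> i)) ` I)" and
    path: "\<And>\<eta> :: 'i \<Rightarrow> nat. consistent M n (P \<union> (\<lambda>\<alpha>. (\<phi> \<alpha>, b \<alpha> (\<eta> \<alpha>))) ` K)"
    using assms(1) unfolding inp_pattern_def by auto
  have "consistent M n (P \<union> (\<lambda>\<alpha>. (\<phi> (h \<alpha>), b (h \<alpha>) (\<eta> \<alpha>))) ` J)" for \<eta>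
  proof (rule consistent_mono[OF path[of "\<eta> \<circ> the_inv_into J h"]])
    have "(\<phi> (h \<alpha>), b (h \<alpha>) (\<eta> \<alpha>)) \<in> (\<lambda>\<beta>. (\<phi> \<beta>, b \<beta> ((\<eta> \<circ> the_inv_into J h) \<beta>))) ` K" if "\<alpha> \<in> J" for \<alpha>
      using that assms(2,3) by (intro image_eqI[of _ _ "h \<alpha>"]) (auto simp: the_inv_into_f_f)
    then show "P \<union> (\<lambda>\<alpha>. (\<phi> (h \<alpha>), b (h \<alpha>) (\<eta> \<alpha>))) ` J
        \<subseteq> P \<union> (\<lambda>\<alpha>. (\<phi> \<alpha>, b \<alpha> ((\<eta> \<circ> the_inv_into J h) \<alpha>))) ` K"
      by blast
  qed
  then show ?thesis
    unfolding inp_pattern_def using wf row assms(3)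
    by (intro exI[of _ "\<lambda>\<alpha>. \<phi> (h \<alpha>)"] exI[of _ "\<lambda>\<alpha>. l (h \<alpha>)"] exI[of _ "\<lambda>\<alpha>. k (h \<alpha>)"]
          exI[of _ "\<lambda>\<alpha>. b (h \<alpha>)"]) (simp add: image_subset_iff)
qed

text \<open>The partial type \<open>{x = x}\<close>, for a tuple \<open>x\<close> of \<open>m\<close> variables, as \<open>{x\<^sub>i = x\<^sub>i | i < m}\<close>.\<close>

definition trivial_type :: "nat \<Rightarrow> (('f, 'r) fm \<times> (nat \<Rightarrow> 'a)) set" where
  "trivial_type m = (\<lambda>i. (Equal (Var i) (Var i), \<lambda>_. undefined)) ` {..<m}"

definition dp_pow :: "('f, 'r, 'z) lang_scheme \<Rightarrow> ('a, 'f, 'r, 'y) fo_struct_scheme \<Rightarrow> nat \<Rightarrow> enat" where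
  "dp_pow L M m = dp_rank L M m (trivial_type m)"

section \<open>vc-density\<close>

text \<open>The supremum is a maximum, since the cardinals are bounded by \<open>2 ^ n\<close>.\<close>

definition shatter_fun :: "'b set \<Rightarrow> 'b set set \<Rightarrow> nat \<Rightarrow> nat" where
  "shatter_fun X \<S> n =
     Sup {card ((\<lambda>C. C \<inter> A) ` \<S>) | A. A \<subseteq> X \<and> finite A \<and> card A = n}"

definition vc :: "'b set \<Rightarrow> 'b set set \<Rightarrow> ereal" where
  "vc X \<S> = Inf {ereal r | r. 0 \<le> r \<and>
                   (\<lambda>n. real (shatter_fun X \<S> n)) \<in> O(\<lambda>n. real n powr r)}"

definition vc_density :: "('f, 'r, 'z) lang_scheme \<Rightarrow> ('a, 'f, 'r, 'y) fo_struct_scheme \<Rightarrow> nat \<Rightarrow> ereal" where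
  "vc_density L M n =
     Sup {vc (tuples (carrier M) k) (solset M k \<phi> ` tuples (carrier M) n) | k \<phi>. \<phi> \<in> formulas L k n}"

section \<open>Commensurability and breadth\<close>

definition finite_index :: "('b, 'x) monoid_scheme \<Rightarrow> 'b set \<Rightarrow> 'b set \<Rightarrow> bool" where
  "finite_index K H N \<longleftrightarrow> finite (rcosets\<^bsub>K\<lparr>carrier := H\<rparr>\<^esub> N)"

definition commensurable :: "('b, 'x) monoid_scheme \<Rightarrow> 'b set \<Rightarrow> 'b set \<Rightarrow> bool" where
  "commensurable K H N \<longleftrightarrow> finite_index K H (H \<inter> N) \<and> finite_index K N (H \<inter> N)"

definition comm_rel :: "('b, 'x) monoid_scheme \<Rightarrow> 'b set set \<Rightarrow> ('b set \<times> 'b set) set" where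
  "comm_rel K \<H> = {(H, N). H \<in> \<H> \<and> N \<in> \<H> \<and> commensurable K H N}"

definition class_meet :: "('b set \<times> 'b set) set \<Rightarrow> 'b set set \<Rightarrow> 'b set set \<Rightarrow> 'b set set" where
  "class_meet R X Y = (\<Union>H \<in> X. \<Union>N \<in> Y. R `` {H \<inter> N})"

text \<open>Breadth of a semilattice \<open>S\<close> with meet \<open>mt\<close> whose empty meet is \<open>t\<close>; it is \<open>\<infinity>\<close> if no \<open>d\<close> exists.\<close>

definition breadth :: "'c set \<Rightarrow> ('c \<Rightarrow> 'c \<Rightarrow> 'c) \<Rightarrow> 'c \<Rightarrow> enat" where
  "breadth S mt t = Inf {enat d | d.
     \<forall>xs. set xs \<subseteq> S \<and> d < length xs \<longrightarrow>
       (\<exists>I \<subseteq> {..<length xs}. card I = d \<and> foldr mt xs t = foldr mt (nths xs I) t)}"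

definition comm_breadth ::
  "('f, 'r, 'z) lang_scheme \<Rightarrow> ('a, 'f, 'r, 'y) fo_struct_scheme \<Rightarrow> ('a, 'x) monoid_scheme \<Rightarrow> nat \<Rightarrow> enat" where
  "comm_breadth L M G m =
     (let \<H> = acleq0_subgroups L M G m; R = comm_rel (group_pow G m) \<H>
      in breadth (\<H> // R) (class_meet R) (R `` {carrier (group_pow G m)}))"

end

theory Submission
  imports Defs
begin

text \<open>
  Dp-rank and vc-density are both shown to be equal to the breadth.

  Upper bounds.  By one-basedness applied to \<open>G\<^sup>k\<^sup>+\<^sup>m\<close>, the fibres \<open>\<phi>(b; G\<^sup>m)\<close> are Boolean combinations
  of boundedly many cosets of finitely many fixed \<open>acl\<^sup>e\<^sup>q(\<emptyset>)\<close>-definable subgroups of \<open>G\<^sup>m\<close>.  If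
  the breadth is at most \<open>d\<close>, then, up to a bounded index, a point of \<open>G\<^sup>m\<close> is located with respect to \<open>n\<close>
  such cosets by naming \<open>d\<close> of them, so that they cut \<open>G\<^sup>m\<close> into \<open>O(n\<^sup>d)\<close> pieces.  This bounds the
  vc-density by \<open>d\<close>, and an inp-pattern of depth \<open>d + 1\<close> would have on the order of \<open>n\<^sup>d\<^sup>+\<^sup>1\<close>
  pairwise distinguishable paths through its first \<open>n\<close> columns.

  Lower bounds.  Breadth at least \<open>d\<close> gives subgroups \<open>H\<^sub>1, \<dots>, H\<^sub>d\<close> such that each
  \<open>X\<^sub>i = \<Inter>\<^sub>j\<^sub>\<noteq>\<^sub>i H\<^sub>j\<close> meets infinitely many cosets of \<open>H\<^sub>i\<close>.  The conjugates of \<open>H\<^sub>i\<close> form a definable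
  family, hence by B. H. Neumann's lemma fall into finitely many commensurability classes, and so \<open>X\<^sub>i\<close> even
  meets infinitely many double cosets \<open>H\<^sub>i g H\<^sub>i\<close>.  A product \<open>g\<^sub>1 \<cdots> g\<^sub>d\<close> with \<open>g\<^sub>i \<in> X\<^sub>i\<close> lies in
  \<open>H\<^sub>i g\<^sub>i H\<^sub>i\<close> for every \<open>i\<close>, so these double cosets are the rows of an inp-pattern of depth \<open>d\<close> and
  of a shattering array.  They are definable in the structure itself because \<open>M\<^sup>e\<^sup>q\<close> induces no new
  definable sets on the home sort.
\<close>

section \<open>Commensurability and coverings by cosets\<close>

text \<open>The group is not assumed commutative, so finite index is replaced by
  \<open>virt_le\<close>: covering by finitely many left cosets. It makes sense for plain sets, is
  transported by conjugation and is exactly what B. H. Neumann's lemma delivers. That lemma gives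
  the fact behind the double cosets: a subgroup that is a Boolean combination of cosets of members
  of a finite family is commensurable with the meet of those members that virtually contain it. As
  there are only finitely many such meets, the conjugates of a definable subgroup have finitely many
  commensurability classes.

  In the upper bound the breadth enters through one choice: for every set \<open>I\<close> of
  subgroups, at most \<open>d\<close> members whose meet is virtually contained in the meet of
  \<open>I\<close>. The family being finite, these choices contribute a constant that is independent
  of the number of cosets.

  The other obstacle is M^eq. Being one-sorted, it lets a single quantifier range over infinitely
  many sorts, whereas a formula can name finitely many; the quantifier has to be split into finitely
  many cases before it can be translated into \<open>M\<close>.\<close>

lemma finite_image_repr: "finite (f ` A) \<Longrightarrow> \<exists>E. E \<subseteq> A \<and> finite E \<and> f ` A = f ` E"
  using finite_subset_image[of "f ` A" f A] by auto

text \<open>Virtual containment of \<open>H\<close> in \<open>N\<close>. It is a covering rather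
  than an index because \<open>infinite_dcos\<close> applies it to a set that is not known to be a
  subgroup; the representatives range over the whole group, so that coverings can be translated
  freely.\<close>

definition virt_le :: "('b, 'x) monoid_scheme \<Rightarrow> 'b set \<Rightarrow> 'b set \<Rightarrow> bool" where
  "virt_le G H N \<longleftrightarrow> (\<exists>F. finite F \<and> F \<subseteq> carrier G \<and> H \<subseteq> (\<Union>f\<in>F. f <#\<^bsub>G\<^esub> N))"

definition meet_of :: "('b, 'x) monoid_scheme \<Rightarrow> 'b set set \<Rightarrow> 'b set" where
  "meet_of G \<B> = carrier G \<inter> \<Inter>\<B>"

definition conj_set :: "('b, 'x) monoid_scheme \<Rightarrow> 'b \<Rightarrow> 'b set \<Rightarrow> 'b set" where
  "conj_set G g H = (\<lambda>h. g \<otimes>\<^bsub>G\<^esub> h \<otimes>\<^bsub>G\<^esub> inv\<^bsub>G\<^esub> g) ` H"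

section \<open>Cosets, virtual containment and Neumann's lemma\<close>

context group
begin

lemma mem_lcos_iff:
  assumes "N \<subseteq> carrier G" "f \<in> carrier G" "x \<in> carrier G"
  shows "x \<in> f <# N \<longleftrightarrow> inv f \<otimes> x \<in> N"
proof
  assume "x \<in> f <# N"
  then obtain n where n: "n \<in> N" "x = f \<otimes> n" unfolding l_coset_def by auto
  then have "inv f \<otimes> x = n" using assms by (metis inv_solve_left subsetD)
  then show "inv f \<otimes> x \<in> N" using n by simp
next
  assume "inv f \<otimes> x \<in> N"
  moreover have "x = f \<otimes> (inv f \<otimes> x)" using assms by (simp add: m_assoc[symmetric])
  ultimately show "x \<in> f <# N" unfolding l_coset_def by blast
qed

lemma lcos_subset_carrier: "\<lbrakk>N \<subseteq> carrier G; a \<in> carrier G\<rbrakk> \<Longrightarrow> a <# N \<subseteq> carrier G"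
  by (rule l_coset_subset_G)

lemma mem_lcos_self: "\<lbrakk>subgroup N G; a \<in> carrier G\<rbrakk> \<Longrightarrow> a \<in> a <# N"
  by (simp add: mem_lcos_iff subgroup.subset subgroup.one_closed)

lemma lcos_eqI: "\<lbrakk>subgroup N G; a \<in> carrier G; y \<in> a <# N\<rbrakk> \<Longrightarrow> y <# N = a <# N"
  by (metis l_repr_independence)

lemma inv_mult_lcos_mem:
  assumes "subgroup N G" "f \<in> carrier G" "x \<in> f <# N" "y \<in> f <# N"
  shows "inv x \<otimes> y \<in> N"
proof -
  have c: "x \<in> carrier G" "y \<in> carrier G"
    using assms lcos_subset_carrier subgroup.subset by blast+
  have "y \<in> x <# N" using lcos_eqI assms by metis
  then show ?thesis using mem_lcos_iff[OF subgroup.subset[OF assms(1)] c] by simp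
qed

lemma subgroup_meet_of: "(\<And>B. B \<in> \<B> \<Longrightarrow> subgroup B G) \<Longrightarrow> subgroup (meet_of G \<B>) G"
  unfolding meet_of_def using subgroups_Inter[of "insert (carrier G) \<B>"] subgroup_self
  by simp blast

lemma meet_of_insert: "meet_of G (insert B \<B>) = B \<inter> meet_of G \<B>"
  unfolding meet_of_def by auto

lemma meet_of_subset: "\<B> \<subseteq> \<C> \<Longrightarrow> meet_of G \<C> \<subseteq> meet_of G \<B>"
  unfolding meet_of_def by auto

lemma virt_leI:
  "\<lbrakk>finite F; F \<subseteq> carrier G; \<And>x. x \<in> H \<Longrightarrow> \<exists>f\<in>F. x \<in> f <# N\<rbrakk> \<Longrightarrow> virt_le G H N"
  unfolding virt_le_def by (intro exI[of _ F]) auto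

lemma virt_le_subset:
  assumes "subgroup N G" "H \<subseteq> N"
  shows "virt_le G H N"
  unfolding virt_le_def
  using assms by (intro exI[of _ "{\<one>}"]) (auto simp: lcos_mult_one subgroup.subset)

lemma virt_le_mono: "\<lbrakk>virt_le G H N; H' \<subseteq> H\<rbrakk> \<Longrightarrow> virt_le G H' N"
  unfolding virt_le_def by (meson subset_trans)

lemma virt_le_trans:
  assumes "virt_le G H N" "virt_le G N P" "P \<subseteq> carrier G"
  shows "virt_le G H P"
proof -
  obtain F where F: "finite F" "F \<subseteq> carrier G" "H \<subseteq> (\<Union>f\<in>F. f <# N)"
    using assms(1) unfolding virt_le_def by auto
  obtain F' where F': "finite F'" "F' \<subseteq> carrier G" "N \<subseteq> (\<Union>f\<in>F'. f <# P)"
    using assms(2) unfolding virt_le_def by auto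
  let ?F = "(\<lambda>(f, f'). f \<otimes> f') ` (F \<times> F')"
  have "x \<in> (\<Union>f\<in>?F. f <# P)" if x: "x \<in> H" for x
  proof -
    obtain f n where f: "f \<in> F" "n \<in> N" "x = f \<otimes> n" using x F(3) unfolding l_coset_def by blast
    obtain f' p where f': "f' \<in> F'" "p \<in> P" "n = f' \<otimes> p" using f F'(3) unfolding l_coset_def by blast
    have "x = (f \<otimes> f') \<otimes> p" using f f' F F' assms(3) by (auto simp: m_assoc subset_iff)
    then have "x \<in> (f \<otimes> f') <# P" using f' unfolding l_coset_def by auto
    then show ?thesis using f f' by blast
  qed
  then show ?thesis unfolding virt_le_def using F F'
    by (intro exI[of _ ?F]) auto
qed

text \<open>Intersecting the two coverings cuts \<open>H\<close> into finitely many pieces, and two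
  points of one piece differ by an element of both \<open>N\<close> and \<open>P\<close>.\<close>

lemma virt_le_Int:
  assumes "virt_le G H N" "virt_le G H P" "subgroup N G" "subgroup P G" "H \<subseteq> carrier G"
  shows "virt_le G H (N \<inter> P)"
proof -
  obtain F where F: "finite F" "F \<subseteq> carrier G" "H \<subseteq> (\<Union>f\<in>F. f <# N)"
    using assms(1) unfolding virt_le_def by auto
  obtain F' where F': "finite F'" "F' \<subseteq> carrier G" "H \<subseteq> (\<Union>f\<in>F'. f <# P)"
    using assms(2) unfolding virt_le_def by auto
  \<comment> \<open>\<open>y\<close> picks a base point in each nonempty piece, which then lies in
    the single coset of \<open>N \<inter> P\<close> through that point; \<open>Q\<close> lists the
    nonempty pieces.\<close>
  define y where "y = (\<lambda>(f, f'). SOME y. y \<in> (f <# N) \<inter> (f' <# P) \<inter> H)"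
  define Q where "Q = {(f, f') \<in> F \<times> F'. (f <# N) \<inter> (f' <# P) \<inter> H \<noteq> {}}"
  have y: "y (f, f') \<in> (f <# N) \<inter> (f' <# P) \<inter> H" if "(f, f') \<in> Q" for f f'
    using that unfolding y_def Q_def by (auto intro: someI2)
  have "x \<in> (\<Union>f\<in>y ` Q. f <# (N \<inter> P))" if x: "x \<in> H" for x
  proof -
    obtain f where f: "f \<in> F" "x \<in> f <# N" using x F(3) by blast
    obtain f' where f': "f' \<in> F'" "x \<in> f' <# P" using x F'(3) by blast
    have q: "(f, f') \<in> Q" unfolding Q_def using f f' x by auto
    have "inv (y (f, f')) \<otimes> x \<in> N" "inv (y (f, f')) \<otimes> x \<in> P"
      using y[OF q] f f' F F' assms inv_mult_lcos_mem by blast+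
    then have "x \<in> y (f, f') <# (N \<inter> P)"
      using y[OF q] x assms by (subst mem_lcos_iff) (auto dest: subgroup.subset)
    then show ?thesis using q by blast
  qed
  moreover have "finite Q" unfolding Q_def by (rule finite_subset[of _ "F \<times> F'"]) (use F F' in auto)
  moreover have "y ` Q \<subseteq> carrier G" using y assms(5) by fastforce
  ultimately show ?thesis by (intro virt_leI[of "y ` Q"]) auto
qed

lemma virt_le_meet_of:
  assumes "finite \<B>" "\<And>B. B \<in> \<B> \<Longrightarrow> subgroup B G \<and> virt_le G H B" "H \<subseteq> carrier G"
  shows "virt_le G H (meet_of G \<B>)"
  using assms(1,2)
proof (induction \<B>)
  case empty
  then show ?case using virt_le_subset[OF subgroup_self assms(3)] by (simp add: meet_of_def)
next
  case (insert B \<B>)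
  show ?case unfolding meet_of_insert
  proof (rule virt_le_Int)
    show "virt_le G H (meet_of G \<B>)" by (rule insert.IH) (rule insert.prems, simp)
    show "subgroup (meet_of G \<B>) G" using insert.prems by (intro subgroup_meet_of) auto
  qed (use insert.prems assms(3) in auto)
qed

lemma virt_le_iff_finite:
  assumes "subgroup N G" "H \<subseteq> carrier G"
  shows "virt_le G H N \<longleftrightarrow> finite ((\<lambda>h. h <# N) ` H)"
proof
  assume "virt_le G H N"
  then obtain F where F: "finite F" "F \<subseteq> carrier G" "H \<subseteq> (\<Union>f\<in>F. f <# N)"
    unfolding virt_le_def by auto
  have "(\<lambda>h. h <# N) ` H \<subseteq> (\<lambda>h. h <# N) ` F"
  proof
    fix C assume "C \<in> (\<lambda>h. h <# N) ` H"
    then obtain h where "h \<in> H" "C = h <# N" by auto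
    moreover then obtain f where "f \<in> F" "h \<in> f <# N" using F by auto
    ultimately show "C \<in> (\<lambda>h. h <# N) ` F"
      using lcos_eqI[OF assms(1), of f h] F by auto
  qed
  then show "finite ((\<lambda>h. h <# N) ` H)" using F(1) finite_surj by auto
next
  assume "finite ((\<lambda>h. h <# N) ` H)"
  then obtain F where F: "F \<subseteq> H" "finite F" "(\<lambda>h. h <# N) ` H = (\<lambda>h. h <# N) ` F"
    using finite_image_repr by metis
  have "H \<subseteq> (\<Union>f\<in>F. f <# N)"
  proof
    fix h assume h: "h \<in> H"
    then obtain f where "f \<in> F" "h <# N = f <# N" using F by blast
    then show "h \<in> (\<Union>f\<in>F. f <# N)" using mem_lcos_self[OF assms(1), of h] h assms by auto
  qed
  then show "virt_le G H N" using F assms by (intro virt_leI[of F]) auto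
qed

lemma lcos_translate:
  assumes "N \<subseteq> carrier G" "a \<in> carrier G" "f \<in> carrier G" "x \<in> carrier G"
  shows "a \<otimes> x \<in> f <# N \<longleftrightarrow> x \<in> (inv a \<otimes> f) <# N"
  using assms by (simp add: mem_lcos_iff inv_mult_group m_assoc)

text \<open>B. H. Neumann's lemma, eliminating one subgroup at a time. If \<open>X\<close> is not
  virtually contained in \<open>B\<close>, some coset \<open>x B\<close> with \<open>x\<close> in
  \<open>X\<close> is missing from the covering, so \<open>x B \<inter> X\<close> is covered by
  cosets of the other subgroups. Every nonempty \<open>f B \<inter> X\<close> is a translate of it
  and therefore covered by them as well.\<close>

lemma neumann_covering:
  assumes "finite \<B>" "\<And>B. B \<in> \<B> \<Longrightarrow> subgroup B G" "subgroup X G"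
    and "\<And>B. B \<in> \<B> \<Longrightarrow> finite (F B) \<and> F B \<subseteq> carrier G"
    and "X \<subseteq> (\<Union>B\<in>\<B>. \<Union>f\<in>F B. f <# B)"
  shows "\<exists>B\<in>\<B>. virt_le G X B"
  using assms(1,2,4,5)
proof (induction \<B> arbitrary: F)
  case empty
  then show ?case using subgroup.one_closed[OF assms(3)] by auto
next
  case (insert B \<B>)
  have B: "subgroup B G" using insert by auto
  have Bs: "B' \<subseteq> carrier G" if "B' \<in> \<B>" for B' using insert.prems(1)[of B'] that by (auto dest: subgroup.subset)
  have Xc: "X \<subseteq> carrier G" using assms(3) by (rule subgroup.subset)
  have FB: "finite (F B)" "F B \<subseteq> carrier G" using insert.prems(2)[of B] by auto
  show ?case
  proof (cases "virt_le G X B")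
    case False
    then obtain x where x: "x \<in> X" "\<And>f. f \<in> F B \<Longrightarrow> x \<notin> f <# B"
      using virt_leI[OF FB, of X B] by auto
    have xc: "x \<in> carrier G" using x Xc by auto
    have xdisj: "y \<notin> f <# B" if "f \<in> F B" "y \<in> x <# B" for y f
      using that x(2)[of f] lcos_eqI[OF B xc that(2)] lcos_eqI[OF B, of f y] FB
        mem_lcos_self[OF B xc] by auto
    define y where "y f = (SOME y. y \<in> (f <# B) \<inter> X)" for f
    define K where "K = {f \<in> F B. (f <# B) \<inter> X \<noteq> {}}"
    have K: "finite K" unfolding K_def using FB by auto
    \<comment> \<open>Multiplication by \<open>y f \<otimes> inv x\<close> carries
      \<open>x B \<inter> X\<close> onto \<open>f B \<inter> X\<close> and takes the covering cosets
      along.\<close>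
    define F' where "F' B' = F B' \<union> (\<lambda>(f, g). y f \<otimes> inv x \<otimes> g) ` (K \<times> F B')" for B'
    have y: "y f \<in> (f <# B) \<inter> X" if "f \<in> K" for f
      unfolding y_def using that[unfolded K_def] by (auto intro: someI2)
    have "\<exists>B\<in>\<B>. virt_le G X B"
    proof (rule insert.IH)
      show "finite (F' B') \<and> F' B' \<subseteq> carrier G" if "B' \<in> \<B>" for B'
      proof -
        have "finite (F B')" "F B' \<subseteq> carrier G" using insert.prems(2)[of B'] that by auto
        moreover have "y f \<otimes> inv x \<otimes> g \<in> carrier G"
          if "f \<in> K" "g \<in> carrier G" for f g
          using y[OF that(1)] Xc xc that(2) by (intro m_closed) auto
        moreover have "finite (F' B')" unfolding F'_def using K calculation(1) by auto
        ultimately show ?thesis unfolding F'_def by auto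
      qed
      show "X \<subseteq> (\<Union>B\<in>\<B>. \<Union>f\<in>F' B. f <# B)"
      proof
        fix z assume z: "z \<in> X"
        then have zc: "z \<in> carrier G" using Xc by auto
        obtain B' f where f: "B' \<in> insert B \<B>" "f \<in> F B'" "z \<in> f <# B'" using z insert.prems(3) by blast
        show "z \<in> (\<Union>B\<in>\<B>. \<Union>f\<in>F' B. f <# B)"
        proof (cases "B' \<in> \<B>")
          case True
          then show ?thesis using f unfolding F'_def by blast
        next
          case False
          then have f': "f \<in> F B" "z \<in> f <# B" using f by auto
          have fK: "f \<in> K" unfolding K_def using f' z by auto
          have yf: "y f \<in> f <# B" "y f \<in> X" using y[OF fK] by auto
          have yc: "y f \<in> carrier G" using yf Xc by auto
          have fc: "f \<in> carrier G" using f' FB by auto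
          have "inv (y f) \<otimes> z \<in> B" using inv_mult_lcos_mem[OF B fc yf(1) f'(2)] .
          moreover have iX: "inv (y f) \<otimes> z \<in> X"
            using yf z assms(3) by (simp add: subgroup.m_closed subgroup.m_inv_closed)
          ultimately have w1: "x \<otimes> (inv (y f) \<otimes> z) \<in> x <# B" unfolding l_coset_def by blast
          have w2: "x \<otimes> (inv (y f) \<otimes> z) \<in> X" using x iX assms(3) by (simp add: subgroup.m_closed)
          obtain C g where g: "C \<in> insert B \<B>" "g \<in> F C" "x \<otimes> (inv (y f) \<otimes> z) \<in> g <# C"
            using w2 insert.prems(3) by blast
          then have C: "C \<in> \<B>" using xdisj w1 by blast
          have gc: "g \<in> carrier G" using insert.prems(2)[of C] g C by auto
          have "inv (y f \<otimes> inv x \<otimes> g) \<otimes> z = inv g \<otimes> (x \<otimes> (inv (y f) \<otimes> z))"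
            using gc xc yc zc by (simp add: inv_mult_group m_assoc)
          then have "z \<in> (y f \<otimes> inv x \<otimes> g) <# C"
            using g(3) gc xc yc zc Bs[OF C] iX by (simp add: mem_lcos_iff)
          moreover have "y f \<otimes> inv x \<otimes> g \<in> F' C" unfolding F'_def using fK g by auto
          ultimately show ?thesis using C by blast
        qed
      qed
    qed (use insert.prems(1) in auto)
    then show ?thesis by auto
  next
    case True
    then show ?thesis by simp
  qed
qed

text \<open>\<open>inv\<close> says that \<open>S\<close> is a Boolean combination of the cosets in
  \<open>\<C>\<close>. By Neumann's lemma some \<open>x\<close> in \<open>S \<inter> D\<close>
  avoids all those cosets whose subgroup does not virtually contain \<open>S\<close>. For
  \<open>z\<close> in \<open>D\<close>, the points \<open>x\<close> and \<open>x \<otimes> z\<close>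
  agree on the cosets of the remaining subgroups, so \<open>z\<close> is in \<open>S\<close> unless
  \<open>x \<otimes> z\<close> falls into an avoided coset. Thus \<open>D\<close> is covered by
  \<open>S\<close> and finitely many cosets of subgroups that cannot virtually contain
  \<open>D\<close>, and Neumann's lemma leaves only \<open>S\<close>.\<close>

lemma boolean_comb_subgroup:
  assumes "finite \<B>" and sub: "\<And>B. B \<in> \<B> \<Longrightarrow> subgroup B G" and S: "subgroup S G"
    and "finite \<C>" and cos: "\<And>C. C \<in> \<C> \<Longrightarrow> \<exists>a\<in>carrier G. \<exists>B\<in>\<B>. C = a <# B"
    and inv: "\<And>y y'. \<lbrakk>y \<in> carrier G; y' \<in> carrier G; \<And>C. C \<in> \<C> \<Longrightarrow> y \<in> C \<longleftrightarrow> y' \<in> C; y \<in> S\<rbrakk> \<Longrightarrow> y' \<in> S"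
  defines "D \<equiv> meet_of G {B \<in> \<B>. virt_le G S B}"
  shows "virt_le G S D" "virt_le G D S"
proof -
  let ?J = "{B \<in> \<B>. virt_le G S B}"
  have D: "subgroup D G" unfolding D_def by (rule subgroup_meet_of) (use sub in auto)
  have Sc: "S \<subseteq> carrier G" using S by (rule subgroup.subset)
  have Dc: "D \<subseteq> carrier G" using D by (rule subgroup.subset)
  show SD: "virt_le G S D"
    unfolding D_def by (rule virt_le_meet_of) (use assms(1) sub Sc in auto)
  have SSD: "virt_le G S (S \<inter> D)"
    by (rule virt_le_Int) (use SD S D Sc in \<open>auto intro: virt_le_subset\<close>)
  have SDg: "subgroup (S \<inter> D) G" using S D by (rule subgroups_Inter_pair)
  \<comment> \<open>One representative per coset in \<open>\<C>\<close>, filed under every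
    \<open>B\<close> for which it still represents a member of \<open>\<C>\<close>; this keeps
    \<open>F B\<close> finite.\<close>
  define F where "F B = {a \<in> (\<lambda>C. SOME a. a \<in> carrier G \<and> (\<exists>B\<in>\<B>. C = a <# B)) ` \<C>. a <# B \<in> \<C> \<and> a \<in> carrier G}" for B
  have Ffin: "finite (F B)" "F B \<subseteq> carrier G" for B unfolding F_def using assms(4) by auto
  have repr: "\<exists>B\<in>\<B>. \<exists>f\<in>F B. C = f <# B" if C: "C \<in> \<C>" for C
  proof -
    define a where "a = (SOME a. a \<in> carrier G \<and> (\<exists>B\<in>\<B>. C = a <# B))"
    have a: "a \<in> carrier G \<and> (\<exists>B\<in>\<B>. C = a <# B)"
      unfolding a_def by (rule someI_ex) (use cos[OF C] in blast)
    then obtain B where B: "B \<in> \<B>" "C = a <# B" by auto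
    have "a \<in> (\<lambda>C. SOME a. a \<in> carrier G \<and> (\<exists>B\<in>\<B>. C = a <# B)) ` \<C>"
      unfolding a_def using C by (rule imageI)
    then have "a \<in> F B" unfolding F_def using C a B by simp
    then show ?thesis using B by auto
  qed
  \<comment> \<open>\<open>S \<inter> D\<close> has finite index in \<open>S\<close>, so such a
    covering would put \<open>S\<close> virtually inside a member of \<open>\<B> - ?J\<close>,
    against the choice of \<open>?J\<close>.\<close>
  have "\<not> S \<inter> D \<subseteq> (\<Union>B\<in>\<B> - ?J. \<Union>f\<in>F B. f <# B)"
  proof
    assume "S \<inter> D \<subseteq> (\<Union>B\<in>\<B> - ?J. \<Union>f\<in>F B. f <# B)"
    then obtain B where B: "B \<in> \<B> - ?J" "virt_le G (S \<inter> D) B"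
      using neumann_covering[of "\<B> - ?J" "S \<inter> D" F] Ffin assms(1) sub SDg by auto
    then have "virt_le G S B"
      using virt_le_trans[OF SSD] sub[of B] by (auto dest: subgroup.subset)
    then show False using B by auto
  qed
  then obtain x where x: "x \<in> S" "x \<in> D" "\<And>B f. \<lbrakk>B \<in> \<B> - ?J; f \<in> F B\<rbrakk> \<Longrightarrow> x \<notin> f <# B" by blast
  have xc: "x \<in> carrier G" using x Sc by auto
  \<comment> \<open>The coset \<open>\<one> S\<close> takes the \<open>z\<close> that end up in
    \<open>S\<close>; the translates by \<open>inv x\<close> take those for which
    \<open>x \<otimes> z\<close> falls into an avoided coset.\<close>
  define F' where "F' B = (if B = S then {\<one>} else {}) \<union> (\<lambda>f. inv x \<otimes> f) ` F B" for B
  have "D \<subseteq> (\<Union>B\<in>insert S (\<B> - ?J). \<Union>f\<in>F' B. f <# B)"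
  proof
    fix z assume z: "z \<in> D"
    then have zc: "z \<in> carrier G" using Dc by auto
    show "z \<in> (\<Union>B\<in>insert S (\<B> - ?J). \<Union>f\<in>F' B. f <# B)"
    proof (cases "\<exists>B\<in>\<B> - ?J. \<exists>f\<in>F B. x \<otimes> z \<in> f <# B")
      case True
      then obtain B f where B: "B \<in> \<B> - ?J" "f \<in> F B" "x \<otimes> z \<in> f <# B" by auto
      have "z \<in> (inv x \<otimes> f) <# B"
        using B Ffin[of B] sub[of B] lcos_translate[of B x f z] xc zc by (auto dest: subgroup.subset)
      then show ?thesis using B unfolding F'_def by blast
    next
      case False
      have "x \<otimes> z \<in> S"
      proof (rule inv[of x])
        fix C assume "C \<in> \<C>"
        then obtain B f where B: "B \<in> \<B>" "f \<in> F B" "C = f <# B" using repr by blast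
        have fc: "f \<in> carrier G" using B Ffin by auto
        have Bg: "subgroup B G" using B sub by auto
        show "x \<in> C \<longleftrightarrow> x \<otimes> z \<in> C"
        proof (cases "B \<in> ?J")
          case True
          then have zB: "z \<in> B" using z unfolding D_def meet_of_def by auto
          have "inv f \<otimes> (x \<otimes> z) \<in> B \<longleftrightarrow> (inv f \<otimes> x) \<in> B"
          proof
            assume a: "inv f \<otimes> (x \<otimes> z) \<in> B"
            have "inv f \<otimes> x = (inv f \<otimes> (x \<otimes> z)) \<otimes> inv z" using fc xc zc by (simp add: m_assoc)
            then show "inv f \<otimes> x \<in> B" using a zB Bg by (metis subgroup.m_closed subgroup.m_inv_closed)
          next
            assume "inv f \<otimes> x \<in> B"
            moreover have "inv f \<otimes> (x \<otimes> z) = (inv f \<otimes> x) \<otimes> z" using fc xc zc by (simp add: m_assoc)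
            ultimately show "inv f \<otimes> (x \<otimes> z) \<in> B" using zB Bg by (metis subgroup.m_closed)
          qed
          then show ?thesis using B fc xc zc Bg by (simp add: mem_lcos_iff subgroup.subset)
        next
          case False
          then show ?thesis using B x(3) \<open>\<not> (\<exists>B\<in>\<B> - ?J. \<exists>f\<in>F B. x \<otimes> z \<in> f <# B)\<close> by blast
        qed
      qed (use x(1) xc zc in auto)
      then have "z \<in> S"
        using x(1) S xc zc by (metis inv_solve_left' subgroup.m_closed subgroup.m_inv_closed m_closed)
      then have "z \<in> \<one> <# S" using Sc by (simp add: lcos_mult_one)
      then show ?thesis unfolding F'_def by auto
    qed
  qed
  moreover have "finite (F' B) \<and> F' B \<subseteq> carrier G" for B
    using Ffin[of B] xc unfolding F'_def by (auto simp: subset_iff)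
  ultimately have "\<exists>B\<in>insert S (\<B> - ?J). virt_le G D B"
    using assms(1) sub S by (intro neumann_covering[where F = F'] D) auto
  moreover have "\<not> virt_le G D B" if "B \<in> \<B> - ?J" for B
    using that virt_le_trans[OF SD, of B] sub[of B] by (auto dest: subgroup.subset)
  ultimately show "virt_le G D S" by auto
qed

section \<open>Conjugates and double cosets\<close>

lemma conj_set_subgroup:
  assumes "subgroup H G" "g \<in> carrier G"
  shows "subgroup (conj_set G g H) G"
proof (rule subgroupI)
  have Hc: "H \<subseteq> carrier G" using assms(1) by (rule subgroup.subset)
  show "conj_set G g H \<subseteq> carrier G" using Hc assms by (auto simp: conj_set_def)
  show "conj_set G g H \<noteq> {}" using assms by (auto simp: conj_set_def dest: subgroup.one_closed)
  fix a assume "a \<in> conj_set G g H"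
  then obtain h where h: "h \<in> H" "a = g \<otimes> h \<otimes> inv g" by (auto simp: conj_set_def)
  have "inv a = g \<otimes> inv h \<otimes> inv g" using h Hc assms by (simp add: inv_mult_group m_assoc subset_iff)
  then show "inv a \<in> conj_set G g H" using h assms by (auto simp: conj_set_def subgroup.m_inv_closed)
  fix b assume "b \<in> conj_set G g H"
  then obtain k where k: "k \<in> H" "b = g \<otimes> k \<otimes> inv g" by (auto simp: conj_set_def)
  have c: "h \<in> carrier G" "k \<in> carrier G" using h k Hc by auto
  have "inv g \<otimes> (g \<otimes> (k \<otimes> inv g)) = k \<otimes> inv g" using c assms by (simp add: m_assoc[symmetric])
  then have "a \<otimes> b = g \<otimes> (h \<otimes> k) \<otimes> inv g" using h(2) k(2) c assms by (simp add: m_assoc)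
  then show "a \<otimes> b \<in> conj_set G g H" using h k assms by (auto simp: conj_set_def subgroup.m_closed)
qed

lemma conj_set_mult:
  assumes "H \<subseteq> carrier G" "a \<in> carrier G" "b \<in> carrier G"
  shows "conj_set G a (conj_set G b H) = conj_set G (a \<otimes> b) H"
  using assms unfolding conj_set_def image_image
  by (intro image_cong) (auto simp: inv_mult_group m_assoc subset_iff)

lemma conj_set_one: "H \<subseteq> carrier G \<Longrightarrow> conj_set G \<one> H = H"
  unfolding conj_set_def by (auto simp: subset_iff image_iff)

text \<open>Free of inverses, because the language is only known to have a symbol for
  multiplication; \<open>conj_definable\<close> turns the right-hand side into a formula.\<close>

lemma mem_conj_set_iff:
  assumes "H \<subseteq> carrier G" "g \<in> carrier G" "x \<in> carrier G"
  shows "x \<in> conj_set G g H \<longleftrightarrow> (\<exists>h\<in>H. x \<otimes> g = g \<otimes> h)"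
proof -
  have "x = g \<otimes> h \<otimes> inv g \<longleftrightarrow> x \<otimes> g = g \<otimes> h" if "h \<in> H" for h
    using that assms by (metis inv_solve_right m_closed subsetD)
  then show ?thesis unfolding conj_set_def image_iff by blast
qed

lemma virt_le_conj_set:
  assumes "virt_le G H N" "H \<subseteq> carrier G" "N \<subseteq> carrier G" "a \<in> carrier G"
  shows "virt_le G (conj_set G a H) (conj_set G a N)"
proof -
  obtain F where F: "finite F" "F \<subseteq> carrier G" "H \<subseteq> (\<Union>f\<in>F. f <# N)"
    using assms(1) unfolding virt_le_def by auto
  have "x \<in> (\<Union>f\<in>conj_set G a F. f <# conj_set G a N)" if x: "x \<in> conj_set G a H" for x
  proof -
    obtain h where h: "h \<in> H" "x = a \<otimes> h \<otimes> inv a" using x unfolding conj_set_def by auto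
    obtain f n where f: "f \<in> F" "n \<in> N" "h = f \<otimes> n" using h F(3) unfolding l_coset_def by blast
    have c: "f \<in> carrier G" "n \<in> carrier G" using f F assms by auto
    have "inv a \<otimes> (a \<otimes> (n \<otimes> inv a)) = n \<otimes> inv a" using c assms by (simp add: m_assoc[symmetric])
    then have "x = (a \<otimes> f \<otimes> inv a) \<otimes> (a \<otimes> n \<otimes> inv a)"
      using h(2) f(3) c assms(4) by (simp add: m_assoc)
    then show ?thesis using f unfolding conj_set_def l_coset_def by blast
  qed
  moreover have "finite (conj_set G a F)" "conj_set G a F \<subseteq> carrier G"
    using F assms unfolding conj_set_def by auto
  ultimately show ?thesis by (intro virt_leI[of "conj_set G a F"]) auto
qed

definition dcos :: "'a set \<Rightarrow> 'a \<Rightarrow> 'a set" where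
  "dcos S g = {a \<otimes> g \<otimes> b | a b. a \<in> S \<and> b \<in> S}"

lemma dcosI: "\<lbrakk>a \<in> S; b \<in> S; y = a \<otimes> g \<otimes> b\<rbrakk> \<Longrightarrow> y \<in> dcos S g"
  unfolding dcos_def by blast

lemma dcos_self: "\<lbrakk>subgroup S G; g \<in> carrier G\<rbrakk> \<Longrightarrow> g \<in> dcos S g"
  by (rule dcosI[of \<one> S \<one>]) (auto dest: subgroup.one_closed)

lemma dcos_mult:
  assumes "subgroup S G" "g \<in> carrier G" "y \<in> dcos S g" "a \<in> S" "b \<in> S"
  shows "a \<otimes> y \<otimes> b \<in> dcos S g"
proof -
  obtain c d where y: "y = c \<otimes> g \<otimes> d" "c \<in> S" "d \<in> S" using assms(3) unfolding dcos_def by auto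
  have "S \<subseteq> carrier G" using assms(1) by (rule subgroup.subset)
  then have "a \<otimes> y \<otimes> b = (a \<otimes> c) \<otimes> g \<otimes> (d \<otimes> b)" using y assms by (simp add: m_assoc subset_iff)
  then show ?thesis using y assms by (intro dcosI[of "a \<otimes> c" S "d \<otimes> b"]) (simp_all add: subgroup.m_closed)
qed

lemma dcos_sym:
  assumes "subgroup S G" "g \<in> carrier G" "y \<in> dcos S g"
  shows "g \<in> dcos S y"
proof -
  obtain c d where y: "y = c \<otimes> g \<otimes> d" "c \<in> S" "d \<in> S" using assms(3) unfolding dcos_def by auto
  have S: "S \<subseteq> carrier G" using assms(1) by (rule subgroup.subset)
  have c: "c \<in> carrier G" "d \<in> carrier G" using S y by auto
  have "inv c \<otimes> y \<otimes> inv d = (inv c \<otimes> c) \<otimes> g \<otimes> (d \<otimes> inv d)"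
    using y(1) c assms(2) by (simp only: m_assoc m_closed inv_closed)
  then have "g = inv c \<otimes> y \<otimes> inv d" using c assms(2) by simp
  then show ?thesis using y assms by (intro dcosI[of "inv c" S "inv d"]) (simp_all add: subgroup.m_inv_closed)
qed

lemma dcos_eq:
  assumes "subgroup S G" "g \<in> carrier G" "y \<in> dcos S g"
  shows "dcos S y = dcos S g"
proof -
  have sub: "dcos S y \<subseteq> dcos S g" if "g \<in> carrier G" "y \<in> dcos S g" for g y
    using dcos_mult[OF assms(1) that] unfolding dcos_def[of S y] by auto
  have "S \<subseteq> carrier G" using assms(1) by (rule subgroup.subset)
  then have "y \<in> carrier G" using assms unfolding dcos_def by auto
  then show ?thesis using sub[OF assms(2,3)] sub dcos_sym[OF assms] by blast
qed

text \<open>Suppose there were finitely many double cosets, and let \<open>N\<close> consist of the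
  \<open>g\<close> in \<open>X\<close> with \<open>g^-1 S g\<close> virtually contained in
  \<open>S\<close>. The conjugates of \<open>S\<close> fall into finitely many classes, so finitely
  many translates of \<open>N\<close> cover \<open>X\<close>. For \<open>e\<close> in
  \<open>N\<close>, the double coset \<open>S e S = e (e^-1 S e) S\<close> is covered by finitely
  many cosets of \<open>S\<close>. Hence \<open>N\<close>, and with it \<open>X\<close>, would be
  virtually contained in \<open>S\<close>.\<close>

lemma infinite_dcos:
  assumes S: "subgroup S G" and X: "subgroup X G" and nv: "\<not> virt_le G X S"
    and fin: "finite \<D>" "\<And>D. D \<in> \<D> \<Longrightarrow> D \<subseteq> carrier G"
    and conj: "\<And>g. g \<in> carrier G \<Longrightarrow> \<exists>D\<in>\<D>. virt_le G (conj_set G g S) D \<and> virt_le G D (conj_set G g S)"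
  shows "infinite (dcos S ` X)"
proof
  assume finX: "finite (dcos S ` X)"
  have Sc: "S \<subseteq> carrier G" using S by (rule subgroup.subset)
  have Xc: "X \<subseteq> carrier G" using X by (rule subgroup.subset)
  obtain D where D: "\<And>g. g \<in> carrier G \<Longrightarrow> D g \<in> \<D> \<and> virt_le G (conj_set G g S) (D g) \<and> virt_le G (D g) (conj_set G g S)"
    using conj by metis
  have "finite (D ` X)" using D Xc by (intro finite_subset[OF _ fin(1)]) auto
  then obtain E where E: "E \<subseteq> X" "finite E" "D ` X = D ` E" using finite_image_repr by metis
  have conjmem: "conj_set G g S \<subseteq> carrier G" if "g \<in> carrier G" for g
    using conj_set_subgroup[OF S that] by (rule subgroup.subset)
  define N where "N = {g \<in> X. virt_le G (conj_set G (inv g) S) S}"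
  have XN: "X \<subseteq> (\<Union>e\<in>E. e <# N)"
  proof
    fix x assume x: "x \<in> X"
    \<comment> \<open>Pigeonhole on the class of the conjugate: if \<open>D e = D x\<close>, the
      conjugates by \<open>e\<close> and \<open>x\<close> are commensurable, and conjugating back by
      \<open>inv x\<close> puts \<open>inv e \<otimes> x\<close> into \<open>N\<close>.\<close>
    then obtain e where e: "e \<in> E" "D e = D x" using E by (metis imageE imageI)
    have c: "x \<in> carrier G" "e \<in> carrier G" using x e E Xc by auto
    have "virt_le G (conj_set G e S) (conj_set G x S)"
      using D[OF c(1)] D[OF c(2)] e(2) virt_le_trans conjmem[OF c(1)] by metis
    then have "virt_le G (conj_set G (inv x) (conj_set G e S)) (conj_set G (inv x) (conj_set G x S))"
      by (rule virt_le_conj_set) (use c conjmem in auto)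
    then have "virt_le G (conj_set G (inv x \<otimes> e) S) S"
      using c Sc by (simp add: conj_set_mult conj_set_one)
    moreover have "inv (inv e \<otimes> x) = inv x \<otimes> e" using c by (simp add: inv_mult_group)
    moreover have "inv e \<otimes> x \<in> X" using x e E X by (auto simp: subgroup.m_closed subgroup.m_inv_closed)
    ultimately have "inv e \<otimes> x \<in> N" unfolding N_def by auto
    then have "x \<in> e <# N" using c by (subst mem_lcos_iff) (use Xc N_def in auto)
    then show "x \<in> (\<Union>e\<in>E. e <# N)" using e by auto
  qed
  have vXN: "virt_le G X N" using XN E Xc by (intro virt_leI[of E]) auto
  have "virt_le G N S"
  proof -
    have "finite (dcos S ` N)" by (rule finite_subset[OF _ finX]) (auto simp: N_def)
    then obtain E' where E': "E' \<subseteq> N" "finite E'" "dcos S ` N = dcos S ` E'"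
      using finite_image_repr by metis
    have ec: "e \<in> carrier G" if "e \<in> E'" for e using that E' N_def Xc by auto
    have "\<exists>F. finite F \<and> F \<subseteq> carrier G \<and> conj_set G (inv e) S \<subseteq> (\<Union>f\<in>F. f <# S)" if "e \<in> E'" for e
      using that E' unfolding N_def virt_le_def by blast
    then obtain F where F: "\<And>e. e \<in> E' \<Longrightarrow> finite (F e) \<and> F e \<subseteq> carrier G \<and> conj_set G (inv e) S \<subseteq> (\<Union>f\<in>F e. f <# S)"
      by metis
    let ?F = "\<Union>e\<in>E'. (\<lambda>f. e \<otimes> f) ` F e"
    have "N \<subseteq> (\<Union>f\<in>?F. f <# S)"
    proof
      fix x assume x: "x \<in> N"
      then obtain e where e: "e \<in> E'" "dcos S x = dcos S e" using E' by (metis imageE imageI)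
      have xc: "x \<in> carrier G" using x N_def Xc by auto
      have "x \<in> dcos S e" using dcos_self[OF S xc] e by auto
      then obtain a b where ab: "a \<in> S" "b \<in> S" "x = a \<otimes> e \<otimes> b" unfolding dcos_def by auto
      have "inv e \<otimes> a \<otimes> e \<in> conj_set G (inv e) S" using ab ec[OF e(1)] unfolding conj_set_def by auto
      then obtain f s where f: "f \<in> F e" "s \<in> S" "inv e \<otimes> a \<otimes> e = f \<otimes> s" using F[OF e(1)] unfolding l_coset_def by blast
      have c: "a \<in> carrier G" "b \<in> carrier G" "e \<in> carrier G" "f \<in> carrier G" "s \<in> carrier G"
        using ab f e ec F Sc by auto
      \<comment> \<open>Moving \<open>e\<close> to the front replaces the left factor
        \<open>a\<close> by a conjugate, which the cosets of \<open>S\<close> at \<open>F e\<close>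
        cover.\<close>
      have "x = e \<otimes> (inv e \<otimes> a \<otimes> e) \<otimes> b" using ab(3) c by (simp add: m_assoc[symmetric])
      also have "\<dots> = (e \<otimes> f) \<otimes> (s \<otimes> b)" unfolding f(3) using c by (simp add: m_assoc)
      finally have "x \<in> (e \<otimes> f) <# S" unfolding l_coset_def using f ab S by (auto simp: subgroup.m_closed)
      then show "x \<in> (\<Union>f\<in>?F. f <# S)" using e f by blast
    qed
    moreover have "finite ?F" "?F \<subseteq> carrier G" using F E' ec by (auto simp: subset_iff)
    ultimately show ?thesis by (intro virt_leI[of ?F]) blast+
  qed
  then show False using nv virt_le_trans[OF vXN _ Sc] by blast
qed

text \<open>Recursive, since the order of the factors matters.\<close>

primrec gprod :: "(nat \<Rightarrow> 'a) \<Rightarrow> nat \<Rightarrow> 'a" where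
  "gprod g 0 = \<one>"
| "gprod g (Suc n) = gprod g n \<otimes> g n"

text \<open>Double cosets rather than cosets make the paths of the array intersect without any normality
  assumption.\<close>

lemma gprod_mem_dcos:
  assumes sub: "\<And>i. i < d \<Longrightarrow> subgroup (H i) G"
    and g: "\<And>i j. \<lbrakk>i < d; j < d; j \<noteq> i\<rbrakk> \<Longrightarrow> g j \<in> H i" "\<And>i. i < d \<Longrightarrow> g i \<in> carrier G"
    and "i < d" "n \<le> d"
  shows "(if i < n then gprod g n \<in> dcos (H i) (g i) else gprod g n \<in> H i)"
  using assms(5)
proof (induction n)
  case 0
  then show ?case using subgroup.one_closed[OF sub[OF assms(4)]] by simp
next
  case (Suc n)
  have H: "subgroup (H i) G" using sub assms(4) by auto
  consider "i < n" | "i = n" | "n < i" by linarith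
  then show ?case
  proof cases
    case 1
    then have gn: "g n \<in> H i" using g(1)[of i n] Suc assms(4) by auto
    have p: "gprod g n \<in> dcos (H i) (g i)" using 1 Suc by auto
    then have "gprod g n \<in> carrier G"
      using subgroup.subset[OF H] g(2)[OF assms(4)] unfolding dcos_def by (auto simp: subset_iff)
    moreover have "\<one> \<otimes> gprod g n \<otimes> g n \<in> dcos (H i) (g i)"
      by (rule dcos_mult) (use H g assms(4) p gn subgroup.one_closed in auto)
    ultimately show ?thesis using 1 by simp
  next
    case 2
    then have p: "gprod g n \<in> H i" using Suc by auto
    have "gprod g n \<otimes> g n \<otimes> \<one> \<in> dcos (H i) (g i)"
      unfolding dcos_def using p H 2 by (auto dest: subgroup.one_closed)
    then show ?thesis using 2 p subgroup.subset[OF H] g(2)[OF assms(4)] by auto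
  next
    case 3
    then have "gprod g n \<in> H i" "g n \<in> H i" using Suc g(1)[of i n] assms(4) by auto
    then show ?thesis using 3 H by (simp add: subgroup.m_closed)
  qed
qed

text \<open>The trace of \<open>y\<close> on \<open>\<C>\<close> is fixed by three data: the set
  \<open>I\<close> of subgroups whose coset through \<open>y\<close> belongs to \<open>\<C>\<close>;
  these cosets for the at most \<open>d\<close> subgroups in \<open>J I\<close>; and the choice of
  one of the finitely many cosets of the meet of \<open>I\<close> that cover the meet of
  \<open>J I\<close>. Only the second grows with \<open>\<C>\<close>, with degree at most
  \<open>d\<close>.\<close>

lemma count_coset_traces:
  assumes fin: "finite \<B>" and sub: "\<And>B. B \<in> \<B> \<Longrightarrow> subgroup B G"
    and red: "\<And>I. I \<subseteq> \<B> \<Longrightarrow> \<exists>J\<subseteq>I. card J \<le> d \<and> virt_le G (meet_of G J) (meet_of G I)"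
  shows "\<exists>c. \<forall>\<C>. finite \<C> \<and> (\<forall>C\<in>\<C>. \<exists>a\<in>carrier G. \<exists>B\<in>\<B>. C = a <# B) \<longrightarrow>
           finite ((\<lambda>y. {C \<in> \<C>. y \<in> C}) ` carrier G) \<and>
           card ((\<lambda>y. {C \<in> \<C>. y \<in> C}) ` carrier G) \<le> c * (card \<C> + 1) ^ d"
proof -
  have "\<exists>J F. J \<subseteq> I \<and> card J \<le> d \<and> finite F \<and> F \<subseteq> carrier G \<and> meet_of G J \<subseteq> (\<Union>f\<in>F. f <# meet_of G I)"
    if "I \<subseteq> \<B>" for I
    using red[OF that] unfolding virt_le_def by blast
  then obtain J F where JF: "\<And>I. I \<subseteq> \<B> \<Longrightarrow> J I \<subseteq> I \<and> card (J I) \<le> d \<and> finite (F I) \<and> F I \<subseteq> carrier G \<and>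
      meet_of G (J I) \<subseteq> (\<Union>f\<in>F I. f <# meet_of G I)"
    by metis
  \<comment> \<open>Sums over all \<open>I\<close> the number of choices for the third
    datum.\<close>
  let ?c = "\<Sum>I\<in>Pow \<B>. card (F I)"
  have "finite ((\<lambda>y. {C \<in> \<C>. y \<in> C}) ` carrier G) \<and>
      card ((\<lambda>y. {C \<in> \<C>. y \<in> C}) ` carrier G) \<le> ?c * (card \<C> + 1) ^ d"
    if C: "finite \<C>" "\<forall>C\<in>\<C>. \<exists>a\<in>carrier G. \<exists>B\<in>\<B>. C = a <# B" for \<C>
  proof -
    define T where "T y = {C \<in> \<C>. y \<in> C}" for y
    have T: "T y = (\<lambda>B. y <# B) ` {B \<in> \<B>. y <# B \<in> \<C>}" if y: "y \<in> carrier G" for y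
    proof
      show "T y \<subseteq> (\<lambda>B. y <# B) ` {B \<in> \<B>. y <# B \<in> \<C>}"
      proof
        fix C assume "C \<in> T y"
        then have Cy: "C \<in> \<C>" "y \<in> C" unfolding T_def by auto
        then obtain a B where "a \<in> carrier G" "B \<in> \<B>" "C = a <# B" using C(2) by blast
        then show "C \<in> (\<lambda>B. y <# B) ` {B \<in> \<B>. y <# B \<in> \<C>}"
          using Cy lcos_eqI[of B a y] sub by auto
      qed
      show "(\<lambda>B. y <# B) ` {B \<in> \<B>. y <# B \<in> \<C>} \<subseteq> T y"
        unfolding T_def using mem_lcos_self sub y by auto
    qed
    define Y where "Y I \<kappa> = {y \<in> carrier G. {B \<in> \<B>. y <# B \<in> \<C>} = I \<and> (\<forall>B\<in>J I. y <# B = \<kappa> B)}" for I \<kappa>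
    have cardY: "finite (T ` Y I \<kappa>) \<and> card (T ` Y I \<kappa>) \<le> card (F I)" if I: "I \<subseteq> \<B>" for I \<kappa>
    proof (cases "Y I \<kappa> = {}")
      case False
      then obtain y0 where y0: "y0 \<in> Y I \<kappa>" by auto
      have y0c: "y0 \<in> carrier G" using y0 Y_def by auto
      \<comment> \<open>Relative to one point \<open>y0\<close> of the class, every other
        \<open>y\<close> differs by an element of the meet of \<open>J I\<close>, hence modulo the
        meet of \<open>I\<close> by some \<open>f\<close> in \<open>F I\<close>. The trace then
        consists of the cosets of the members of \<open>I\<close> through
        \<open>y0 \<otimes> f\<close>.\<close>
      have "T ` Y I \<kappa> \<subseteq> (\<lambda>f. (\<lambda>B. (y0 \<otimes> f) <# B) ` I) ` F I"
      proof
        fix t assume "t \<in> T ` Y I \<kappa>"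
        then obtain y where y: "y \<in> Y I \<kappa>" "t = T y" by auto
        have yc: "y \<in> carrier G" using y Y_def by auto
        have "inv y0 \<otimes> y \<in> B" if B: "B \<in> J I" for B
        proof -
          have "y <# B = y0 <# B" using y y0 B unfolding Y_def by auto
          moreover have Bs: "subgroup B G" using B JF[OF I] I sub by auto
          ultimately have "y \<in> y0 <# B" using mem_lcos_self[OF Bs yc] by auto
          then show ?thesis using mem_lcos_iff[OF subgroup.subset[OF Bs] y0c yc] by simp
        qed
        then have "inv y0 \<otimes> y \<in> meet_of G (J I)" using y0c yc unfolding meet_of_def by auto
        then obtain f where f: "f \<in> F I" "inv y0 \<otimes> y \<in> f <# meet_of G I" using JF[OF I] by blast
        have fc: "f \<in> carrier G" using f JF[OF I] by auto
        have meq: "meet_of G I \<subseteq> carrier G" unfolding meet_of_def by auto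
        have "y <# B = (y0 \<otimes> f) <# B" if B: "B \<in> I" for B
        proof -
          have Bs: "subgroup B G" using B I sub by auto
          have "inv f \<otimes> (inv y0 \<otimes> y) \<in> meet_of G I" using f mem_lcos_iff[OF meq fc] y0c yc by auto
          then have "inv f \<otimes> (inv y0 \<otimes> y) \<in> B" using B unfolding meet_of_def by auto
          then have "inv (y0 \<otimes> f) \<otimes> y \<in> B" using y0c yc fc by (simp add: inv_mult_group m_assoc)
          then have "y \<in> (y0 \<otimes> f) <# B" using mem_lcos_iff Bs y0c yc fc by (auto dest: subgroup.subset)
          then show ?thesis using lcos_eqI[OF Bs m_closed[OF y0c fc]] by simp
        qed
        moreover have "t = (\<lambda>B. y <# B) ` I" using T[OF yc] y unfolding Y_def by auto
        ultimately have "t = (\<lambda>B. (y0 \<otimes> f) <# B) ` I" by auto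
        then show "t \<in> (\<lambda>f. (\<lambda>B. (y0 \<otimes> f) <# B) ` I) ` F I" using f by auto
      qed
      moreover have "finite (F I)" using JF[OF I] by auto
      ultimately show ?thesis by (metis card_image_le card_mono finite_imageI finite_subset le_trans)
    qed auto
    let ?U = "\<Union>I\<in>Pow \<B>. \<Union>\<kappa>\<in>(J I \<rightarrow>\<^sub>E \<C>). T ` Y I \<kappa>"
    have finJ: "finite (J I)" if "I \<subseteq> \<B>" for I
      using JF[OF that] that fin finite_subset by metis
    have sub': "T ` carrier G \<subseteq> ?U"
    proof
      fix t assume "t \<in> T ` carrier G"
      then obtain y where y: "y \<in> carrier G" "t = T y" by auto
      let ?I = "{B \<in> \<B>. y <# B \<in> \<C>}"
      have I: "?I \<subseteq> \<B>" by auto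
      let ?k = "\<lambda>B\<in>J ?I. y <# B"
      have "?k \<in> J ?I \<rightarrow>\<^sub>E \<C>" using JF[OF I] by auto
      moreover have "y \<in> Y ?I ?k" unfolding Y_def using y by auto
      ultimately show "t \<in> ?U" using I y by blast
    qed
    have fU: "finite ?U" using fin C(1) finJ cardY by (auto intro!: finite_PiE)
    have "card ?U \<le> (\<Sum>I\<in>Pow \<B>. card (\<Union>\<kappa>\<in>(J I \<rightarrow>\<^sub>E \<C>). T ` Y I \<kappa>))"
      by (rule card_UN_le) (use fin in auto)
    also have "\<dots> \<le> (\<Sum>I\<in>Pow \<B>. card (F I) * (card \<C> + 1) ^ d)"
    proof (rule sum_mono)
      fix I assume "I \<in> Pow \<B>"
      then have I: "I \<subseteq> \<B>" by auto
      have fp: "finite (J I \<rightarrow>\<^sub>E \<C>)" using finJ[OF I] C(1) by (auto intro: finite_PiE)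
      have "card (\<Union>\<kappa>\<in>(J I \<rightarrow>\<^sub>E \<C>). T ` Y I \<kappa>) \<le> (\<Sum>\<kappa>\<in>(J I \<rightarrow>\<^sub>E \<C>). card (T ` Y I \<kappa>))"
        by (rule card_UN_le[OF fp])
      also have "\<dots> \<le> (\<Sum>\<kappa>\<in>(J I \<rightarrow>\<^sub>E \<C>). card (F I))" by (rule sum_mono) (use cardY[OF I] in auto)
      also have "\<dots> = card (F I) * card \<C> ^ card (J I)" using finJ[OF I] by (simp add: card_PiE)
      also have "\<dots> \<le> card (F I) * (card \<C> + 1) ^ d"
      proof -
        \<comment> \<open>The summand 1 keeps the base positive even for empty \<open>\<C>\<close>,
          so that the exponent may be raised from \<open>card (J I)\<close> to
          \<open>d\<close>.\<close>
        have "card \<C> ^ card (J I) \<le> (card \<C> + 1) ^ card (J I)" by (rule power_mono) auto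
        also have "\<dots> \<le> (card \<C> + 1) ^ d" by (rule power_increasing) (use JF[OF I] in auto)
        finally show ?thesis by simp
      qed
      finally show "card (\<Union>\<kappa>\<in>(J I \<rightarrow>\<^sub>E \<C>). T ` Y I \<kappa>) \<le> card (F I) * (card \<C> + 1) ^ d" .
    qed
    also have "\<dots> = ?c * (card \<C> + 1) ^ d" by (simp add: sum_distrib_right)
    finally show ?thesis using sub' fU card_mono[OF fU sub'] finite_subset[OF sub' fU]
      unfolding T_def[abs_def] by linarith
  qed
  then show ?thesis by blast
qed

end

section \<open>Definable predicates\<close>

lemma finite_fv_tm: "finite (fv_tm t)"
  by (induction t) auto

lemma finite_fv: "finite (fv \<phi>)"
  by (induction \<phi>) (auto simp: finite_fv_tm)

lemma tm_val_cong: "(\<And>i. i \<in> fv_tm t \<Longrightarrow> e i = e' i) \<Longrightarrow> tm_val M e t = tm_val M e' t"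
proof (induction t)
  case (Fn f ts)
  then have "map (tm_val M e) ts = map (tm_val M e') ts" by auto
  then show ?case by (simp del: map_eq_conv)
qed auto

lemma sat_cong: "(\<And>i. i \<in> fv \<phi> \<Longrightarrow> e i = e' i) \<Longrightarrow> sat M e \<phi> \<longleftrightarrow> sat M e' \<phi>"
proof (induction \<phi> arbitrary: e e')
  case (Equal s t)
  then show ?case using tm_val_cong[of s e e' M] tm_val_cong[of t e e' M] by auto
next
  case (Atom r ts)
  have "map (tm_val M e) ts = map (tm_val M e') ts"
    by (rule map_cong[OF refl], rule tm_val_cong) (use Atom in auto)
  then show ?case by (simp del: map_eq_conv)
next
  case (Conj \<phi> \<psi>)
  have "sat M e \<phi> \<longleftrightarrow> sat M e' \<phi>" by (rule Conj.IH(1)) (use Conj.prems in auto)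
  moreover have "sat M e \<psi> \<longleftrightarrow> sat M e' \<psi>" by (rule Conj.IH(2)) (use Conj.prems in auto)
  ultimately show ?case by simp
next
  case (Exists i \<phi>)
  have "sat M (e(i := a)) \<phi> \<longleftrightarrow> sat M (e'(i := a)) \<phi>" for a
    using Exists by (intro Exists.IH) auto
  then show ?case by simp
next
  case (Neg \<phi>)
  have "sat M e \<phi> \<longleftrightarrow> sat M e' \<phi>" by (rule Neg.IH) (use Neg.prems in auto)
  then show ?case by simp
qed

primrec rename_tm :: "(nat \<Rightarrow> nat) \<Rightarrow> 'f tm \<Rightarrow> 'f tm" where
  "rename_tm \<rho> (Var i) = Var (\<rho> i)"
| "rename_tm \<rho> (Fn f ts) = Fn f (map (rename_tm \<rho>) ts)"

lemma wf_rename_tm: "wf_tm L t \<Longrightarrow> wf_tm L (rename_tm \<rho> t)"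
  by (induction t) auto

lemma fv_rename_tm: "fv_tm (rename_tm \<rho> t) = \<rho> ` fv_tm t"
  by (induction t) auto

lemma tm_val_rename_tm: "tm_val M e (rename_tm \<rho> t) = tm_val M (e \<circ> \<rho>) t"
proof (induction t)
  case (Fn f ts)
  have "map (tm_val M e) (map (rename_tm \<rho>) ts) = map (tm_val M (e \<circ> \<rho>)) ts"
    unfolding map_map by (rule map_cong[OF refl]) (simp add: Fn comp_def)
  then show ?case by (simp only: rename_tm.simps tm_val.simps)
qed auto

text \<open>The substitution may identify variables, so a bound variable has to move to a fresh
  \<open>j\<close>. The choice of \<open>j\<close> depends on \<open>\<rho>\<close>, whence an
  existence statement and an induction over all \<open>\<rho>\<close>.\<close>

lemma rename_fm:
  "\<exists>\<psi>. (wf_fm L \<phi> \<longrightarrow> wf_fm L \<psi>) \<and> fv \<psi> \<subseteq> \<rho> ` fv \<phi> \<and> (\<forall>e. sat M e \<psi> \<longleftrightarrow> sat M (e \<circ> \<rho>) \<phi>)"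
proof (induction \<phi> arbitrary: \<rho>)
  case (Equal s t)
  then show ?case
    by (intro exI[of _ "Equal (rename_tm \<rho> s) (rename_tm \<rho> t)"])
      (auto simp: wf_rename_tm fv_rename_tm tm_val_rename_tm comp_def)
next
  case (Atom r ts)
  have "map (tm_val M e \<circ> rename_tm \<rho>) ts = map (tm_val M (e \<circ> \<rho>)) ts" for e
    by (rule map_cong[OF refl]) (simp add: tm_val_rename_tm comp_def)
  then show ?case
    by (intro exI[of _ "Atom r (map (rename_tm \<rho>) ts)"])
      (auto simp: wf_rename_tm fv_rename_tm comp_def simp del: map_eq_conv)
next
  case (Neg \<phi>)
  then obtain \<psi> where "wf_fm L \<phi> \<longrightarrow> wf_fm L \<psi>" "fv \<psi> \<subseteq> \<rho> ` fv \<phi>" "\<forall>e. sat M e \<psi> \<longleftrightarrow> sat M (e \<circ> \<rho>) \<phi>"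
    by blast
  then show ?case by (intro exI[of _ "Neg \<psi>"]) (auto simp: comp_def)
next
  case (Conj \<phi>1 \<phi>2)
  obtain \<psi>1 where "wf_fm L \<phi>1 \<longrightarrow> wf_fm L \<psi>1" "fv \<psi>1 \<subseteq> \<rho> ` fv \<phi>1" "\<forall>e. sat M e \<psi>1 \<longleftrightarrow> sat M (e \<circ> \<rho>) \<phi>1"
    using Conj.IH(1) by blast
  moreover obtain \<psi>2 where "wf_fm L \<phi>2 \<longrightarrow> wf_fm L \<psi>2" "fv \<psi>2 \<subseteq> \<rho> ` fv \<phi>2" "\<forall>e. sat M e \<psi>2 \<longleftrightarrow> sat M (e \<circ> \<rho>) \<phi>2"
    using Conj.IH(2) by blast
  ultimately show ?case by (intro exI[of _ "Conj \<psi>1 \<psi>2"]) (auto simp: comp_def)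
next
  case (Exists i \<phi>)
  obtain j where j: "j \<notin> \<rho> ` fv \<phi>" 
    using ex_new_if_finite[OF infinite_UNIV_nat finite_imageI[OF finite_fv]] by blast
  obtain \<psi> where \<psi>: "wf_fm L \<phi> \<longrightarrow> wf_fm L \<psi>" "fv \<psi> \<subseteq> \<rho>(i := j) ` fv \<phi>"
    "\<And>e. sat M e \<psi> \<longleftrightarrow> sat M (e \<circ> \<rho>(i := j)) \<phi>"
    using Exists.IH by blast
  have "sat M (e(j := a)) \<psi> \<longleftrightarrow> sat M ((e \<circ> \<rho>)(i := a)) \<phi>" for e a
    unfolding \<psi>(3) by (rule sat_cong) (use j in auto)
  moreover have "fv \<psi> - {j} \<subseteq> \<rho> ` (fv \<phi> - {i})" using \<psi>(2) j by (auto split: if_splits)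
  ultimately show ?case using \<psi>(1) by (intro exI[of _ "Exists j \<psi>"]) (auto simp: comp_def)
qed

text \<open>Parameter-free definability as a property of HOL predicates on assignments. Formulas are
  then built by closure lemmas, and variables are rearranged by composing assignments instead of
  rewriting syntax.\<close>

definition expressible ::
  "('f, 'r, 'z) lang_scheme \<Rightarrow> ('a, 'f, 'r, 'y) fo_struct_scheme \<Rightarrow> ((nat \<Rightarrow> 'a) \<Rightarrow> bool) \<Rightarrow> bool" where
  "expressible L M P \<longleftrightarrow> (\<exists>\<phi>. wf_fm L \<phi> \<and> (\<forall>e. range e \<subseteq> carrier M \<longrightarrow> (sat M e \<phi> \<longleftrightarrow> P e)))"

lemma expressible_cong:
  "\<lbrakk>expressible L M P; \<And>e. range e \<subseteq> carrier M \<Longrightarrow> P e \<longleftrightarrow> Q e\<rbrakk> \<Longrightarrow> expressible L M Q"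
  unfolding expressible_def by metis

lemma expressible_sat: "wf_fm L \<phi> \<Longrightarrow> expressible L M (\<lambda>e. sat M e \<phi>)"
  unfolding expressible_def by auto

lemma expressible_not: "expressible L M P \<Longrightarrow> expressible L M (\<lambda>e. \<not> P e)"
  unfolding expressible_def by (metis sat.simps(3) wf_fm.simps(3))

lemma expressible_conj:
  "\<lbrakk>expressible L M P; expressible L M Q\<rbrakk> \<Longrightarrow> expressible L M (\<lambda>e. P e \<and> Q e)"
  unfolding expressible_def by (metis sat.simps(4) wf_fm.simps(4))

lemma expressible_const: "expressible L M (\<lambda>e. b)"
proof (cases b)
  case True
  then show ?thesis unfolding expressible_def by (intro exI[of _ "Equal (Var 0) (Var 0)"]) auto
next
  case False
  then show ?thesis unfolding expressible_def by (intro exI[of _ "Neg (Equal (Var 0) (Var 0))"]) auto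
qed

lemma expressible_ball:
  assumes "finite I" "\<And>i. i \<in> I \<Longrightarrow> expressible L M (P i)"
  shows "expressible L M (\<lambda>e. \<forall>i\<in>I. P i e)"
  using assms
proof (induction I)
  case empty
  then show ?case using expressible_const[of L M True] by simp
next
  case (insert i I)
  then have "expressible L M (\<lambda>e. P i e \<and> (\<forall>i\<in>I. P i e))" by (intro expressible_conj) auto
  then show ?case by simp
qed

lemma expressible_bex:
  assumes "finite I" "\<And>i. i \<in> I \<Longrightarrow> expressible L M (P i)"
  shows "expressible L M (\<lambda>e. \<exists>i\<in>I. P i e)"
  using expressible_not[OF expressible_ball[OF assms(1), of L M "\<lambda>i e. \<not> P i e"]] assms(2)
  by (simp add: expressible_not)

lemma expressible_rename: "expressible L M P \<Longrightarrow> expressible L M (\<lambda>e. P (e \<circ> \<rho>))"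
proof -
  assume "expressible L M P"
  then obtain \<phi> where \<phi>: "wf_fm L \<phi>" "\<And>e. range e \<subseteq> carrier M \<Longrightarrow> sat M e \<phi> \<longleftrightarrow> P e"
    unfolding expressible_def by auto
  obtain \<psi> where "wf_fm L \<psi>" "\<And>e. sat M e \<psi> \<longleftrightarrow> sat M (e \<circ> \<rho>) \<phi>"
    using rename_fm[of L \<phi> \<rho> M] \<phi>(1) by auto
  moreover have "range (e \<circ> \<rho>) \<subseteq> carrier M" if "range e \<subseteq> carrier M" for e using that by auto
  ultimately show ?thesis unfolding expressible_def using \<phi>(2) by metis
qed

lemma expressible_ex:
  assumes "expressible L M P"
  shows "expressible L M (\<lambda>e. \<exists>a\<in>carrier M. P (e(i := a)))"
proof -
  obtain \<phi> where \<phi>: "wf_fm L \<phi>" "\<And>e. range e \<subseteq> carrier M \<Longrightarrow> sat M e \<phi> \<longleftrightarrow> P e"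
    using assms unfolding expressible_def by auto
  have "range (e(i := a)) \<subseteq> carrier M" if "range e \<subseteq> carrier M" "a \<in> carrier M" for e a using that by auto
  then show ?thesis unfolding expressible_def using \<phi>
    by (intro exI[of _ "Exists i \<phi>"]) auto
qed

lemma expressible_ex_set:
  fixes M :: "('a, 'f, 'r, 'y) fo_struct_scheme"
  assumes "finite V" "expressible L M P"
  shows "expressible L M (\<lambda>e. \<exists>e'. range e' \<subseteq> carrier M \<and> (\<forall>v. v \<notin> V \<longrightarrow> e' v = e v) \<and> P e')"
  using assms(1)
proof (induction V)
  case empty
  have "e' = e" if "\<forall>v. e' v = e v" for e' e :: "nat \<Rightarrow> 'a" using that by auto
  then show ?case by (intro expressible_cong[OF assms(2)]) auto
next
  case (insert i V)
  show ?case
  proof (rule expressible_cong[OF expressible_ex[OF insert.IH, of i]])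
    fix e :: "nat \<Rightarrow> 'a" assume e: "range e \<subseteq> carrier M"
    show "(\<exists>a\<in>carrier M. \<exists>e'. range e' \<subseteq> carrier M \<and> (\<forall>v. v \<notin> V \<longrightarrow> e' v = (e(i := a)) v) \<and> P e') \<longleftrightarrow>
        (\<exists>e'. range e' \<subseteq> carrier M \<and> (\<forall>v. v \<notin> insert i V \<longrightarrow> e' v = e v) \<and> P e')" (is "?l \<longleftrightarrow> ?r")
    proof
      assume ?l
      then obtain a e' where a: "a \<in> carrier M" "range e' \<subseteq> carrier M" "\<forall>v. v \<notin> V \<longrightarrow> e' v = (e(i := a)) v" "P e'"
        by auto
      then show ?r by (intro exI[of _ e']) auto
    next
      assume ?r
      then obtain e' where e': "range e' \<subseteq> carrier M" "\<forall>v. v \<notin> insert i V \<longrightarrow> e' v = e v" "P e'"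
        by auto
      then show ?l by (intro bexI[of _ "e' i"] exI[of _ e']) auto
    qed
  qed
qed

lemma range_tcat:
  "\<lbrakk>x \<in> tuples A k; range c \<subseteq> A\<rbrakk> \<Longrightarrow> range (tcat k x c) \<subseteq> A"
  by (auto simp: tcat_def PiE_iff)

lemma tcat_less [simp]: "i < k \<Longrightarrow> tcat k x y i = x i"
  by (simp add: tcat_def)

lemma tcat_ge [simp]: "k \<le> i \<Longrightarrow> tcat k x y i = y (i - k)"
  by (simp add: tcat_def)

lemma expressible_ex_tuple:
  fixes M :: "('a, 'f, 'r, 'y) fo_struct_scheme"
  assumes "expressible L M P"
  shows "expressible L M (\<lambda>e. \<exists>x\<in>tuples (carrier M) m. P (tcat m x e))"
\<comment> \<open>The renaming \<open>i - m\<close> shifts the old variables behind a block of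
  \<open>m\<close> new ones. Truncated subtraction sends the block itself to variable 0, which does
  no harm because the quantifier overwrites the block.\<close>
proof (rule expressible_cong[OF expressible_rename[OF expressible_ex_set[OF _ assms], of "{..<m}" "\<lambda>i. i - m"]])
  fix e :: "nat \<Rightarrow> 'a" assume e: "range e \<subseteq> carrier M"
  show "(\<exists>e'. range e' \<subseteq> carrier M \<and> (\<forall>v. v \<notin> {..<m} \<longrightarrow> e' v = (e \<circ> (\<lambda>i. i - m)) v) \<and> P e') \<longleftrightarrow>
      (\<exists>x\<in>tuples (carrier M) m. P (tcat m x e))" (is "?l \<longleftrightarrow> ?r")
  proof
    assume ?l
    then obtain e' where e': "range e' \<subseteq> carrier M" "\<forall>v. v \<notin> {..<m} \<longrightarrow> e' v = e (v - m)" "P e'" by auto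
    then have "e' = tcat m (restrict e' {..<m}) e" by (auto simp: tcat_def fun_eq_iff)
    then show ?r using e' by (intro bexI[of _ "restrict e' {..<m}"]) auto
  next
    assume ?r
    then obtain x where "x \<in> tuples (carrier M) m" "P (tcat m x e)" by auto
    then show ?l using range_tcat[of x m "carrier M" e] e by (intro exI[of _ "tcat m x e"]) auto
  qed
qed auto

text \<open>An infinite parameter sequence spares later arguments the length of the tuple. Padding a
  tuple takes an element of \<open>A\<close>, whence \<open>A \<noteq> {}\<close>; conversely a
  formula reads only finitely many parameters.\<close>

lemma definable_iff:
  assumes "A \<noteq> {}" "A \<subseteq> carrier M"
  shows "definable L M A k D \<longleftrightarrow>
    (\<exists>P c. expressible L M P \<and> range c \<subseteq> A \<and> D = {x \<in> tuples (carrier M) k. P (tcat k x c)})"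
proof
  assume "definable L M A k D"
  then obtain n \<phi> b where \<phi>: "\<phi> \<in> formulas L k n" "b \<in> tuples A n" "D = solset M k \<phi> b"
    unfolding definable_def by auto
  obtain a where a: "a \<in> A" using assms by auto
  let ?c = "\<lambda>i. if i < n then b i else a"
  have "sat M (tcat k x b) \<phi> \<longleftrightarrow> sat M (tcat k x ?c) \<phi>" for x
    by (rule sat_cong) (use \<phi>(1) in \<open>auto simp: formulas_def tcat_def\<close>)
  then have "D = {x \<in> tuples (carrier M) k. sat M (tcat k x ?c) \<phi>}" using \<phi> by (simp add: solset_def)
  moreover have "range ?c \<subseteq> A" using \<phi>(2) a by (auto simp: PiE_iff)
  moreover have "expressible L M (\<lambda>e. sat M e \<phi>)" using \<phi>(1) by (intro expressible_sat) (auto simp: formulas_def)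
  ultimately show "\<exists>P c. expressible L M P \<and> range c \<subseteq> A \<and> D = {x \<in> tuples (carrier M) k. P (tcat k x c)}"
    by blast
next
  assume "\<exists>P c. expressible L M P \<and> range c \<subseteq> A \<and> D = {x \<in> tuples (carrier M) k. P (tcat k x c)}"
  then obtain P c where P: "expressible L M P" "range c \<subseteq> A" "D = {x \<in> tuples (carrier M) k. P (tcat k x c)}"
    by auto
  obtain \<phi> where \<phi>: "wf_fm L \<phi>" "\<And>e. range e \<subseteq> carrier M \<Longrightarrow> sat M e \<phi> \<longleftrightarrow> P e"
    using P(1) unfolding expressible_def by auto
  obtain n where n: "fv \<phi> \<subseteq> {..<n}" using finite_nat_bounded[OF finite_fv] by auto
  let ?b = "restrict c {..<n}"
  have "sat M (tcat k x ?b) \<phi> \<longleftrightarrow> sat M (tcat k x c) \<phi>" for x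
    by (rule sat_cong) (use n in \<open>auto simp: tcat_def\<close>)
  moreover have "sat M (tcat k x c) \<phi> \<longleftrightarrow> P (tcat k x c)" if "x \<in> tuples (carrier M) k" for x
    by (rule \<phi>(2)) (use that P(2) assms range_tcat[of x k "carrier M" c] in auto)
  ultimately have "D = solset M k \<phi> ?b" unfolding solset_def P(3) by auto
  moreover have "\<phi> \<in> formulas L k n" using \<phi>(1) n by (auto simp: formulas_def)
  moreover have "?b \<in> tuples A n" using P(2) by auto
  ultimately show "definable L M A k D" unfolding definable_def by blast
qed

lemma definable_Int:
  assumes "A \<noteq> {}" "A \<subseteq> carrier M" "definable L M A k D" "definable L M A k E"
  shows "definable L M A k (D \<inter> E)"
proof -
  obtain P c where P: "expressible L M P" "range c \<subseteq> A" "D = {x \<in> tuples (carrier M) k. P (tcat k x c)}"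
    using assms(3) unfolding definable_iff[OF assms(1,2)] by auto
  obtain Q d where Q: "expressible L M Q" "range d \<subseteq> A" "E = {x \<in> tuples (carrier M) k. Q (tcat k x d)}"
    using assms(4) unfolding definable_iff[OF assms(1,2)] by auto
  \<comment> \<open>The two parameter sequences are interleaved at even and odd positions.\<close>
  let ?c = "\<lambda>i. if even i then c (i div 2) else d (i div 2)"
  let ?r = "\<lambda>i. if i < k then i else k + 2 * (i - k)"
  let ?s = "\<lambda>i. if i < k then i else k + (2 * (i - k) + 1)"
  have "expressible L M (\<lambda>e. P (e \<circ> ?r) \<and> Q (e \<circ> ?s))"
    using P Q by (intro expressible_conj expressible_rename)
  moreover have "range ?c \<subseteq> A" using P Q by auto
  moreover have "tcat k x ?c \<circ> ?r = tcat k x c" "tcat k x ?c \<circ> ?s = tcat k x d" for x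
    by (auto simp: tcat_def fun_eq_iff)
  then have "D \<inter> E = {x \<in> tuples (carrier M) k. P (tcat k x ?c \<circ> ?r) \<and> Q (tcat k x ?c \<circ> ?s)}"
    unfolding P Q by auto
  ultimately show ?thesis unfolding definable_iff[OF assms(1,2)]
    by (intro exI[of _ "\<lambda>e. P (e \<circ> ?r) \<and> Q (e \<circ> ?s)"] exI[of _ ?c]) auto
qed

lemma acl_subset_carrier: "acl L M A \<subseteq> carrier M"
  by (force simp: acl_def definable_def solset_def PiE_iff)

section \<open>Elimination of imaginaries from definitions of sets of real tuples\<close>

text \<open>A kind prescribes where the value of a variable lives. The number in
  \<open>KOther\<close> is a label for comparing values, not a sort.\<close>

datatype ('f, 'r) kind = KHome | KSort nat "('f, 'r) fm" | KOther nat

text \<open>Variable \<open>code i j\<close> of a formula for \<open>M\<close> holds coordinate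
  \<open>j\<close> of a home tuple that represents the value of variable \<open>i\<close> of a
  formula for M^eq.\<close>

definition code :: "nat \<Rightarrow> nat \<Rightarrow> nat" where "code i j = prod_encode (i, j)"

lemma code_eq [simp]: "code i j = code i' j' \<longleftrightarrow> i = i' \<and> j = j'"
  by (simp add: code_def)

fun proj_sorts :: "('f, ('f, 'r) eq_rel) fm \<Rightarrow> (nat \<times> ('f, 'r) fm) set" where
  "proj_sorts (Equal s t) = {}"
| "proj_sorts (Atom r ts) = (case r of Proj k \<epsilon> \<Rightarrow> {(k, \<epsilon>)} | _ \<Rightarrow> {})"
| "proj_sorts (Neg \<psi>) = proj_sorts \<psi>"
| "proj_sorts (Conj \<psi> \<chi>) = proj_sorts \<psi> \<union> proj_sorts \<chi>"
| "proj_sorts (Exists i \<psi>) = proj_sorts \<psi>"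

lemma proj_sorts_imag: "wf_fm (eq_lang L M) \<psi> \<Longrightarrow> proj_sorts \<psi> \<subseteq> imag_sorts L M \<and> finite (proj_sorts \<psi>)"
  by (induction \<psi>) (auto simp: eq_lang_def split: eq_rel.splits)

abbreviation eqc where
  "eqc M k \<epsilon> w i \<equiv> def_rel M k \<epsilon> `` {\<lambda>j\<in>{..<k}. w (code i j)}"

definition other :: "('f, 'r, 'z) lang_scheme \<Rightarrow> ('a, 'f, 'r, 'y) fo_struct_scheme \<Rightarrow> (nat \<times> ('f, 'r) fm) set \<Rightarrow> ('a, 'f, 'r) eq_elem set"
  where
  "other L M \<Sigma> = {u \<in> carrier (eq_struct L M). \<exists>k \<epsilon> C. u = Imag k \<epsilon> C \<and> (k, \<epsilon>) \<notin> \<Sigma>}"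

text \<open>
  The home sort and the sorts in the finite set \<open>\<Sigma>\<close> are coded by tuples of the model.  Elements of the
  remaining sorts are indiscernible for formulas that mention only sorts in \<open>\<Sigma>\<close>, so that it is enough to
  record the equalities between them, by means of labels.
\<close>

definition coded where
  "coded L M \<Sigma> V t w e \<longleftrightarrow>
     (\<forall>i\<in>V. case t i of KHome \<Rightarrow> e i = Home (w (code i 0))
        | KSort k \<epsilon> \<Rightarrow> (k, \<epsilon>) \<in> \<Sigma> \<and> e i = Imag k \<epsilon> (eqc M k \<epsilon> w i)
        | KOther l \<Rightarrow> e i \<in> other L M \<Sigma>) \<and>
     (\<forall>i\<in>V. \<forall>j\<in>V. \<forall>l l'. t i = KOther l \<and> t j = KOther l' \<longrightarrow> (l = l' \<longleftrightarrow> e i = e j))"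

lemma coded_mono: "coded L M \<Sigma> V t w e \<Longrightarrow> V' \<subseteq> V \<Longrightarrow> coded L M \<Sigma> V' t w e"
  unfolding coded_def by blast

lemma equiv_Times: "equiv A (A \<times> A)"
  by (rule equivI) (auto simp: refl_on_def sym_def trans_def)

text \<open>For every \<open>k\<close> the total relation on \<open>k\<close>-tuples gives a sort
  with a single element, and only finitely many of these sorts are in \<open>\<Sigma>\<close>. So an
  unnamed element distinct from finitely many given ones always exists, as the quantifier step of
  \<open>eliminate_imaginaries\<close> requires.\<close>

lemma infinite_other:
  fixes M :: "('a, 'f, 'r, 'y) fo_struct_scheme" and L :: "('f, 'r, 'z) lang_scheme"
  assumes "finite \<Sigma>" "is_struct L M"
  shows "infinite (other L M \<Sigma>)"
proof -
  define \<tau> :: "('f, 'r) fm" where "\<tau> = Exists 0 (Equal (Var 0) (Var 0))"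
  define f where "f k = (Imag k \<tau> (tuples (carrier M) k) :: ('a, 'f, 'r) eq_elem)" for k
  have ne: "carrier M \<noteq> {}" using assms(2) by (simp add: is_struct_def)
  have dr: "def_rel M k \<tau> = tuples (carrier M) k \<times> tuples (carrier M) k" for k
    using ne by (auto simp: def_rel_def \<tau>_def)
  have "(k, \<tau>) \<in> imag_sorts L M" for k
    unfolding imag_sorts_def using equiv_Times[of "tuples (carrier M) k"]
    by (simp add: dr) (simp add: formulas_def \<tau>_def)
  moreover have "tuples (carrier M) k \<in> tuples (carrier M) k // def_rel M k \<tau>" for k
  proof -
    obtain a where "a \<in> carrier M" using ne by auto
    then have "(\<lambda>i\<in>{..<k}. a) \<in> tuples (carrier M) k" by auto
    then have "(tuples (carrier M) k \<times> tuples (carrier M) k) `` {\<lambda>i\<in>{..<k}. a} \<in> tuples (carrier M) k // def_rel M k \<tau>"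
      unfolding dr by (rule quotientI)
    moreover have "(A \<times> A) `` {x} = A" if "x \<in> A" for x and A :: "(nat \<Rightarrow> 'a) set" using that by auto
    ultimately show ?thesis using \<open>(\<lambda>i\<in>{..<k}. a) \<in> tuples (carrier M) k\<close> by metis
  qed
  ultimately have mem: "f k \<in> carrier (eq_struct L M)" for k
    unfolding f_def eq_struct_def by auto
  have "finite {k. (k, \<tau>) \<in> \<Sigma>}"
    by (rule finite_subset[of _ "fst ` \<Sigma>"]) (use assms(1) in \<open>force+\<close>)
  then have "infinite (UNIV - {k. (k, \<tau>) \<in> \<Sigma>})" by (intro Diff_infinite_finite) auto
  moreover have "inj_on f (UNIV - {k. (k, \<tau>) \<in> \<Sigma>})" by (auto simp: inj_on_def f_def)
  ultimately have "infinite (f ` (UNIV - {k. (k, \<tau>) \<in> \<Sigma>}))" using finite_imageD by blast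
  moreover have "f ` (UNIV - {k. (k, \<tau>) \<in> \<Sigma>}) \<subseteq> other L M \<Sigma>"
    using mem unfolding other_def f_def by auto
  ultimately show ?thesis using finite_subset by blast
qed

lemma eqc_eq_iff:
  assumes "(k, \<epsilon>) \<in> imag_sorts L M" "range w \<subseteq> carrier M" "x \<in> tuples (carrier M) k"
  shows "def_rel M k \<epsilon> `` {x} = eqc M k \<epsilon> w j \<longleftrightarrow> sat M (tcat k x (\<lambda>i. w (code j i))) \<epsilon>"
proof -
  let ?y = "\<lambda>i\<in>{..<k}. w (code j i)"
  have y: "?y \<in> tuples (carrier M) k" using assms(2) by auto
  have "def_rel M k \<epsilon> `` {x} = eqc M k \<epsilon> w j \<longleftrightarrow> (x, ?y) \<in> def_rel M k \<epsilon>"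
    using assms y by (intro eq_equiv_class_iff) (auto simp: imag_sorts_def)
  also have "\<dots> \<longleftrightarrow> sat M (tcat k x ?y) \<epsilon>" using assms y by (simp add: def_rel_def)
  also have "\<dots> \<longleftrightarrow> sat M (tcat k x (\<lambda>i. w (code j i))) \<epsilon>"
    by (rule sat_cong) (use assms(1) in \<open>auto simp: imag_sorts_def formulas_def tcat_def\<close>)
  finally show ?thesis .
qed

lemma wf_tm_eq_lang: "wf_tm (eq_lang L M) t \<Longrightarrow> \<exists>i. t = Var i"
  by (cases t) (auto simp: eq_lang_def)

lemma wf_tms_eq_lang:
  assumes "\<forall>t\<in>set ts. wf_tm (eq_lang L M) t"
  shows "\<exists>is. ts = map Var is"
  using assms
proof (induction ts)
  case (Cons t ts)
  then obtain i "is" where "t = Var i" "ts = map Var is" using wf_tm_eq_lang[of L M t] by auto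
  then show ?case by (intro exI[of _ "i # is"]) simp
qed auto

lemma map_eq_Home_iff:
  assumes "\<And>i. i \<in> set is \<Longrightarrow> (e i = Home (f i))"
  shows "map e is = map Home xs \<longleftrightarrow> xs = map f is"
proof -
  have *: "map e is = map Home (map f is)" by (simp add: assms)
  show ?thesis unfolding * by (subst inj_map_eq_map) (auto intro: injI)
qed

text \<open>Used in both directions of the quantifier step: only the coordinates of variable
  \<open>i\<close> change, so the coding of the other variables survives.\<close>

lemma coded_update:
  assumes c: "coded L M \<Sigma> (V - {i}) t w e" and w: "\<And>j v. j \<noteq> i \<Longrightarrow> w' (code j v) = w (code j v)"
    and a: "case \<kappa> of KHome \<Rightarrow> a = Home (w' (code i 0))
      | KSort k \<epsilon> \<Rightarrow> (k, \<epsilon>) \<in> \<Sigma> \<and> a = Imag k \<epsilon> (eqc M k \<epsilon> w' i)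
      | KOther l \<Rightarrow> a \<in> other L M \<Sigma> \<and> (\<forall>j\<in>V - {i}. \<forall>l'. t j = KOther l' \<longrightarrow> (l = l' \<longleftrightarrow> a = e j))"
  shows "coded L M \<Sigma> V (t(i := \<kappa>)) w' (e(i := a))"
  unfolding coded_def
proof (intro conjI ballI allI impI)
  fix j assume j: "j \<in> V"
  show "case (t(i := \<kappa>)) j of KHome \<Rightarrow> (e(i := a)) j = Home (w' (code j 0))
      | KSort k \<epsilon> \<Rightarrow> (k, \<epsilon>) \<in> \<Sigma> \<and> (e(i := a)) j = Imag k \<epsilon> (eqc M k \<epsilon> w' j)
      | KOther l \<Rightarrow> (e(i := a)) j \<in> other L M \<Sigma>"
  proof (cases "j = i")
    case True
    then show ?thesis using a by (cases \<kappa>) simp_all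
  next
    case False
    then have "j \<in> V - {i}" using j by auto
    then have "case t j of KHome \<Rightarrow> e j = Home (w (code j 0))
        | KSort k \<epsilon> \<Rightarrow> (k, \<epsilon>) \<in> \<Sigma> \<and> e j = Imag k \<epsilon> (eqc M k \<epsilon> w j)
        | KOther l \<Rightarrow> e j \<in> other L M \<Sigma>"
      using c unfolding coded_def by blast
    then show ?thesis using False w[OF False] by (cases "t j") auto
  qed
next
  fix j j' l l' assume j: "j \<in> V" "j' \<in> V" and t: "(t(i := \<kappa>)) j = KOther l \<and> (t(i := \<kappa>)) j' = KOther l'"
  have *: "l = l' \<longleftrightarrow> e j = e j'" if "j \<noteq> i" "j' \<noteq> i"
  proof -
    have "j \<in> V - {i}" "j' \<in> V - {i}" "t j = KOther l" "t j' = KOther l'" using j t that by auto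
    then show ?thesis using c unfolding coded_def by blast
  qed
  have **: "l = l' \<longleftrightarrow> a = e j" if "j \<in> V - {i}" "\<kappa> = KOther l" "t j = KOther l'" for j l l'
    using a that by auto
  show "l = l' \<longleftrightarrow> (e(i := a)) j = (e(i := a)) j'"
    using * **[of j' l l'] **[of j l' l] j t by (cases "j = i"; cases "j' = i") auto
qed

text \<open>For each assignment \<open>t\<close> of kinds there is one formula about
  representatives, correct for all values of these kinds. A bound variable has finitely many
  relevant kinds: home, a sort in \<open>\<Sigma>\<close>, a label in use, a fresh label; its
  quantifier becomes the disjunction over them. Labels need no quantifier in \<open>M\<close>: a
  label in use names a value already present, and a new value for a fresh label always
  exists.\<close>

lemma eliminate_imaginaries:
  fixes M :: "('a, 'f, 'r, 'y) fo_struct_scheme" and L :: "('f, 'r, 'z) lang_scheme"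
  assumes M: "is_struct L M" and \<Sigma>: "finite \<Sigma>" "\<Sigma> \<subseteq> imag_sorts L M"
    and "wf_fm (eq_lang L M) \<psi>" "proj_sorts \<psi> \<subseteq> \<Sigma>"
  shows "\<exists>P. expressible L M P \<and>
    (\<forall>w e. range w \<subseteq> carrier M \<and> coded L M \<Sigma> (fv \<psi>) t w e \<longrightarrow> (sat (eq_struct L M) e \<psi> \<longleftrightarrow> P w))"
  using assms(4,5)
proof (induction \<psi> arbitrary: t)
  case (Equal s s')
  have "wf_tm (eq_lang L M) s" "wf_tm (eq_lang L M) s'" using Equal.prems by auto
  then obtain i j where ij: "s = Var i" "s' = Var j" using wf_tm_eq_lang by blast
  \<comment> \<open>Values of different kinds are never equal. Within a sort, equality of classes is
    \<open>\<epsilon>\<close> applied to the two blocks of coordinates; within \<open>KOther\<close>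
    it is equality of labels.\<close>
  define P where "P w \<longleftrightarrow> (case (t i, t j) of
      (KHome, KHome) \<Rightarrow> w (code i 0) = w (code j 0)
    | (KSort k \<epsilon>, KSort k' \<epsilon>') \<Rightarrow> (k, \<epsilon>) = (k', \<epsilon>') \<and> (k, \<epsilon>) \<in> \<Sigma> \<and> sat M (w \<circ> (\<lambda>v. if v < k then code i v else code j (v - k))) \<epsilon>
    | (KOther l, KOther l') \<Rightarrow> l = l'
    | _ \<Rightarrow> False)" for w :: "nat \<Rightarrow> 'a"
  have E0: "expressible L M (\<lambda>w. w (code i 0) = w (code j 0))"
    using expressible_sat[of L "Equal (Var (code i 0)) (Var (code j 0))" M] by simp
  have E1: "expressible L M (\<lambda>w. sat M (w \<circ> \<rho>) \<epsilon>)" if "(k, \<epsilon>) \<in> \<Sigma>" for k \<epsilon> \<rho>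
    by (rule expressible_rename, rule expressible_sat)
      (use that \<Sigma>(2) in \<open>auto simp: imag_sorts_def formulas_def\<close>)
  have "expressible L M P"
  proof (cases "\<exists>k \<epsilon>. t i = KSort k \<epsilon> \<and> t j = KSort k \<epsilon> \<and> (k, \<epsilon>) \<in> \<Sigma>")
    case True
    then obtain k \<epsilon> where k: "t i = KSort k \<epsilon>" "t j = KSort k \<epsilon>" "(k, \<epsilon>) \<in> \<Sigma>" by auto
    then show ?thesis
      by (intro expressible_cong[OF E1[OF k(3), of "\<lambda>v. if v < k then code i v else code j (v - k)"]])
        (simp add: P_def)
  next
    case False
    then show ?thesis unfolding P_def[abs_def]
      by (cases "t i"; cases "t j") (auto intro: E0 expressible_const)
  qed
  moreover have "sat (eq_struct L M) e (Equal s s') \<longleftrightarrow> P w"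
    if w: "range w \<subseteq> carrier M" and c: "coded L M \<Sigma> (fv (Equal s s')) t w e" for w e
  proof -
    have ci: "case t i of KHome \<Rightarrow> e i = Home (w (code i 0))
        | KSort k \<epsilon> \<Rightarrow> (k, \<epsilon>) \<in> \<Sigma> \<and> e i = Imag k \<epsilon> (eqc M k \<epsilon> w i)
        | KOther l \<Rightarrow> e i \<in> other L M \<Sigma>"
      "case t j of KHome \<Rightarrow> e j = Home (w (code j 0))
        | KSort k \<epsilon> \<Rightarrow> (k, \<epsilon>) \<in> \<Sigma> \<and> e j = Imag k \<epsilon> (eqc M k \<epsilon> w j)
        | KOther l \<Rightarrow> e j \<in> other L M \<Sigma>"
      "t i = KOther l \<and> t j = KOther l' \<Longrightarrow> (l = l' \<longleftrightarrow> e i = e j)" for l l'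
      using c unfolding coded_def ij by auto
    have *: "eqc M k \<epsilon> w i = eqc M k \<epsilon> w j \<longleftrightarrow> sat M (w \<circ> (\<lambda>v. if v < k then code i v else code j (v - k))) \<epsilon>"
      if "(k, \<epsilon>) \<in> \<Sigma>" for k \<epsilon>
    proof -
      have "eqc M k \<epsilon> w i = eqc M k \<epsilon> w j \<longleftrightarrow> sat M (tcat k (\<lambda>v\<in>{..<k}. w (code i v)) (\<lambda>v. w (code j v))) \<epsilon>"
        by (rule eqc_eq_iff) (use w that \<Sigma> in \<open>auto split: if_splits\<close>)
      moreover have "tcat k (\<lambda>v\<in>{..<k}. w (code i v)) (\<lambda>v. w (code j v)) = w \<circ> (\<lambda>v. if v < k then code i v else code j (v - k))"
        by (auto simp: tcat_def fun_eq_iff)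
      ultimately show ?thesis by simp
    qed
    show ?thesis
    proof (cases "\<exists>k \<epsilon>. t i = KSort k \<epsilon> \<and> t j = KSort k \<epsilon>")
      case True
      then obtain k \<epsilon> where k: "t i = KSort k \<epsilon>" "t j = KSort k \<epsilon>" by auto
      then have "(k, \<epsilon>) \<in> \<Sigma>" "e i = Imag k \<epsilon> (eqc M k \<epsilon> w i)" "e j = Imag k \<epsilon> (eqc M k \<epsilon> w j)"
        using ci(1,2) by auto
      then show ?thesis using *[of k \<epsilon>] k by (simp add: ij P_def)
    next
      case False
      consider l l' where "t i = KOther l" "t j = KOther l'" | "\<not> (\<exists>l l'. t i = KOther l \<and> t j = KOther l')" by blast
      then show ?thesis
      proof cases
        case 1
        then show ?thesis using ci(3) by (simp add: ij P_def)
      next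
        case 2
        then show ?thesis using False ci(1,2)
          by (cases "t i"; cases "t j") (simp_all add: ij P_def other_def, force+)
      qed
    qed
  qed
  ultimately show ?case by blast
next
  case (Atom r ts)
  then obtain "is" where ts: "ts = map Var is" using wf_tms_eq_lang[of ts L M] by auto
  have tv: "map (tm_val (eq_struct L M) e) ts = map e is" for e by (simp add: ts)
  have satA: "sat (eq_struct L M) e (Atom r ts) \<longleftrightarrow> eq_holds M r (map e is)" for e
    unfolding sat.simps tv by (simp add: eq_struct_def)
  have fvA: "fv (Atom r ts) = set is" by (auto simp: ts)
  have home: "e i = Home (w (code i 0))" if "coded L M \<Sigma> (set is) t w e" "i \<in> set is" "t i = KHome" for i w e
    using that unfolding coded_def by auto
  have nhome: "\<nexists>x. e i = Home x" if "coded L M \<Sigma> (set is) t w e" "i \<in> set is" "t i \<noteq> KHome" for i w e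
    using that unfolding coded_def other_def by (cases "t i") auto
  show ?case
  proof (cases r)
    case (Old_Rel r')
    have wf: "(r', length is) \<in> rels L" using Atom.prems(1) unfolding Old_Rel ts by (auto simp: eq_lang_def)
    show ?thesis
    proof (cases "\<forall>i\<in>set is. t i = KHome")
      case True
      have "expressible L M (\<lambda>w. sat M w (Atom r' (map (\<lambda>i. Var (code i 0)) is)))"
        by (rule expressible_sat) (use wf in auto)
      moreover have "sat (eq_struct L M) e (Atom r ts) \<longleftrightarrow> sat M w (Atom r' (map (\<lambda>i. Var (code i 0)) is))"
        if "coded L M \<Sigma> (set is) t w e" for w e
        using map_eq_Home_iff[of "is" e "\<lambda>i. w (code i 0)"] home[OF that] True
        unfolding satA unfolding Old_Rel by (auto simp: comp_def)
      ultimately show ?thesis unfolding fvA by blast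
    next
      case False
      then obtain i where i: "i \<in> set is" "t i \<noteq> KHome" by auto
      have "\<not> sat (eq_struct L M) e (Atom r ts)" if "coded L M \<Sigma> (set is) t w e" for w e
      proof
        assume "sat (eq_struct L M) e (Atom r ts)"
        then obtain xs where "map e is = map Home xs" unfolding satA unfolding Old_Rel by auto
        then have "e i \<in> set (map Home xs)" using i(1) by (metis image_eqI set_map)
        then show False using nhome[OF that i] by auto
      qed
      then show ?thesis unfolding fvA using expressible_const[of L M False] by blast
    qed
  next
    case (Graph f)
    have wf: "\<exists>n. length is = Suc n \<and> (f, n) \<in> funs L"
      using Atom.prems(1) unfolding Graph ts by (auto simp: eq_lang_def)
    then obtain js j where js: "is = js @ [j]" "(f, length js) \<in> funs L"
      by (cases "is" rule: rev_cases) auto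
    show ?thesis
    proof (cases "\<forall>i\<in>set is. t i = KHome")
      case True
      let ?\<chi> = "Equal (Fn f (map (\<lambda>i. Var (code i 0)) js)) (Var (code j 0)) :: ('f, 'r) fm"
      have "expressible L M (\<lambda>w. sat M w ?\<chi>)"
        by (rule expressible_sat) (use js in auto)
      moreover have "sat (eq_struct L M) e (Atom r ts) \<longleftrightarrow> sat M w ?\<chi>"
        if c: "coded L M \<Sigma> (set is) t w e" for w e
      proof -
        have "map e js = map Home xs \<longleftrightarrow> xs = map (\<lambda>i. w (code i 0)) js" for xs
          by (rule map_eq_Home_iff) (use home[OF c] True js in auto)
        moreover have "e j = Home (w (code j 0))" using home[OF c] True js by auto
        ultimately show ?thesis unfolding satA unfolding Graph js(1) by (auto simp: comp_def)
      qed
      ultimately show ?thesis unfolding fvA by blast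
    next
      case False
      then obtain i where i: "i \<in> set is" "t i \<noteq> KHome" by auto
      have "\<not> sat (eq_struct L M) e (Atom r ts)" if "coded L M \<Sigma> (set is) t w e" for w e
      proof
        assume "sat (eq_struct L M) e (Atom r ts)"
        then obtain xs where "map e is = map Home (xs @ [fn M f xs])" unfolding satA unfolding Graph by auto
        then have "e i \<in> set (map Home (xs @ [fn M f xs]))" using i(1) by (metis image_eqI set_map)
        then show False using nhome[OF that i] by auto
      qed
      then show ?thesis unfolding fvA using expressible_const[of L M False] by blast
    qed
  next
    case (Proj k \<epsilon>)
    have ke: "(k, \<epsilon>) \<in> \<Sigma>" using Atom.prems(2) Proj by auto
    then have ks: "(k, \<epsilon>) \<in> imag_sorts L M" using \<Sigma> by auto
    have "length is = Suc k"
      using Atom.prems(1) unfolding Proj ts by (auto simp: eq_lang_def)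
    then obtain js j where js: "is = js @ [j]" "length js = k"
      by (cases "is" rule: rev_cases) auto
    show ?thesis
    proof (cases "(\<forall>i\<in>set js. t i = KHome) \<and> t j = KSort k \<epsilon>")
      case True
      \<comment> \<open>\<open>\<epsilon>\<close> compares the tuple of home values with the stored
        representative of the class.\<close>
      let ?\<rho> = "\<lambda>v. if v < k then code (js ! v) 0 else code j (v - k)"
      have "expressible L M (\<lambda>w. sat M (w \<circ> ?\<rho>) \<epsilon>)"
        by (rule expressible_rename, rule expressible_sat)
          (use ks in \<open>auto simp: imag_sorts_def formulas_def\<close>)
      moreover have "sat (eq_struct L M) e (Atom r ts) \<longleftrightarrow> sat M (w \<circ> ?\<rho>) \<epsilon>"
        if w: "range w \<subseteq> carrier M" and c: "coded L M \<Sigma> (set is) t w e" for w e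
      proof -
        let ?xs = "map (\<lambda>i. w (code i 0)) js"
        let ?x = "\<lambda>i\<in>{..<k}. ?xs ! i"
        have "map e js = map Home xs \<longleftrightarrow> xs = ?xs" for xs
          by (rule map_eq_Home_iff) (use home[OF c] True js in auto)
        moreover have ej: "e j = Imag k \<epsilon> (eqc M k \<epsilon> w j)" using c True js unfolding coded_def by auto
        ultimately have "sat (eq_struct L M) e (Atom r ts) \<longleftrightarrow> def_rel M k \<epsilon> `` {?x} = eqc M k \<epsilon> w j"
          unfolding satA unfolding Proj js(1) using js(2) by auto
        also have "\<dots> \<longleftrightarrow> sat M (tcat k ?x (\<lambda>i. w (code j i))) \<epsilon>"
          by (rule eqc_eq_iff) (use ks w js in \<open>auto split: if_splits\<close>)
        also have "tcat k ?x (\<lambda>i. w (code j i)) = w \<circ> ?\<rho>" using js by (auto simp: tcat_def fun_eq_iff)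
        finally show ?thesis .
      qed
      ultimately show ?thesis unfolding fvA by blast
    next
      case False
      have "\<not> sat (eq_struct L M) e (Atom r ts)" if c: "coded L M \<Sigma> (set is) t w e" for w e
      proof
        assume "sat (eq_struct L M) e (Atom r ts)"
        then obtain xs C where xs: "map e js = map Home xs" "e j = Imag k \<epsilon> C" unfolding satA unfolding Proj js(1) by auto
        have "t i = KHome" if "i \<in> set js" for i
        proof -
          have "e i \<in> set (map Home xs)" using that xs(1) by (metis image_eqI set_map)
          then show ?thesis using nhome[OF c, of i] that js by auto
        qed
        then have "t j \<noteq> KSort k \<epsilon>" using False by auto
        moreover have "j \<in> set is" using js by auto
        ultimately show False using c xs(2) ke unfolding coded_def other_def by (cases "t j") fastforce+
      qed
      then show ?thesis unfolding fvA using expressible_const[of L M False] by blast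
    qed
  qed
next
  case (Neg \<psi>)
  obtain P where P: "expressible L M P" "\<And>w e. range w \<subseteq> carrier M \<and> coded L M \<Sigma> (fv \<psi>) t w e \<Longrightarrow> (sat (eq_struct L M) e \<psi> \<longleftrightarrow> P w)"
    using Neg.IH[of t] Neg.prems by auto
  then show ?case using expressible_not[OF P(1)] by (intro exI[of _ "\<lambda>w. \<not> P w"]) auto
next
  case (Conj \<psi> \<chi>)
  obtain P where P: "expressible L M P" "\<And>w e. range w \<subseteq> carrier M \<and> coded L M \<Sigma> (fv \<psi>) t w e \<Longrightarrow> (sat (eq_struct L M) e \<psi> \<longleftrightarrow> P w)"
    using Conj.IH(1)[of t] Conj.prems by auto
  obtain Q where Q: "expressible L M Q" "\<And>w e. range w \<subseteq> carrier M \<and> coded L M \<Sigma> (fv \<chi>) t w e \<Longrightarrow> (sat (eq_struct L M) e \<chi> \<longleftrightarrow> Q w)"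
    using Conj.IH(2)[of t] Conj.prems by auto
  have "sat (eq_struct L M) e (Conj \<psi> \<chi>) \<longleftrightarrow> P w \<and> Q w"
    if "range w \<subseteq> carrier M" "coded L M \<Sigma> (fv (Conj \<psi> \<chi>)) t w e" for w e
    using P(2)[of w e] Q(2)[of w e] that coded_mono[OF that(2), of "fv \<psi>"] coded_mono[OF that(2), of "fv \<chi>"] by auto
  then show ?case using expressible_conj[OF P(1) Q(1)] by blast
next
  case (Exists i \<psi>)
  define lab where "lab \<kappa> = (case \<kappa> of KOther l \<Rightarrow> l | _ \<Rightarrow> 0)" for \<kappa> :: "('f, 'r) kind"
  obtain l0 where l0: "l0 \<notin> (\<lambda>j. lab (t j)) ` fv \<psi>"
    using ex_new_if_finite[OF infinite_UNIV_nat finite_imageI[OF finite_fv]] by blast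
  define \<K> where "\<K> = {KHome} \<union> (\<lambda>(k, \<epsilon>). KSort k \<epsilon>) ` \<Sigma> \<union> KOther ` insert l0 ((\<lambda>j. lab (t j)) ` fv \<psi>)"
  have "\<forall>\<kappa>. \<exists>P. expressible L M P \<and>
      (\<forall>w e. range w \<subseteq> carrier M \<and> coded L M \<Sigma> (fv \<psi>) (t(i := \<kappa>)) w e \<longrightarrow> (sat (eq_struct L M) e \<psi> \<longleftrightarrow> P w))"
    using Exists.IH Exists.prems by auto
  then obtain P where P: "\<And>\<kappa>. expressible L M (P \<kappa>)"
    "\<And>\<kappa> w e. range w \<subseteq> carrier M \<Longrightarrow> coded L M \<Sigma> (fv \<psi>) (t(i := \<kappa>)) w e \<Longrightarrow> (sat (eq_struct L M) e \<psi> \<longleftrightarrow> P \<kappa> w)"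
    by metis
  \<comment> \<open>The variables of \<open>M\<close> that hold the coordinates of the bound value,
    and so the ones to be quantified.\<close>
  define V where "V \<kappa> = (case \<kappa> of KHome \<Rightarrow> {code i 0} | KSort k \<epsilon> \<Rightarrow> code i ` {..<k} | KOther l \<Rightarrow> {})" for \<kappa> :: "('f, 'r) kind"
  have V: "finite (V \<kappa>)" for \<kappa> by (auto simp: V_def split: kind.splits)
  have Vi: "code i' j \<notin> V \<kappa>" if "i' \<noteq> i" for i' j \<kappa> using that by (auto simp: V_def split: kind.splits)
  define Q where "Q w \<longleftrightarrow> (\<exists>\<kappa>\<in>\<K>. \<exists>w'. range w' \<subseteq> carrier M \<and> (\<forall>v. v \<notin> V \<kappa> \<longrightarrow> w' v = w v) \<and> P \<kappa> w')" for w
  have finK: "finite \<K>" unfolding \<K>_def using \<Sigma> by (auto simp: finite_fv)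
  have "expressible L M Q"
    unfolding Q_def[abs_def] by (rule expressible_bex[OF finK], rule expressible_ex_set[OF V P(1)])
  moreover have "sat (eq_struct L M) e (Exists i \<psi>) \<longleftrightarrow> Q w"
    if w: "range w \<subseteq> carrier M" and c: "coded L M \<Sigma> (fv (Exists i \<psi>)) t w e" for w e
  proof -
    have c': "coded L M \<Sigma> (fv \<psi> - {i}) t w e" using c by simp
    have cO: "l = l' \<longleftrightarrow> e j = e j'"
      if "j \<in> fv \<psi> - {i}" "j' \<in> fv \<psi> - {i}" "t j = KOther l" "t j' = KOther l'" for j j' l l'
      using c' that unfolding coded_def by blast
    have cK: "e j \<in> other L M \<Sigma>" if "j \<in> fv \<psi> - {i}" "t j = KOther l" for j l
    proof -
      have "case t j of KHome \<Rightarrow> e j = Home (w (code j 0))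
          | KSort k \<epsilon> \<Rightarrow> (k, \<epsilon>) \<in> \<Sigma> \<and> e j = Imag k \<epsilon> (eqc M k \<epsilon> w j)
          | KOther l \<Rightarrow> e j \<in> other L M \<Sigma>"
        using c' that(1) unfolding coded_def by blast
      then show ?thesis using that(2) by simp
    qed
    show ?thesis
    proof
      assume "sat (eq_struct L M) e (Exists i \<psi>)"
      then obtain a where a: "a \<in> carrier (eq_struct L M)" "sat (eq_struct L M) (e(i := a)) \<psi>" by auto
      have QI: "Q w" if "\<kappa> \<in> \<K>" "range w' \<subseteq> carrier M" "\<forall>v. v \<notin> V \<kappa> \<longrightarrow> w' v = w v"
        "case \<kappa> of KHome \<Rightarrow> a = Home (w' (code i 0))
        | KSort k \<epsilon> \<Rightarrow> (k, \<epsilon>) \<in> \<Sigma> \<and> a = Imag k \<epsilon> (eqc M k \<epsilon> w' i)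
        | KOther l \<Rightarrow> a \<in> other L M \<Sigma> \<and> (\<forall>j\<in>fv \<psi> - {i}. \<forall>l'. t j = KOther l' \<longrightarrow> (l = l' \<longleftrightarrow> a = e j))"
        for \<kappa> w'
      proof -
        have "coded L M \<Sigma> (fv \<psi>) (t(i := \<kappa>)) w' (e(i := a))"
          by (rule coded_update[where w = w]) (use c that Vi in auto)
        then show ?thesis unfolding Q_def using P(2)[OF that(2)] a that by blast
      qed
      consider (h) x where "a = Home x" "x \<in> carrier M"
        | (s) k \<epsilon> x where "(k, \<epsilon>) \<in> \<Sigma>" "x \<in> tuples (carrier M) k" "a = Imag k \<epsilon> (def_rel M k \<epsilon> `` {x})"
        | (o) "a \<in> other L M \<Sigma>"
        using a(1) unfolding other_def eq_struct_def by (auto elim!: quotientE) blast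
      then show "Q w"
      proof cases
        case h
        show ?thesis
          by (rule QI[of KHome "w(code i 0 := x)"]) (use w h in \<open>auto simp: \<K>_def V_def\<close>)
      next
        case s
        define w' where "w' v = (if v \<in> code i ` {..<k} then x (snd (prod_decode v)) else w v)" for v
        have w'i: "w' (code i j) = x j" if "j < k" for j using that by (auto simp: w'_def code_def)
        have "(\<lambda>j\<in>{..<k}. w' (code i j)) = x" using s(2) w'i by (auto simp: fun_eq_iff PiE_iff extensional_def)
        then have "a = Imag k \<epsilon> (eqc M k \<epsilon> w' i)" using s by simp
        moreover have "range w' \<subseteq> carrier M" using w s by (auto simp: w'_def code_def PiE_iff)
        moreover have "KSort k \<epsilon> \<in> \<K>" using s by (auto simp: \<K>_def)
        ultimately show ?thesis
          using s by (intro QI[of "KSort k \<epsilon>" w']) (simp_all add: V_def w'_def)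
      next
        case o
        \<comment> \<open>A value that is already present takes over its label, a new one gets
          \<open>l0\<close>.\<close>
        show ?thesis
        proof (cases "\<exists>j\<in>fv \<psi> - {i}. \<exists>l. t j = KOther l \<and> e j = a")
          case True
          then obtain j l where jl: "j \<in> fv \<psi> - {i}" "t j = KOther l" "e j = a" by auto
          have "l = l' \<longleftrightarrow> a = e j'" if "j' \<in> fv \<psi> - {i}" "t j' = KOther l'" for j' l'
            using cO[OF jl(1) that(1) jl(2) that(2)] jl(3) by simp
          moreover have "lab (t j) = l" using jl by (simp add: lab_def)
          then have "KOther l \<in> \<K>" using jl unfolding \<K>_def by blast
          ultimately show ?thesis using o w by (intro QI[of "KOther l" w]) auto
        next
          case False
          have "l0 \<noteq> l'" if "j' \<in> fv \<psi>" "t j' = KOther l'" for j' l'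
          proof -
            have "lab (t j') = l'" using that by (simp add: lab_def)
            then show ?thesis using l0 that by blast
          qed
          then show ?thesis using o w False by (intro QI[of "KOther l0" w]) (auto simp: \<K>_def)
        qed
      qed
    next
      assume "Q w"
      then obtain \<kappa> w' where k: "\<kappa> \<in> \<K>" "range w' \<subseteq> carrier M" "\<forall>v. v \<notin> V \<kappa> \<longrightarrow> w' v = w v" "P \<kappa> w'"
        unfolding Q_def by auto
      have "\<exists>a\<in>carrier (eq_struct L M). case \<kappa> of KHome \<Rightarrow> a = Home (w' (code i 0))
        | KSort k \<epsilon> \<Rightarrow> (k, \<epsilon>) \<in> \<Sigma> \<and> a = Imag k \<epsilon> (eqc M k \<epsilon> w' i)
        | KOther l \<Rightarrow> a \<in> other L M \<Sigma> \<and> (\<forall>j\<in>fv \<psi> - {i}. \<forall>l'. t j = KOther l' \<longrightarrow> (l = l' \<longleftrightarrow> a = e j))"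
      proof (cases \<kappa>)
        case KHome
        then show ?thesis using k(2) by (auto simp: eq_struct_def)
      next
        case (KSort k' \<epsilon>)
        then have "(k', \<epsilon>) \<in> \<Sigma>" using k(1) by (auto simp: \<K>_def)
        moreover have "eqc M k' \<epsilon> w' i \<in> tuples (carrier M) k' // def_rel M k' \<epsilon>"
          using k(2) by (intro quotientI) auto
        ultimately show ?thesis using KSort \<Sigma>(2) by (auto simp: eq_struct_def)
      next
        case (KOther l)
        show ?thesis
        proof (cases "\<exists>j\<in>fv \<psi> - {i}. t j = KOther l")
          case True
          then obtain j where j: "j \<in> fv \<psi> - {i}" "t j = KOther l" by auto
          have ej: "e j \<in> other L M \<Sigma>" by (rule cK[OF j])
          have "l = l' \<longleftrightarrow> e j = e j'" if "j' \<in> fv \<psi> - {i}" "t j' = KOther l'" for j' l'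
            by (rule cO[OF j(1) that(1) j(2) that(2)])
          moreover have "e j \<in> carrier (eq_struct L M)" using ej by (simp add: other_def)
          ultimately show ?thesis using ej unfolding KOther kind.case by blast
        next
          case False
          have "\<not> other L M \<Sigma> \<subseteq> e ` fv \<psi>"
          proof
            assume "other L M \<Sigma> \<subseteq> e ` fv \<psi>"
            then have "finite (other L M \<Sigma>)" by (rule finite_subset) (rule finite_imageI[OF finite_fv])
            then show False using infinite_other[OF \<Sigma>(1) M] by simp
          qed
          then obtain a where a: "a \<in> other L M \<Sigma>" "a \<notin> e ` fv \<psi>" by blast
          have "l = l' \<longleftrightarrow> a = e j'" if "j' \<in> fv \<psi> - {i}" "t j' = KOther l'" for j' l'
            using that False a(2) by auto
          moreover have "a \<in> carrier (eq_struct L M)" using a(1) by (simp add: other_def)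
          ultimately show ?thesis using a(1) unfolding KOther kind.case by blast
        qed
      qed
      then obtain a where a: "a \<in> carrier (eq_struct L M)" "case \<kappa> of KHome \<Rightarrow> a = Home (w' (code i 0))
        | KSort k \<epsilon> \<Rightarrow> (k, \<epsilon>) \<in> \<Sigma> \<and> a = Imag k \<epsilon> (eqc M k \<epsilon> w' i)
        | KOther l \<Rightarrow> a \<in> other L M \<Sigma> \<and> (\<forall>j\<in>fv \<psi> - {i}. \<forall>l'. t j = KOther l' \<longrightarrow> (l = l' \<longleftrightarrow> a = e j))"
        by blast
      have "coded L M \<Sigma> (fv \<psi>) (t(i := \<kappa>)) w' (e(i := a))"
        by (rule coded_update[OF _ _ a(2), of w]) (use c k Vi in auto)
      then show "sat (eq_struct L M) e (Exists i \<psi>)" using P(2)[OF k(2)] k(4) a(1) by auto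
    qed
  qed
  ultimately show ?case by blast
qed

definition home_tuple :: "nat \<Rightarrow> (nat \<Rightarrow> 'a) \<Rightarrow> nat \<Rightarrow> ('a, 'f, 'r) eq_elem" where
  "home_tuple k x = (\<lambda>i\<in>{..<k}. Home (x i))"

lemma home_tuple_inj: "inj_on (home_tuple k :: _ \<Rightarrow> _ \<Rightarrow> ('a, 'f, 'r) eq_elem) (tuples A k)"
proof (rule inj_onI)
  fix x y assume x: "x \<in> tuples A k" "y \<in> tuples A k" and e: "home_tuple k x = (home_tuple k y :: _ \<Rightarrow> ('a, 'f, 'r) eq_elem)"
  have "x i = y i" if "i < k" for i using fun_cong[OF e, of i] that by (simp add: home_tuple_def)
  then show "x = y" using x by (intro PiE_ext) auto
qed

lemma acleq0_definable_iff:
  "acleq0_definable L M k D \<longleftrightarrow> D \<subseteq> tuples (carrier M) k \<and>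
     definable (eq_lang L M) (eq_struct L M) (acleq0 L M) k (home_tuple k ` D)"
  unfolding acleq0_definable_def home_tuple_def[abs_def] ..

lemma home_in_carrier: "a \<in> carrier M \<Longrightarrow> Home a \<in> carrier (eq_struct L M)"
  by (simp add: eq_struct_def)

lemma home_tuple_in: "x \<in> tuples (carrier M) k \<Longrightarrow> home_tuple k x \<in> tuples (carrier (eq_struct L M)) k"
  by (auto simp: home_tuple_def intro!: home_in_carrier)

lemma acleq0_subset_carrier: "acleq0 L M \<subseteq> carrier (eq_struct L M)"
  unfolding acleq0_def by (rule acl_subset_carrier)

text \<open>Home elements replace the parameters, each imaginary one giving way to a tuple that
  represents its class. The outcome is definability in \<open>M\<close> with parameters, which
  suffices for building patterns and for applying one-basedness.\<close>

lemma acleq0_definable_expressible: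
  fixes M :: "('a, 'f, 'r, 'y) fo_struct_scheme" and L :: "('f, 'r, 'z) lang_scheme"
  assumes M: "is_struct L M" and D: "acleq0_definable L M k D"
  shows "\<exists>P c. expressible L M P \<and> range c \<subseteq> carrier M \<and> D = {x \<in> tuples (carrier M) k. P (tcat k x c)}"
proof -
  have DM: "D \<subseteq> tuples (carrier M) k" using D by (simp add: acleq0_definable_def)
  obtain n \<phi> b where \<phi>: "\<phi> \<in> formulas (eq_lang L M) k n" and b: "b \<in> tuples (acleq0 L M) n"
    and Ds: "home_tuple k ` D = solset (eq_struct L M) k \<phi> b"
    using D unfolding acleq0_definable_iff definable_def by auto
  have bc: "b i \<in> carrier (eq_struct L M)" if "i < n" for i
    using b that acleq0_subset_carrier by (auto simp: PiE_iff)
  obtain a0 where a0: "a0 \<in> carrier M" using M by (auto simp: is_struct_def)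
  \<comment> \<open>\<open>f\<close> lists the coordinates of a representative of the parameter
    \<open>b i\<close>.\<close>
  define Q where "Q i f \<longleftrightarrow> range f \<subseteq> carrier M \<and> (case b i of Home a \<Rightarrow> f 0 = a
      | Imag s \<epsilon> C \<Rightarrow> (s, \<epsilon>) \<in> imag_sorts L M \<and> C = def_rel M s \<epsilon> `` {restrict f {..<s}})" for i f
  have "\<exists>f. Q i f" if i: "i < n" for i
  proof (cases "b i")
    case (Home a)
    then have "a \<in> carrier M" using bc[OF i] by (auto simp: eq_struct_def)
    then show ?thesis using Home by (intro exI[of _ "\<lambda>_. a"]) (auto simp: Q_def)
  next
    case (Imag s \<epsilon> C)
    then have se: "(s, \<epsilon>) \<in> imag_sorts L M" "C \<in> tuples (carrier M) s // def_rel M s \<epsilon>"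
      using bc[OF i] by (auto simp: eq_struct_def)
    then obtain x where x: "x \<in> tuples (carrier M) s" "C = def_rel M s \<epsilon> `` {x}" by (auto elim!: quotientE)
    let ?f = "\<lambda>j. if j < s then x j else a0"
    have "restrict ?f {..<s} = x" using x(1) by (auto simp: fun_eq_iff PiE_iff extensional_def)
    moreover have "range ?f \<subseteq> carrier M" using x(1) a0 by (auto simp: PiE_iff)
    ultimately show ?thesis using Imag se x by (intro exI[of _ ?f]) (simp add: Q_def)
  qed
  then obtain r where "\<And>i. i < n \<Longrightarrow> Q i (r i)" by metis
  then have r: "range (r i) \<subseteq> carrier M \<and> (case b i of Home a \<Rightarrow> r i 0 = a
      | Imag s \<epsilon> C \<Rightarrow> (s, \<epsilon>) \<in> imag_sorts L M \<and> C = def_rel M s \<epsilon> `` {restrict (r i) {..<s}})" if "i < n" for i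
    using that unfolding Q_def by blast
  define r' where "r' i = (if i < n then r i else (\<lambda>_. a0))" for i
  have r'c: "r' i j \<in> carrier M" for i j using r[of i] a0 by (auto simp: r'_def)
  \<comment> \<open>The object variables are home variables, and the sorts of the parameters go into
    \<open>\<Sigma>\<close>; so no free variable has kind \<open>KOther\<close>.\<close>
  define t where "t i = (if i < k then KHome else case b (i - k) of Home a \<Rightarrow> KHome | Imag s \<epsilon> C \<Rightarrow> KSort s \<epsilon>)" for i
  define \<Sigma> where "\<Sigma> = proj_sorts \<phi> \<union> (\<lambda>i. case b i of Home a \<Rightarrow> undefined | Imag s \<epsilon> C \<Rightarrow> (s, \<epsilon>)) ` {i. i < n \<and> (\<exists>s \<epsilon> C. b i = Imag s \<epsilon> C)}"
  have wf: "wf_fm (eq_lang L M) \<phi>" "fv \<phi> \<subseteq> {..<k + n}" using \<phi> by (auto simp: formulas_def)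
  have S1: "finite \<Sigma>" unfolding \<Sigma>_def using proj_sorts_imag[OF wf(1)] by auto
  have S2: "\<Sigma> \<subseteq> imag_sorts L M"
  proof
    fix p assume "p \<in> \<Sigma>"
    then consider "p \<in> proj_sorts \<phi>" | i s \<epsilon> C where "i < n" "b i = Imag s \<epsilon> C" "p = (s, \<epsilon>)"
      unfolding \<Sigma>_def by auto
    then show "p \<in> imag_sorts L M"
    proof cases
      case 1
      then show ?thesis using proj_sorts_imag[OF wf(1)] by auto
    next
      case 2
      then show ?thesis using r[OF 2(1)] by auto
    qed
  qed
  have S3: "(s, \<epsilon>) \<in> \<Sigma>" if "i < n" "b i = Imag s \<epsilon> C" for i s \<epsilon> C
    using that unfolding \<Sigma>_def by (auto intro!: image_eqI[of _ _ i])
  obtain P0 where P0: "expressible L M P0"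
    "\<And>w e. range w \<subseteq> carrier M \<Longrightarrow> coded L M \<Sigma> (fv \<phi>) t w e \<Longrightarrow> (sat (eq_struct L M) e \<phi> \<longleftrightarrow> P0 w)"
    using eliminate_imaginaries[OF M S1 S2 wf(1), of t] unfolding \<Sigma>_def by blast
  \<comment> \<open>All coordinates of an object variable \<open>i < k\<close> are read off at
    \<open>x i\<close>; those of a parameter point into the sequence \<open>c\<close>, which is
    \<open>r'\<close> laid out by \<open>code\<close>.\<close>
  define \<rho> where "\<rho> v = (case prod_decode v of (i, j) \<Rightarrow> if i < k then i else k + code (i - k) j)" for v
  define c where "c v = (case prod_decode v of (i, j) \<Rightarrow> r' i j)" for v
  have cc: "range c \<subseteq> carrier M" using r'c by (auto simp: c_def split: prod.splits)
  have main: "home_tuple k x \<in> solset (eq_struct L M) k \<phi> b \<longleftrightarrow> P0 (tcat k x c \<circ> \<rho>)"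
    if x: "x \<in> tuples (carrier M) k" for x
  proof -
    let ?w = "tcat k x c \<circ> \<rho>" and ?e = "tcat k (home_tuple k x) b"
    have w: "?w (code i j) = (if i < k then x i else r' (i - k) j)" for i j
      by (simp add: \<rho>_def code_def c_def)
    have "range (tcat k x c) \<subseteq> carrier M" using range_tcat[OF x cc] .
    then have rw: "range ?w \<subseteq> carrier M" by auto
    have "case t i of KHome \<Rightarrow> ?e i = Home (?w (code i 0))
        | KSort s \<epsilon> \<Rightarrow> (s, \<epsilon>) \<in> \<Sigma> \<and> ?e i = Imag s \<epsilon> (eqc M s \<epsilon> ?w i)
        | KOther l \<Rightarrow> ?e i \<in> other L M \<Sigma>" if i: "i \<in> fv \<phi>" for i
    proof (cases "i < k")
      case True
      then have "?w (code i 0) = x i" unfolding w by simp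
      moreover have "?e i = Home (x i)" using True by (simp add: home_tuple_def)
      ultimately show ?thesis using True by (simp add: t_def del: comp_apply)
    next
      case False
      then have ik: "i - k < n" using i wf(2) by auto
      have w': "?w (code i j) = r (i - k) j" for j unfolding w using False ik by (simp add: r'_def)
      have ei: "?e i = b (i - k)" using False by simp
      show ?thesis
      proof (cases "b (i - k)")
        case (Home a)
        then have "?w (code i 0) = a" unfolding w' using r[OF ik] by simp
        then show ?thesis using False Home ei by (simp add: t_def del: comp_apply)
      next
        case (Imag s \<epsilon> C)
        then have "C = def_rel M s \<epsilon> `` {restrict (r (i - k)) {..<s}}" using r[OF ik] by simp
        also have "restrict (r (i - k)) {..<s} = (\<lambda>j\<in>{..<s}. ?w (code i j))" unfolding w' ..
        finally have CC: "C = eqc M s \<epsilon> ?w i" .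
        have "?e i = Imag s \<epsilon> (eqc M s \<epsilon> ?w i)" unfolding ei Imag CC ..
        then show ?thesis using False Imag S3[OF ik Imag] by (simp add: t_def del: comp_apply)
      qed
    qed
    moreover have "t i \<noteq> KOther l" for i l by (auto simp: t_def split: eq_elem.splits)
    ultimately have "coded L M \<Sigma> (fv \<phi>) t ?w ?e" unfolding coded_def by blast
    then have "sat (eq_struct L M) ?e \<phi> \<longleftrightarrow> P0 ?w" by (rule P0(2)[OF rw])
    then show ?thesis unfolding solset_def using home_tuple_in[OF x, of L] by simp
  qed
  have "x \<in> D \<longleftrightarrow> P0 (tcat k x c \<circ> \<rho>)" if x: "x \<in> tuples (carrier M) k" for x
  proof -
    have "x \<in> D \<longleftrightarrow> (home_tuple k x :: nat \<Rightarrow> ('a, 'f, 'r) eq_elem) \<in> home_tuple k ` D"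
      using inj_on_image_mem_iff[OF home_tuple_inj x DM] by metis
    then show ?thesis using main[OF x] unfolding Ds by simp
  qed
  then have "D = {x \<in> tuples (carrier M) k. P0 (tcat k x c \<circ> \<rho>)}" using DM by auto
  moreover have "expressible L M (\<lambda>e. P0 (e \<circ> \<rho>))" by (rule expressible_rename[OF P0(1)])
  ultimately show ?thesis using cc by (intro exI[of _ "\<lambda>e. P0 (e \<circ> \<rho>)"] exI[of _ c]) simp
qed

section \<open>The acl^eq(0)-definable subgroups of the powers of the group\<close>

locale group_structure =
  fixes L :: "('f, 'r) lang" and M :: "('a, 'f, 'r) fo_struct" and G :: "'a monoid" and mu :: 'f
  assumes group_struct: "group_struct L mu M G"
begin

abbreviation "\<H> \<equiv> acleq0_subgroups L M G"

abbreviation ht :: "nat \<Rightarrow> (nat \<Rightarrow> 'a) \<Rightarrow> nat \<Rightarrow> ('a, 'f, 'r) eq_elem" where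
  "ht \<equiv> home_tuple"

lemma struct: "is_struct L M" and group_G: "group G" and carrier_G: "carrier G = carrier M"
  and mu: "(mu, 2) \<in> funs L"
  and mu_eq: "\<lbrakk>x \<in> carrier M; y \<in> carrier M\<rbrakk> \<Longrightarrow> fn M mu [x, y] = x \<otimes>\<^bsub>G\<^esub> y"
  using group_struct by (auto simp: group_struct_def)

lemma group_K: "group (group_pow G m)"
  using group_G by (intro product_group) auto

lemma carrier_K: "carrier (group_pow G m) = tuples (carrier M) m"
  by (simp add: carrier_G)

lemma graph_mu_iff:
  "eq_holds M (Graph mu) [u, v, w] \<longleftrightarrow> (\<exists>a b. u = Home a \<and> v = Home b \<and> w = Home (fn M mu [a, b]))"
proof
  assume "eq_holds M (Graph mu) [u, v, w]"
  then obtain xs where xs: "[u, v, w] = map Home xs @ [Home (fn M mu xs)]"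
    unfolding eq_holds.simps by blast
  then have "length xs = 2" by (metis One_nat_def Suc_1 Suc_inject length_Cons length_append_singleton length_map list.size(3))
  then obtain a b where "xs = [a, b]" by (metis One_nat_def Suc_1 length_0_conv length_Suc_conv)
  then show "\<exists>a b. u = Home a \<and> v = Home b \<and> w = Home (fn M mu [a, b])" using xs by auto
next
  assume "\<exists>a b. u = Home a \<and> v = Home b \<and> w = Home (fn M mu [a, b])"
  then obtain a b where "u = Home a \<and> v = Home b \<and> w = Home (fn M mu [a, b])" by auto
  then show "eq_holds M (Graph mu) [u, v, w]" by (auto intro!: exI[of _ "[a, b]"])
qed

text \<open>The identity is the only solution of \<open>x x = x\<close>. It makes the parameter set
  nonempty, as \<open>definable_iff\<close> demands.\<close>

lemma one_acleq0: "Home \<one>\<^bsub>G\<^esub> \<in> acleq0 L M"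
proof -
  let ?\<phi> = "Atom (Graph mu) [Var 0, Var 0, Var 0] :: ('f, ('f, 'r) eq_rel) fm"
  have one: "\<one>\<^bsub>G\<^esub> \<in> carrier M" using group_G carrier_G by (metis group.is_monoid monoid.one_closed)
  have iff: "sat (eq_struct L M) e ?\<phi> \<longleftrightarrow> e 0 = Home \<one>\<^bsub>G\<^esub>" if "e 0 \<in> carrier (eq_struct L M)" for e
  proof -
    have "sat (eq_struct L M) e ?\<phi> \<longleftrightarrow> eq_holds M (Graph mu) [e 0, e 0, e 0]" by (simp add: eq_struct_def)
    also have "\<dots> \<longleftrightarrow> (\<exists>a\<in>carrier M. e 0 = Home a \<and> a = a \<otimes>\<^bsub>G\<^esub> a)"
      unfolding graph_mu_iff using that mu_eq by (auto simp: eq_struct_def)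
    also have "\<dots> \<longleftrightarrow> e 0 = Home \<one>\<^bsub>G\<^esub>"
      using group.l_cancel_one'[OF group_G] one carrier_G by (metis group.r_cancel_one' group_G)
    finally show ?thesis .
  qed
  have "solset (eq_struct L M) 1 ?\<phi> (\<lambda>_. undefined) = {\<lambda>i\<in>{..<1}. Home \<one>\<^bsub>G\<^esub>}" (is "?S = {?u}")
  proof -
    have "?u \<in> tuples (carrier (eq_struct L M)) 1" using one by (auto simp: home_in_carrier)
    moreover have "x = ?u" if "x \<in> tuples (carrier (eq_struct L M)) 1" "x 0 = Home \<one>\<^bsub>G\<^esub>" for x
      using that by (intro PiE_ext[of x "{..<1}" "\<lambda>_. carrier (eq_struct L M)"]) (use one home_in_carrier in auto)
    moreover have "sat (eq_struct L M) (tcat 1 x (\<lambda>_. undefined)) ?\<phi> \<longleftrightarrow> x 0 = Home \<one>\<^bsub>G\<^esub>"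
      if "x \<in> tuples (carrier (eq_struct L M)) 1" for x
      using iff[of "tcat 1 x (\<lambda>_. undefined)"] that by (simp add: PiE_iff)
    ultimately show ?thesis unfolding solset_def by (intro equalityI subsetI) (auto simp del: sat.simps)
  qed
  moreover have "?\<phi> \<in> formulas (eq_lang L M) 1 0" using mu by (auto simp: formulas_def eq_lang_def numeral_2_eq_2)
  ultimately have "definable (eq_lang L M) (eq_struct L M) {} 1 {?u}"
    unfolding definable_def
    by (intro exI[of _ 0] bexI[of _ ?\<phi>] bexI[of _ "\<lambda>_. undefined"]) (simp_all del: sat.simps)
  then show ?thesis unfolding acleq0_def acl_def by (auto intro!: exI[of _ "{?u}"])
qed

lemma acleq0_nonempty: "acleq0 L M \<noteq> {}" using one_acleq0 by auto

lemmas eq_definable_iff = definable_iff[OF acleq0_nonempty acleq0_subset_carrier]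

lemma subgroup_\<H>: "H \<in> \<H> m \<Longrightarrow> subgroup H (group_pow G m)"
  by (simp add: acleq0_subgroups_def)

lemma \<H>_Int:
  assumes "H \<in> \<H> m" "N \<in> \<H> m"
  shows "H \<inter> N \<in> \<H> m"
proof -
  have "ht m ` (H \<inter> N) = ht m ` H \<inter> ht m ` N"
    by (rule inj_on_image_Int[OF home_tuple_inj[of m "carrier M"]])
      (use assms in \<open>auto simp: acleq0_subgroups_def acleq0_definable_def\<close>)
  moreover have "definable (eq_lang L M) (eq_struct L M) (acleq0 L M) m (ht m ` H \<inter> ht m ` N)"
    by (rule definable_Int[OF acleq0_nonempty acleq0_subset_carrier])
      (use assms in \<open>auto simp: acleq0_subgroups_def acleq0_definable_iff\<close>)
  ultimately show ?thesis
    using assms by (auto simp: acleq0_subgroups_def acleq0_definable_iff intro: group.subgroups_Inter_pair[OF group_K])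
qed

text \<open>M^eq has no predicate for its home sort, but an element lies in it exactly if it has a
  product with itself.\<close>

lemma \<H>_carrier: "carrier (group_pow G m) \<in> \<H> m"
proof -
  let ?\<phi> = "\<lambda>i. Exists (Suc i) (Atom (Graph mu) [Var i, Var i, Var (Suc i)]) :: ('f, ('f, 'r) eq_rel) fm"
  have iff: "sat (eq_struct L M) e (?\<phi> i) \<longleftrightarrow> e i \<in> Home ` carrier M" if "e i \<in> carrier (eq_struct L M)" for e i
  proof -
    have "sat (eq_struct L M) e (?\<phi> i) \<longleftrightarrow> (\<exists>u\<in>carrier (eq_struct L M). eq_holds M (Graph mu) [e i, e i, u])"
      by (simp add: eq_struct_def)
    also have "\<dots> \<longleftrightarrow> e i \<in> Home ` carrier M"
    proof
      assume "\<exists>u\<in>carrier (eq_struct L M). eq_holds M (Graph mu) [e i, e i, u]"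
      then show "e i \<in> Home ` carrier M" unfolding graph_mu_iff using that by (auto simp: eq_struct_def)
    next
      assume "e i \<in> Home ` carrier M"
      then obtain a where a: "a \<in> carrier M" "e i = Home a" by auto
      then have "fn M mu [a, a] \<in> carrier M"
        using mu_eq group_G carrier_G by (metis group.is_monoid monoid.m_closed)
      then show "\<exists>u\<in>carrier (eq_struct L M). eq_holds M (Graph mu) [e i, e i, u]"
        unfolding graph_mu_iff using a
        by (intro bexI[of _ "Home (fn M mu [a, a])"] exI[of _ a]) (simp_all add: home_in_carrier)
    qed
    finally show ?thesis .
  qed
  have "expressible (eq_lang L M) (eq_struct L M) (\<lambda>e. sat (eq_struct L M) e (?\<phi> i))" for i
    by (rule expressible_sat) (use mu in \<open>auto simp: eq_lang_def numeral_2_eq_2\<close>)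
  then have "expressible (eq_lang L M) (eq_struct L M) (\<lambda>e. \<forall>i\<in>{..<m}. sat (eq_struct L M) e (?\<phi> i))"
    by (intro expressible_ball) auto
  moreover have "ht m ` tuples (carrier M) m =
      {x \<in> tuples (carrier (eq_struct L M)) m. \<forall>i\<in>{..<m}. sat (eq_struct L M) (tcat m x (\<lambda>_. Home \<one>\<^bsub>G\<^esub>)) (?\<phi> i)}"
    (is "?l = ?r")
  proof (intro equalityI subsetI)
    fix u assume "u \<in> ?l"
    then obtain x where x: "x \<in> tuples (carrier M) m" "u = ht m x" by auto
    have u: "u \<in> tuples (carrier (eq_struct L M)) m" using home_tuple_in[OF x(1)] x(2) by simp
    have "sat (eq_struct L M) (tcat m u (\<lambda>_. Home \<one>\<^bsub>G\<^esub>)) (?\<phi> i)" if "i < m" for i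
      by (subst iff) (use u x that in \<open>auto simp: home_tuple_def PiE_iff\<close>)
    then show "u \<in> ?r" using u by simp
  next
    fix u assume u: "u \<in> ?r"
    have "u i \<in> Home ` carrier M" if "i < m" for i
      using u that iff[of "tcat m u (\<lambda>_. Home \<one>\<^bsub>G\<^esub>)" i] by (auto simp: PiE_iff)
    then have "\<forall>i. \<exists>a. i < m \<longrightarrow> u i = Home a \<and> a \<in> carrier M" by blast
    then obtain x where x: "\<And>i. i < m \<Longrightarrow> u i = Home (x i) \<and> x i \<in> carrier M" by metis
    have "u = ht m (restrict x {..<m})"
      using u x by (auto simp: home_tuple_def fun_eq_iff PiE_iff extensional_def)
    then show "u \<in> ?l" using x by auto
  qed
  ultimately have "definable (eq_lang L M) (eq_struct L M) (acleq0 L M) m (ht m ` tuples (carrier M) m)"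
    unfolding eq_definable_iff using one_acleq0
    by (intro exI[of _ "\<lambda>e. \<forall>i\<in>{..<m}. sat (eq_struct L M) e (?\<phi> i)"] exI[of _ "\<lambda>_. Home \<one>\<^bsub>G\<^esub>"]) auto
  then show ?thesis unfolding acleq0_subgroups_def acleq0_definable_iff carrier_K
    using group.subgroup_self[OF group_K, of m] carrier_K by auto
qed

lemma \<H>_meet_of:
  assumes "finite \<B>" "\<B> \<subseteq> \<H> m"
  shows "meet_of (group_pow G m) \<B> \<in> \<H> m"
  using assms
proof (induction \<B>)
  case empty
  then show ?case using \<H>_carrier by (simp add: meet_of_def)
next
  case (insert B \<B>)
  then show ?case unfolding group.meet_of_insert[OF group_K] by (intro \<H>_Int) auto
qed

text \<open>The section of \<open>H\<close> over the identity of the first \<open>k\<close>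
  coordinates. Nonempty sections of cosets of \<open>H\<close> are cosets of it, see
  \<open>section_lcos\<close>.\<close>

definition fibre :: "nat \<Rightarrow> nat \<Rightarrow> (nat \<Rightarrow> 'a) set \<Rightarrow> (nat \<Rightarrow> 'a) set" where
  "fibre k m H = {y \<in> tuples (carrier M) m. tcat k (\<lambda>i\<in>{..<k}. \<one>\<^bsub>G\<^esub>) y \<in> H}"

lemma tcat_tuples: "\<lbrakk>x \<in> tuples A k; y \<in> tuples A m\<rbrakk> \<Longrightarrow> tcat k x y \<in> tuples A (k + m)"
  by (auto simp: tcat_def PiE_iff extensional_def)

lemma one_in: "\<one>\<^bsub>G\<^esub> \<in> carrier M"
  using group_G carrier_G by (metis group.is_monoid monoid.one_closed)

lemma one_K: "(\<lambda>i\<in>{..<k}. \<one>\<^bsub>G\<^esub>) \<in> tuples (carrier M) k"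
  by (auto simp: one_in)

lemma tcat_mult:
  assumes "x \<in> tuples (carrier M) k" "y \<in> tuples (carrier M) m" "x' \<in> tuples (carrier M) k" "y' \<in> tuples (carrier M) m"
  shows "tcat k x y \<otimes>\<^bsub>group_pow G (k + m)\<^esub> tcat k x' y' =
    tcat k (x \<otimes>\<^bsub>group_pow G k\<^esub> x') (y \<otimes>\<^bsub>group_pow G m\<^esub> y')"
  by (auto simp: tcat_def fun_eq_iff)

lemma tcat_inv:
  assumes "x \<in> tuples (carrier M) k" "y \<in> tuples (carrier M) m"
  shows "inv\<^bsub>group_pow G (k + m)\<^esub> tcat k x y = tcat k (inv\<^bsub>group_pow G k\<^esub> x) (inv\<^bsub>group_pow G m\<^esub> y)"
proof -
  have "inv\<^bsub>group_pow G (k + m)\<^esub> tcat k x y = (\<lambda>i\<in>{..<k + m}. inv\<^bsub>G\<^esub> (tcat k x y i))"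
    using tcat_tuples[OF assms] group_G by (intro inv_product_group) (auto simp: carrier_G)
  moreover have "inv\<^bsub>group_pow G k\<^esub> x = (\<lambda>i\<in>{..<k}. inv\<^bsub>G\<^esub> (x i))"
    using assms group_G by (intro inv_product_group) (auto simp: carrier_G)
  moreover have "inv\<^bsub>group_pow G m\<^esub> y = (\<lambda>i\<in>{..<m}. inv\<^bsub>G\<^esub> (y i))"
    using assms group_G by (intro inv_product_group) (auto simp: carrier_G)
  ultimately show ?thesis by (auto simp: tcat_def fun_eq_iff)
qed

lemma fibre_subgroup:
  assumes H: "subgroup H (group_pow G (k + m))"
  shows "subgroup (fibre k m H) (group_pow G m)"
proof -
  interpret Km: group "group_pow G m" by (rule group_K)
  interpret Kk: group "group_pow G k" by (rule group_K)
  let ?e = "\<lambda>i\<in>{..<k}. \<one>\<^bsub>G\<^esub>"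
  have e: "?e = \<one>\<^bsub>group_pow G k\<^esub>" by simp
  have sub: "fibre k m H \<subseteq> carrier (group_pow G m)" unfolding carrier_K by (auto simp: fibre_def)
  show ?thesis
  proof (rule Km.subgroupI)
    have "tcat k ?e (\<lambda>i\<in>{..<m}. \<one>\<^bsub>G\<^esub>) = \<one>\<^bsub>group_pow G (k + m)\<^esub>" by (auto simp: tcat_def fun_eq_iff)
    then have "(\<lambda>i\<in>{..<m}. \<one>\<^bsub>G\<^esub>) \<in> fibre k m H"
      using subgroup.one_closed[OF H] one_K[of m] by (simp add: fibre_def)
    then show "fibre k m H \<noteq> {}" by auto
  next
    fix a assume a: "a \<in> fibre k m H"
    then have am: "a \<in> tuples (carrier M) m" "tcat k ?e a \<in> H" by (auto simp: fibre_def)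
    have "inv\<^bsub>group_pow G (k + m)\<^esub> tcat k ?e a = tcat k ?e (inv\<^bsub>group_pow G m\<^esub> a)"
      using tcat_inv[OF one_K am(1), of k] unfolding e Kk.inv_one .
    then show "inv\<^bsub>group_pow G m\<^esub> a \<in> fibre k m H"
      using subgroup.m_inv_closed[OF H am(2)] Km.inv_closed[of a] am(1) unfolding fibre_def carrier_K by simp
    fix b assume b: "b \<in> fibre k m H"
    then have bm: "b \<in> tuples (carrier M) m" "tcat k ?e b \<in> H" by (auto simp: fibre_def)
    have "tcat k ?e a \<otimes>\<^bsub>group_pow G (k + m)\<^esub> tcat k ?e b = tcat k ?e (a \<otimes>\<^bsub>group_pow G m\<^esub> b)"
      using tcat_mult[OF one_K am(1) one_K bm(1), of k] unfolding e Kk.l_one[OF Kk.one_closed] .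
    then show "a \<otimes>\<^bsub>group_pow G m\<^esub> b \<in> fibre k m H"
      using subgroup.m_closed[OF H am(2) bm(2)] Km.m_closed[of a b] am(1) bm(1) unfolding fibre_def carrier_K by simp
  qed (rule sub)
qed

text \<open>Substituting the identity keeps the definition over acl^eq(0), to which the identity
  belongs.\<close>

lemma fibre_\<H>:
  assumes H: "H \<in> \<H> (k + m)"
  shows "fibre k m H \<in> \<H> m"
proof -
  have Hs: "subgroup H (group_pow G (k + m))" using H by (rule subgroup_\<H>)
  have "H \<subseteq> tuples (carrier M) (k + m)" using subgroup.subset[OF Hs] carrier_K by simp
  have "definable (eq_lang L M) (eq_struct L M) (acleq0 L M) (k + m) (ht (k + m) ` H)"
    using H by (simp add: acleq0_subgroups_def acleq0_definable_iff)
  then obtain P c where P: "expressible (eq_lang L M) (eq_struct L M) P" "range c \<subseteq> acleq0 L M"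
    "ht (k + m) ` H = {x \<in> tuples (carrier (eq_struct L M)) (k + m). P (tcat (k + m) x c)}"
    unfolding eq_definable_iff by auto
  let ?e = "\<lambda>i\<in>{..<k}. \<one>\<^bsub>G\<^esub>"
  \<comment> \<open>The first \<open>k\<close> variables all read the one new parameter at position
    \<open>m\<close>, the identity; the old parameters move up by one.\<close>
  define \<rho> where "\<rho> j = (if j < k then m else if j < k + m then j - k else m + 1 + (j - (k + m)))" for j
  define c' where "c' i = (if i = 0 then Home \<one>\<^bsub>G\<^esub> else c (i - 1))" for i
  have r: "tcat m u c' \<circ> \<rho> = tcat (k + m) (tcat k (ht k ?e) u) c" for u
    by (auto simp: \<rho>_def c'_def tcat_def fun_eq_iff home_tuple_def)
  have ht: "ht (k + m) (tcat k ?e y) = tcat k (ht k ?e) (ht m y)" for y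
    by (rule ext) (auto simp: tcat_def home_tuple_def)
  have mem: "x \<in> H \<longleftrightarrow> P (tcat (k + m) (ht (k + m) x) c)" if x: "x \<in> tuples (carrier M) (k + m)" for x
  proof -
    have "x \<in> H \<longleftrightarrow> ht (k + m) x \<in> ht (k + m) ` H"
      using inj_on_image_mem_iff[OF home_tuple_inj x \<open>H \<subseteq> tuples (carrier M) (k + m)\<close>] by metis
    then show ?thesis unfolding P(3) using home_tuple_in[OF x, of L] by simp
  qed
  have "ht m ` fibre k m H = ht m ` tuples (carrier M) m \<inter> {u \<in> tuples (carrier (eq_struct L M)) m. P (tcat m u c' \<circ> \<rho>)}"
    (is "?l = ?a \<inter> ?b")
  proof -
    have "y \<in> fibre k m H \<longleftrightarrow> ht m y \<in> ?b" if y: "y \<in> tuples (carrier M) m" for y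
      unfolding r using mem[OF tcat_tuples[OF one_K y, of k]] ht[of y] home_tuple_in[OF y, of L] y by (simp add: fibre_def)
    then show ?thesis by (auto simp: fibre_def)
  qed
  moreover have "definable (eq_lang L M) (eq_struct L M) (acleq0 L M) m ?b"
    unfolding eq_definable_iff using expressible_rename[OF P(1), of \<rho>] P(2) one_acleq0
    by (intro exI[of _ "\<lambda>e. P (e \<circ> \<rho>)"] exI[of _ c']) (auto simp: c'_def)
  moreover have "definable (eq_lang L M) (eq_struct L M) (acleq0 L M) m ?a"
    using \<H>_carrier[of m] unfolding acleq0_subgroups_def acleq0_definable_iff carrier_K by simp
  ultimately have "definable (eq_lang L M) (eq_struct L M) (acleq0 L M) m (ht m ` fibre k m H)"
    using definable_Int[OF acleq0_nonempty acleq0_subset_carrier] by simp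
  then show ?thesis unfolding acleq0_subgroups_def acleq0_definable_iff
    using fibre_subgroup[OF Hs] by (auto simp: fibre_def)
qed

end

section \<open>Breadth\<close>

text \<open>The index counts right cosets of \<open>H \<inter> N\<close> inside \<open>H\<close>,
  whereas \<open>virt_le\<close> uses left cosets of \<open>N\<close> in the whole group; inversion
  exchanges the two sides.\<close>

lemma (in group) finite_index_iff_virt_le:
  assumes H: "subgroup H G" and N: "subgroup N G"
  shows "finite_index G H (H \<inter> N) \<longleftrightarrow> virt_le G H N"
proof -
  let ?P = "H \<inter> N"
  have P: "subgroup ?P G" using H N by (rule subgroups_Inter_pair)
  have Hc: "H \<subseteq> carrier G" using H by (rule subgroup.subset)
  have Nc: "N \<subseteq> carrier G" using N by (rule subgroup.subset)
  have rc: "rcosets\<^bsub>G\<lparr>carrier := H\<rparr>\<^esub> ?P = (\<lambda>a. ?P #> a) ` H"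
    by (auto simp: RCOSETS_def r_coset_def)
  show ?thesis unfolding finite_index_def rc
  proof
    assume "finite ((\<lambda>a. ?P #> a) ` H)"
    then obtain E where E: "E \<subseteq> H" "finite E" "(\<lambda>a. ?P #> a) ` H = (\<lambda>a. ?P #> a) ` E"
      using finite_image_repr by metis
    show "virt_le G H N"
    proof (rule virt_leI[of "(\<lambda>e. inv e) ` E"])
      show "finite ((\<lambda>e. inv e) ` E)" "(\<lambda>e. inv e) ` E \<subseteq> carrier G" using E Hc by auto
      fix x assume x: "x \<in> H"
      then have xi: "inv x \<in> H" using H by (simp add: subgroup.m_inv_closed)
      then obtain e where e: "e \<in> E" "?P #> inv x = ?P #> e" using E(3) by blast
      have "inv x \<in> ?P #> inv x" using rcos_self[OF _ P] xi Hc by auto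
      then obtain p where p: "p \<in> ?P" "inv x = p \<otimes> e" using e(2) unfolding r_coset_def by auto
      have c: "x \<in> carrier G" "e \<in> carrier G" "p \<in> carrier G" using x e E p Hc by auto
      have "x = inv e \<otimes> inv p" using p(2) c by (metis inv_inv inv_mult_group)
      moreover have "inv p \<in> N" using p(1) N by (simp add: subgroup.m_inv_closed)
      ultimately have "x \<in> inv e <# N" unfolding l_coset_def by auto
      then show "\<exists>f\<in>(\<lambda>e. inv e) ` E. x \<in> f <# N" using e by auto
    qed
  next
    assume "virt_le G H N"
    then have "virt_le G H ?P" using virt_le_subset[OF H] N H Hc by (intro virt_le_Int) auto
    then have "finite ((\<lambda>h. h <# ?P) ` H)" using virt_le_iff_finite[OF P Hc] by simp
    then obtain E where E: "E \<subseteq> H" "finite E" "(\<lambda>h. h <# ?P) ` H = (\<lambda>h. h <# ?P) ` E"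
      using finite_image_repr by metis
    have "(\<lambda>a. ?P #> a) ` H \<subseteq> (\<lambda>e. ?P #> inv e) ` E"
    proof
      fix C assume "C \<in> (\<lambda>a. ?P #> a) ` H"
      then obtain a where a: "a \<in> H" "C = ?P #> a" by auto
      then have ai: "inv a \<in> H" using H by (simp add: subgroup.m_inv_closed)
      then obtain e where e: "e \<in> E" "inv a <# ?P = e <# ?P" using E(3) by blast
      have "inv a \<in> inv a <# ?P" using mem_lcos_self[OF P] ai Hc by auto
      then obtain p where p: "p \<in> ?P" "inv a = e \<otimes> p" using e(2) unfolding l_coset_def by auto
      have c: "a \<in> carrier G" "e \<in> carrier G" "p \<in> carrier G" using a e E p Hc by auto
      have "a = inv p \<otimes> inv e" using p(2) c by (metis inv_inv inv_mult_group)
      moreover have "inv p \<in> ?P" using p(1) P by (rule subgroup.m_inv_closed[rotated])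
      ultimately have "a \<in> ?P #> inv e" unfolding r_coset_def by auto
      then have "?P #> inv e = ?P #> a" using repr_independence[OF _ _ P] c by simp
      then show "C \<in> (\<lambda>e. ?P #> inv e) ` E" using e a by auto
    qed
    then show "finite ((\<lambda>a. ?P #> a) ` H)" using E(2) finite_surj by blast
  qed
qed

lemma (in group) commensurable_iff:
  assumes "subgroup H G" "subgroup N G"
  shows "commensurable G H N \<longleftrightarrow> virt_le G H N \<and> virt_le G N H"
  unfolding commensurable_def using finite_index_iff_virt_le assms by (metis Int_commute)

context group_structure
begin

abbreviation "K \<equiv> group_pow G"
abbreviation "R m \<equiv> comm_rel (K m) (\<H> m)"

lemma R_iff: "(H, N) \<in> R m \<longleftrightarrow> H \<in> \<H> m \<and> N \<in> \<H> m \<and> virt_le (K m) H N \<and> virt_le (K m) N H"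
  unfolding comm_rel_def using group.commensurable_iff[OF group_K subgroup_\<H> subgroup_\<H>] by auto

lemma \<H>_subset: "H \<in> \<H> m \<Longrightarrow> H \<subseteq> carrier (K m)"
  using subgroup_\<H> subgroup.subset by metis

lemma equiv_R: "equiv (\<H> m) (R m)"
proof (rule equivI)
  show "R m \<subseteq> \<H> m \<times> \<H> m" by (auto simp: R_iff)
  show "refl_on (\<H> m) (R m)"
    by (auto simp: refl_on_def R_iff intro!: group.virt_le_subset[OF group_K] subgroup_\<H>)
  show "sym (R m)" by (auto simp: sym_def R_iff)
  show "trans (R m)"
  proof (rule transI)
    fix H N P assume "(H, N) \<in> R m" "(N, P) \<in> R m"
    then have a: "H \<in> \<H> m" "P \<in> \<H> m" "virt_le (K m) H N" "virt_le (K m) N H" "virt_le (K m) N P" "virt_le (K m) P N"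
      by (auto simp: R_iff)
    have "virt_le (K m) H P" using a group.virt_le_trans[OF group_K a(3,5) \<H>_subset] by simp
    moreover have "virt_le (K m) P H" using a group.virt_le_trans[OF group_K a(6,4) \<H>_subset] by simp
    ultimately show "(H, P) \<in> R m" using a by (simp add: R_iff)
  qed
qed

lemma R_Int:
  assumes "(H, H') \<in> R m" "(N, N') \<in> R m"
  shows "(H \<inter> N, H' \<inter> N') \<in> R m"
proof -
  have *: "virt_le (K m) (H \<inter> N) (H' \<inter> N')" if "(H, H') \<in> R m" "(N, N') \<in> R m" for H H' N N'
  proof (rule group.virt_le_Int[OF group_K])
    show "virt_le (K m) (H \<inter> N) H'" "virt_le (K m) (H \<inter> N) N'"
      using that group.virt_le_mono[OF group_K] unfolding R_iff by (meson Int_lower1 Int_lower2)+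
    show "subgroup H' (K m)" "subgroup N' (K m)" "H \<inter> N \<subseteq> carrier (K m)"
      using that unfolding R_iff by (auto simp del: carrier_product_group dest: subgroup_\<H> \<H>_subset)
  qed
  have "(H', H) \<in> R m" "(N', N) \<in> R m" using assms by (auto simp: R_iff)
  then show ?thesis using *[OF assms] *[of H' H N' N] assms \<H>_Int by (simp add: R_iff)
qed

text \<open>\<open>class_meet\<close> unites over all pairs of representatives, and by
  \<open>R_Int\<close> all members of that union coincide.\<close>

lemma class_meet_eq:
  assumes "H \<in> \<H> m" "N \<in> \<H> m"
  shows "class_meet (R m) (R m `` {H}) (R m `` {N}) = R m `` {H \<inter> N}"
proof -
  have refl: "(H, H) \<in> R m" if "H \<in> \<H> m" for H using equiv_R that by (meson equivE refl_onD)
  have eq: "R m `` {H' \<inter> N'} = R m `` {H \<inter> N}" if "H' \<in> R m `` {H}" "N' \<in> R m `` {N}" for H' N'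
  proof -
    have "(H \<inter> N, H' \<inter> N') \<in> R m" using that by (intro R_Int) auto
    then show ?thesis using equiv_class_eq[OF equiv_R] by metis
  qed
  have "class_meet (R m) (R m `` {H}) (R m `` {N}) = (\<Union>H'\<in>R m `` {H}. \<Union>N'\<in>R m `` {N}. R m `` {H \<inter> N})"
    unfolding class_meet_def using eq by simp
  also have "\<dots> = R m `` {H \<inter> N}" using refl[OF assms(1)] refl[OF assms(2)] by blast
  finally show ?thesis .
qed

lemma foldr_class_meet:
  assumes "set Hs \<subseteq> \<H> m"
  shows "foldr (class_meet (R m)) (map (\<lambda>H. R m `` {H}) Hs) (R m `` {carrier (K m)}) =
    R m `` {meet_of (K m) (set Hs)}"
  using assms
proof (induction Hs)
  case Nil
  then show ?case by (simp add: meet_of_def)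
next
  case (Cons H Hs)
  have "meet_of (K m) (set Hs) \<in> \<H> m" using Cons.prems by (intro \<H>_meet_of) auto
  then show ?case using Cons group.meet_of_insert[OF group_K] by (simp add: class_meet_eq)
qed

text \<open>The condition on \<open>d\<close> in the definition of breadth, moved from classes to
  subgroups. A single virtual inclusion expresses commensurability here, since the full meet is
  contained in every partial one.\<close>

definition reduces :: "nat \<Rightarrow> nat \<Rightarrow> bool" where
  "reduces m d \<longleftrightarrow> (\<forall>Hs. set Hs \<subseteq> \<H> m \<and> d < length Hs \<longrightarrow>
     (\<exists>I\<subseteq>{..<length Hs}. card I = d \<and> virt_le (K m) (meet_of (K m) ((!) Hs ` I)) (meet_of (K m) (set Hs))))"

lemma comm_breadth_eq: "comm_breadth L M G m = Inf {enat d | d. reduces m d}"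
proof -
  have *: "(foldr (class_meet (R m)) xs (R m `` {carrier (K m)}) = foldr (class_meet (R m)) (nths xs I) (R m `` {carrier (K m)}))
      \<longleftrightarrow> virt_le (K m) (meet_of (K m) ((!) Hs ` I)) (meet_of (K m) (set Hs))"
    if Hs: "set Hs \<subseteq> \<H> m" and xs: "xs = map (\<lambda>H. R m `` {H}) Hs" and I: "I \<subseteq> {..<length Hs}" for xs Hs I
  proof -
    have sn: "set (nths Hs I) = (!) Hs ` I" using I by (auto simp: set_nths)
    have sub: "(!) Hs ` I \<subseteq> set Hs" using I by auto
    have A: "meet_of (K m) (set Hs) \<in> \<H> m" "meet_of (K m) ((!) Hs ` I) \<in> \<H> m"
      using Hs sub finite_subset[OF sub] by (auto intro!: \<H>_meet_of)
    have "foldr (class_meet (R m)) (nths xs I) (R m `` {carrier (K m)}) = R m `` {meet_of (K m) ((!) Hs ` I)}"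
      using foldr_class_meet[of "nths Hs I" m] Hs sub sn unfolding xs nths_map by auto
    moreover have "foldr (class_meet (R m)) xs (R m `` {carrier (K m)}) = R m `` {meet_of (K m) (set Hs)}"
      unfolding xs by (rule foldr_class_meet[OF Hs])
    moreover have "R m `` {meet_of (K m) (set Hs)} = R m `` {meet_of (K m) ((!) Hs ` I)} \<longleftrightarrow>
        (meet_of (K m) (set Hs), meet_of (K m) ((!) Hs ` I)) \<in> R m"
      by (rule eq_equiv_class_iff[OF equiv_R A])
    moreover have "virt_le (K m) (meet_of (K m) (set Hs)) (meet_of (K m) ((!) Hs ` I))"
      using group.virt_le_subset[OF group_K subgroup_\<H>[OF A(2)]] group.meet_of_subset[OF group_K sub] by metis
    ultimately show ?thesis using A by (simp add: R_iff)
  qed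
  have "(\<forall>xs. set xs \<subseteq> \<H> m // R m \<and> d < length xs \<longrightarrow>
       (\<exists>I \<subseteq> {..<length xs}. card I = d \<and> foldr (class_meet (R m)) xs (R m `` {carrier (K m)})
          = foldr (class_meet (R m)) (nths xs I) (R m `` {carrier (K m)}))) \<longleftrightarrow> reduces m d" (is "?l \<longleftrightarrow> ?r") for d
  proof
    assume l: ?l
    show ?r unfolding reduces_def
    proof (intro allI impI)
      fix Hs assume Hs: "set Hs \<subseteq> \<H> m \<and> d < length Hs"
      let ?xs = "map (\<lambda>H. R m `` {H}) Hs"
      have "set ?xs \<subseteq> \<H> m // R m" using Hs by (auto intro: quotientI)
      then obtain I where I: "I \<subseteq> {..<length ?xs}" "card I = d"
        "foldr (class_meet (R m)) ?xs (R m `` {carrier (K m)}) = foldr (class_meet (R m)) (nths ?xs I) (R m `` {carrier (K m)})"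
        using l Hs by (metis length_map)
      then show "\<exists>I\<subseteq>{..<length Hs}. card I = d \<and> virt_le (K m) (meet_of (K m) ((!) Hs ` I)) (meet_of (K m) (set Hs))"
        using *[of Hs ?xs I] Hs by auto
    qed
  next
    assume r: ?r
    show ?l
    proof (intro allI impI)
      fix xs assume xs: "set xs \<subseteq> \<H> m // R m \<and> d < length xs"
      have "\<forall>x\<in>set xs. \<exists>H. H \<in> \<H> m \<and> x = R m `` {H}"
      proof
        fix x assume "x \<in> set xs"
        then have "x \<in> \<H> m // R m" using xs by blast
        then show "\<exists>H. H \<in> \<H> m \<and> x = R m `` {H}" by (rule quotientE) blast
      qed
      then obtain f where f: "\<And>x. x \<in> set xs \<Longrightarrow> f x \<in> \<H> m \<and> x = R m `` {f x}" by metis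
      let ?Hs = "map f xs"
      have xe: "xs = map (\<lambda>H. R m `` {H}) ?Hs"
        unfolding map_map by (rule sym, rule map_idI) (use f in auto)
      have Hs: "set ?Hs \<subseteq> \<H> m" using f by auto
      obtain I where I: "I \<subseteq> {..<length ?Hs}" "card I = d" "virt_le (K m) (meet_of (K m) ((!) ?Hs ` I)) (meet_of (K m) (set ?Hs))"
        using r Hs xs unfolding reduces_def by (metis length_map)
      then show "\<exists>I \<subseteq> {..<length xs}. card I = d \<and> foldr (class_meet (R m)) xs (R m `` {carrier (K m)})
          = foldr (class_meet (R m)) (nths xs I) (R m `` {carrier (K m)})"
        using *[OF Hs xe I(1)] by (intro exI[of _ I]) simp
    qed
  qed
  then show ?thesis unfolding comm_breadth_def breadth_def Let_def by simp
qed

text \<open>Breadth speaks of lists and of exactly \<open>d\<close> positions; counting wants sets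
  and at most \<open>d\<close> members. A set too small for the definition is kept whole.\<close>

lemma comm_breadth_leD:
  assumes "comm_breadth L M G m \<le> enat d" "finite \<B>" "\<B> \<subseteq> \<H> m"
  shows "\<exists>J\<subseteq>\<B>. card J \<le> d \<and> virt_le (K m) (meet_of (K m) J) (meet_of (K m) \<B>)"
proof -
  \<comment> \<open>An infimum below \<open>Suc d\<close> is witnessed by an actual
    \<open>d' \<le> d\<close>.\<close>
  have "comm_breadth L M G m < enat (Suc d)" using assms(1) by (metis enat_ord_simps(2) le_less_trans lessI)
  then obtain d' where d': "reduces m d'" "d' \<le> d" unfolding comm_breadth_eq Inf_less_iff by auto
  obtain Hs where Hs: "set Hs = \<B>" "distinct Hs" using finite_distinct_list[OF assms(2)] by auto
  show ?thesis
  proof (cases "d' < length Hs")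
    case True
    then obtain I where I: "I \<subseteq> {..<length Hs}" "card I = d'" "virt_le (K m) (meet_of (K m) ((!) Hs ` I)) (meet_of (K m) (set Hs))"
      using d'(1) Hs(1) assms(3) unfolding reduces_def by blast
    have "card ((!) Hs ` I) \<le> d" using I(1,2) d'(2) card_image_le[of I "(!) Hs"] finite_subset[OF I(1)] by auto
    moreover have "(!) Hs ` I \<subseteq> \<B>" using I(1) Hs(1) by auto
    ultimately show ?thesis using I(3) Hs(1) by auto
  next
    case False
    then have "card \<B> \<le> d" using Hs d'(2) distinct_card[OF Hs(2)] by simp
    moreover have "virt_le (K m) (meet_of (K m) \<B>) (meet_of (K m) \<B>)"
      using \<H>_meet_of[OF assms(2,3)] by (intro group.virt_le_subset[OF group_K]) (auto intro: subgroup_\<H>)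
    ultimately show ?thesis by blast
  qed
qed

definition irredundant :: "nat \<Rightarrow> nat \<Rightarrow> (nat \<Rightarrow> (nat \<Rightarrow> 'a) set) \<Rightarrow> bool" where
  "irredundant m d H \<longleftrightarrow> (\<forall>i<d. H i \<in> \<H> m \<and> \<not> virt_le (K m) (meet_of (K m) (H ` ({..<d} - {i}))) (H i))"

text \<open>A list on which \<open>d - 1\<close> fails is thinned out to a set \<open>J\<close> of
  positions, of least size, whose meet is still virtually contained in the full one. Minimality
  makes \<open>J\<close> irredundant, the failure of \<open>d - 1\<close> gives it at least
  \<open>d\<close> positions, and irredundance passes to any \<open>d\<close> of them.\<close>

lemma comm_breadth_geD:
  assumes "enat d \<le> comm_breadth L M G m"
  shows "\<exists>H. irredundant m d H"
proof (cases d)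
  case 0
  then show ?thesis by (simp add: irredundant_def)
next
  case (Suc d')
  have "\<not> reduces m d'"
  proof
    assume "reduces m d'"
    then have "comm_breadth L M G m \<le> enat d'" unfolding comm_breadth_eq by (intro Inf_lower) auto
    then have "enat d \<le> enat d'" using assms by (rule order_trans[rotated])
    then show False using Suc by simp
  qed
  then obtain Hs where Hs: "set Hs \<subseteq> \<H> m" "d' < length Hs"
    "\<And>I. I \<subseteq> {..<length Hs} \<Longrightarrow> card I = d' \<Longrightarrow> \<not> virt_le (K m) (meet_of (K m) ((!) Hs ` I)) (meet_of (K m) (set Hs))"
    unfolding reduces_def by blast
  have nthH: "Hs ! j \<in> \<H> m" if "j < length Hs" for j using Hs(1) nth_mem[OF that] by auto
  define mt where "mt I = meet_of (K m) ((!) Hs ` I)" for I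
  have full: "mt {..<length Hs} = meet_of (K m) (set Hs)"
    unfolding mt_def by (rule arg_cong[of _ _ "meet_of (K m)"]) (auto simp: set_conv_nth)
  have mtH: "mt I \<in> \<H> m" if "I \<subseteq> {..<length Hs}" for I
  proof -
    have "(!) Hs ` I \<subseteq> set Hs" using that by auto
    then show ?thesis unfolding mt_def using Hs(1) finite_subset[OF that] by (intro \<H>_meet_of) auto
  qed
  have mono: "mt I \<subseteq> mt J" if "J \<subseteq> I" for I J
    unfolding mt_def using that by (intro group.meet_of_subset[OF group_K]) auto
  define good where "good J \<longleftrightarrow> J \<subseteq> {..<length Hs} \<and> virt_le (K m) (mt J) (meet_of (K m) (set Hs))" for J
  have "good {..<length Hs}"
    unfolding good_def full[symmetric]
    using group.virt_le_subset[OF group_K subgroup_\<H>[OF mtH[OF subset_refl]] subset_refl] by simp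
  then obtain J where J: "good J" "\<And>J'. good J' \<Longrightarrow> card J \<le> card J'"
    using ex_has_least_nat[of good "{..<length Hs}" card] by blast
  have Jl: "J \<subseteq> {..<length Hs}" using J(1) by (simp add: good_def)
  have Jf: "finite J" using Jl finite_subset by blast
  have "d \<le> card J"
  proof (rule ccontr)
    assume "\<not> d \<le> card J"
    then have "card J \<le> d'" using Suc by simp
    \<comment> \<open>The failure concerns sets of exactly \<open>d'\<close> positions, so a smaller
      \<open>J\<close> is first enlarged; this only shrinks the meet.\<close>
    then obtain I where I: "J \<subseteq> I" "I \<subseteq> {..<length Hs}" "card I = d'"
      using exists_subset_between[of J d' "{..<length Hs}"] Jl Hs(2) by auto
    have "virt_le (K m) (mt I) (meet_of (K m) (set Hs))"
      using group.virt_le_mono[OF group_K _ mono[OF I(1)]] J(1) by (simp add: good_def)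
    then show False using Hs(3)[OF I(2,3)] by (simp add: mt_def)
  qed
  have irr: "\<not> virt_le (K m) (mt (J - {j})) (Hs ! j)" if j: "j \<in> J" for j
  proof
    assume v: "virt_le (K m) (mt (J - {j})) (Hs ! j)"
    have Jj: "J - {j} \<subseteq> {..<length Hs}" using Jl by auto
    have Hj: "Hs ! j \<in> \<H> m" using nthH j Jl by auto
    have "(!) Hs ` J = insert (Hs ! j) ((!) Hs ` (J - {j}))" using j by auto
    then have e: "mt J = Hs ! j \<inter> mt (J - {j})" unfolding mt_def by (simp only: group.meet_of_insert[OF group_K])
    have s: "subgroup (mt (J - {j})) (K m)" using mtH[OF Jj] by (rule subgroup_\<H>)
    have "virt_le (K m) (mt (J - {j})) (mt J)" unfolding e
      by (rule group.virt_le_Int[OF group_K v group.virt_le_subset[OF group_K s subset_refl] subgroup_\<H>[OF Hj] s subgroup.subset[OF s]])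
    moreover have "virt_le (K m) (mt J) (meet_of (K m) (set Hs))" using J(1) by (simp add: good_def)
    moreover have "meet_of (K m) (set Hs) \<subseteq> carrier (K m)" by (auto simp: meet_of_def)
    ultimately have "virt_le (K m) (mt (J - {j})) (meet_of (K m) (set Hs))" by (rule group.virt_le_trans[OF group_K])
    then have "good (J - {j})" using Jj by (simp add: good_def)
    then have "card J \<le> card (J - {j})" by (rule J(2))
    moreover have "card (J - {j}) < card J" using j Jf by (intro card_Diff1_less) auto
    ultimately show False by simp
  qed
  obtain J' where J': "J' \<subseteq> J" "card J' = d" "finite J'" using obtain_subset_with_card_n[OF \<open>d \<le> card J\<close>] by auto
  obtain h where h: "bij_betw h {..<d} J'" using ex_bij_betw_nat_finite[OF J'(3)] J'(2) by (auto simp: atLeast0LessThan)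
  have "irredundant m d (\<lambda>i. Hs ! h i)" unfolding irredundant_def
  proof (intro allI impI conjI)
    fix i assume i: "i < d"
    then have hi: "h i \<in> J'" using h by (auto simp: bij_betw_def)
    show "Hs ! h i \<in> \<H> m" using nthH hi J'(1) Jl by auto
    have "h ` ({..<d} - {i}) \<subseteq> J - {h i}" using h i J'(1) unfolding bij_betw_def inj_on_def by auto
    then have "mt (J - {h i}) \<subseteq> mt (h ` ({..<d} - {i}))" by (rule mono)
    moreover have "mt (h ` ({..<d} - {i})) = meet_of (K m) ((\<lambda>i. Hs ! h i) ` ({..<d} - {i}))"
      unfolding mt_def image_image ..
    ultimately show "\<not> virt_le (K m) (meet_of (K m) ((\<lambda>i. Hs ! h i) ` ({..<d} - {i}))) (Hs ! h i)"
      using irr[of "h i"] hi J'(1) group.virt_le_mono[OF group_K] by blast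
  qed
  then show ?thesis by blast
qed

end

section \<open>Upper bounds\<close>

text \<open>This is the form in which Boolean combinations enter the counting: finitely many members
  of the family decide membership.\<close>

lemma bool_combs_invariant:
  assumes "S \<in> bool_combs X \<S>"
  obtains F where "F \<subseteq> \<S>" "finite F"
    "\<And>x y. \<lbrakk>x \<in> X; y \<in> X; \<forall>C\<in>F. x \<in> C \<longleftrightarrow> y \<in> C\<rbrakk> \<Longrightarrow> x \<in> S \<longleftrightarrow> y \<in> S"
proof -
  define resp where "resp F S \<longleftrightarrow> (\<forall>x\<in>X. \<forall>y\<in>X. (\<forall>C\<in>F. x \<in> C \<longleftrightarrow> y \<in> C) \<longrightarrow> (x \<in> S \<longleftrightarrow> y \<in> S))" for F S
  have "\<exists>F\<subseteq>\<S>. finite F \<and> resp F S"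
    using assms
  proof (induction S)
    case (base S)
    then show ?case by (intro exI[of _ "{S}"]) (simp add: resp_def)
  next
    case empty
    then show ?case by (intro exI[of _ "{}"]) (simp add: resp_def)
  next
    case (compl S)
    then obtain F where F: "F \<subseteq> \<S>" "finite F" "resp F S" by blast
    have "resp F (X - S)" unfolding resp_def
    proof (intro ballI impI)
      fix x y assume a: "x \<in> X" "y \<in> X" "\<forall>C\<in>F. x \<in> C \<longleftrightarrow> y \<in> C"
      then have "x \<in> S \<longleftrightarrow> y \<in> S" using F(3) unfolding resp_def by blast
      then show "x \<in> X - S \<longleftrightarrow> y \<in> X - S" using a(1,2) by simp
    qed
    then show ?case using F(1,2) by (intro exI[of _ F]) simp
  next
    case (union S S')
    obtain F where F: "F \<subseteq> \<S>" "finite F" "resp F S" using union.IH(1) by blast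
    obtain F' where F': "F' \<subseteq> \<S>" "finite F'" "resp F' S'" using union.IH(2) by blast
    have "resp (F \<union> F') (S \<union> S')" unfolding resp_def
    proof (intro ballI impI)
      fix x y assume a: "x \<in> X" "y \<in> X" "\<forall>C\<in>F \<union> F'. x \<in> C \<longleftrightarrow> y \<in> C"
      then have "x \<in> S \<longleftrightarrow> y \<in> S" using F(3) unfolding resp_def by (meson UnI1)
      moreover have "x \<in> S' \<longleftrightarrow> y \<in> S'" using F'(3) a unfolding resp_def by (meson UnI2)
      ultimately show "x \<in> S \<union> S' \<longleftrightarrow> y \<in> S \<union> S'" by simp
    qed
    then show ?case using F F' by (intro exI[of _ "F \<union> F'"]) simp
  qed
  then show ?thesis using that unfolding resp_def by blast
qed

lemma card_image_factor:
  assumes "finite (T ` Y)" "\<And>y y'. \<lbrakk>y \<in> Y; y' \<in> Y; T y = T y'\<rbrakk> \<Longrightarrow> f y = f y'"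
  shows "finite (f ` Y)" "card (f ` Y) \<le> card (T ` Y)"
proof -
  define g where "g t = f (SOME y. y \<in> Y \<and> T y = t)" for t
  have "f y = g (T y)" if "y \<in> Y" for y
  proof -
    have "(SOME y'. y' \<in> Y \<and> T y' = T y) \<in> Y \<and> T (SOME y'. y' \<in> Y \<and> T y' = T y) = T y"
      by (rule someI[of _ y]) (use that in auto)
    then show ?thesis unfolding g_def using assms(2)[OF that] by metis
  qed
  then have "f ` Y = g ` T ` Y" by (auto simp: image_iff)
  then show "finite (f ` Y)" "card (f ` Y) \<le> card (T ` Y)" using assms(1) card_image_le by auto
qed

lemma card_le_fibres:
  assumes "finite S" "\<And>t. t \<in> f ` S \<Longrightarrow> card {x \<in> S. f x = t} \<le> q"
  shows "card S \<le> q * card (f ` S)"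
proof -
  have "card S = (\<Sum>x\<in>S. 1)" by simp
  also have "\<dots> = (\<Sum>t\<in>f ` S. \<Sum>x\<in>{x \<in> S. f x = t}. 1)" by (rule sum.image_gen[OF assms(1)])
  also have "\<dots> \<le> (\<Sum>t\<in>f ` S. q)" by (rule sum_mono) (use assms(2) in simp)
  finally show ?thesis by (simp add: mult.commute)
qed

locale one_based_structure = group_structure L M G mu
  for L :: "('f, 'r) lang" and M :: "('a, 'f, 'r) fo_struct" and G :: "'a monoid" and mu :: 'f +
  assumes infinite_M: "infinite (carrier M)" and one_based: "one_based L M G"
begin

lemma carrier_nonempty: "carrier M \<noteq> {}" using infinite_M by auto

lemmas M_definable_iff = definable_iff[OF carrier_nonempty subset_refl]

lemma definable_sat:
  assumes "\<phi> \<in> formulas L k m"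
  shows "definable L M (carrier M) (k + m) {z \<in> tuples (carrier M) (k + m). sat M z \<phi>}"
proof -
  have "sat M (tcat (k + m) z (\<lambda>_. undefined)) \<phi> \<longleftrightarrow> sat M z \<phi>" for z
    by (rule sat_cong) (use assms in \<open>auto simp: formulas_def\<close>)
  then have "{z \<in> tuples (carrier M) (k + m). sat M z \<phi>} = solset M (k + m) \<phi> (\<lambda>_. undefined)"
    by (simp add: solset_def)
  moreover have "\<phi> \<in> formulas L (k + m) 0" using assms by (simp add: formulas_def)
  ultimately show ?thesis unfolding definable_def by (intro exI[of _ 0] bexI[of _ \<phi>] bexI[of _ "\<lambda>_. undefined"]) auto
qed

text \<open>The point \<open>(x, y0)\<close> may replace \<open>a\<close> as representative, and
  \<open>(x, y0)^-1 (x, y) = (1, y0^-1 y)\<close>.\<close>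

lemma section_lcos:
  assumes H: "subgroup H (K (k + m))" and a: "a \<in> carrier (K (k + m))"
    and x: "x \<in> tuples (carrier M) k" and y0: "y0 \<in> tuples (carrier M) m"
    and mem: "tcat k x y0 \<in> a <#\<^bsub>K (k + m)\<^esub> H"
  shows "{y \<in> tuples (carrier M) m. tcat k x y \<in> a <#\<^bsub>K (k + m)\<^esub> H} = y0 <#\<^bsub>K m\<^esub> fibre k m H"
proof -
  interpret Kkm: group "K (k + m)" by (rule group_K)
  interpret Km: group "K m" by (rule group_K)
  interpret Kk: group "K k" by (rule group_K)
  have F: "subgroup (fibre k m H) (K m)" using H by (rule fibre_subgroup)
  have "tcat k x y \<in> a <#\<^bsub>K (k + m)\<^esub> H \<longleftrightarrow> y \<in> y0 <#\<^bsub>K m\<^esub> fibre k m H" if y: "y \<in> tuples (carrier M) m" for y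
  proof -
    have c: "tcat k x y \<in> carrier (K (k + m))" "tcat k x y0 \<in> carrier (K (k + m))"
      unfolding carrier_K by (rule tcat_tuples[OF x y], rule tcat_tuples[OF x y0])
    have yc: "y \<in> carrier (K m)" "y0 \<in> carrier (K m)" "x \<in> carrier (K k)" unfolding carrier_K using y y0 x by auto
    have "tcat k x y \<in> a <#\<^bsub>K (k + m)\<^esub> H \<longleftrightarrow> tcat k x y \<in> tcat k x y0 <#\<^bsub>K (k + m)\<^esub> H"
      using Kkm.lcos_eqI[OF H a mem] by simp
    also have "\<dots> \<longleftrightarrow> inv\<^bsub>K (k + m)\<^esub> tcat k x y0 \<otimes>\<^bsub>K (k + m)\<^esub> tcat k x y \<in> H"
      by (rule Kkm.mem_lcos_iff[OF subgroup.subset[OF H] c(2,1)])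
    also have "inv\<^bsub>K (k + m)\<^esub> tcat k x y0 \<otimes>\<^bsub>K (k + m)\<^esub> tcat k x y =
        tcat k (inv\<^bsub>K k\<^esub> x \<otimes>\<^bsub>K k\<^esub> x) (inv\<^bsub>K m\<^esub> y0 \<otimes>\<^bsub>K m\<^esub> y)"
      unfolding tcat_inv[OF x y0]
      by (rule tcat_mult) (use x y Kk.inv_closed[OF yc(3)] Km.inv_closed[OF yc(2)] in \<open>simp_all only: carrier_K\<close>)
    also have "inv\<^bsub>K k\<^esub> x \<otimes>\<^bsub>K k\<^esub> x = (\<lambda>i\<in>{..<k}. \<one>\<^bsub>G\<^esub>)"
      using Kk.l_inv[OF yc(3)] by (simp only: one_product_group)
    also have "tcat k (\<lambda>i\<in>{..<k}. \<one>\<^bsub>G\<^esub>) (inv\<^bsub>K m\<^esub> y0 \<otimes>\<^bsub>K m\<^esub> y) \<in> H \<longleftrightarrow>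
        inv\<^bsub>K m\<^esub> y0 \<otimes>\<^bsub>K m\<^esub> y \<in> fibre k m H"
      using Km.m_closed[OF Km.inv_closed[OF yc(2)] yc(1)] unfolding fibre_def carrier_K by simp
    also have "\<dots> \<longleftrightarrow> y \<in> y0 <#\<^bsub>K m\<^esub> fibre k m H"
      by (rule Km.mem_lcos_iff[OF subgroup.subset[OF F] yc(2,1), symmetric])
    finally show ?thesis .
  qed
  moreover have "y0 <#\<^bsub>K m\<^esub> fibre k m H \<subseteq> tuples (carrier M) m"
    using Km.lcos_subset_carrier[OF subgroup.subset[OF F], of y0] y0 unfolding carrier_K by simp
  ultimately show ?thesis by auto
qed

text \<open>One-basedness for the power \<open>k + m\<close> decides \<open>D\<close> by finitely
  many cosets, and their sections at \<open>x\<close> are cosets of the fibres of the same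
  subgroups. So neither \<open>\<B>\<close> nor \<open>N\<close> depends on
  \<open>x\<close>.\<close>

lemma definable_fibres:
  assumes D: "definable L M (carrier M) (k + m) D"
  shows "\<exists>\<B> N. finite \<B> \<and> \<B> \<subseteq> \<H> m \<and> (\<forall>x\<in>tuples (carrier M) k. \<exists>\<C>. finite \<C> \<and> card \<C> \<le> N \<and>
    (\<forall>C\<in>\<C>. \<exists>a\<in>carrier (K m). \<exists>B\<in>\<B>. C = a <#\<^bsub>K m\<^esub> B) \<and>
    (\<forall>y\<in>tuples (carrier M) m. \<forall>y'\<in>tuples (carrier M) m.
       (\<forall>C\<in>\<C>. y \<in> C \<longleftrightarrow> y' \<in> C) \<longrightarrow> (tcat k x y \<in> D \<longleftrightarrow> tcat k x y' \<in> D)))"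
proof -
  let ?\<S> = "{a <#\<^bsub>K (k + m)\<^esub> H | a H. a \<in> carrier (K (k + m)) \<and> H \<in> \<H> (k + m)}"
  have Db: "D \<in> bool_combs (carrier (K (k + m))) ?\<S>" using one_based D unfolding one_based_def by blast
  obtain F where F: "F \<subseteq> ?\<S>" "finite F"
    "\<And>z z'. \<lbrakk>z \<in> carrier (K (k + m)); z' \<in> carrier (K (k + m)); \<forall>C\<in>F. z \<in> C \<longleftrightarrow> z' \<in> C\<rbrakk> \<Longrightarrow> z \<in> D \<longleftrightarrow> z' \<in> D"
    by (rule bool_combs_invariant[OF Db], rule that)
  have "\<forall>C\<in>F. \<exists>a H. C = a <#\<^bsub>K (k + m)\<^esub> H \<and> a \<in> carrier (K (k + m)) \<and> H \<in> \<H> (k + m)" using F(1) by blast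
  then obtain a H where aH: "\<And>C. C \<in> F \<Longrightarrow> C = a C <#\<^bsub>K (k + m)\<^esub> H C \<and> a C \<in> carrier (K (k + m)) \<and> H C \<in> \<H> (k + m)"
    by metis
  define \<B> where "\<B> = (\<lambda>C. fibre k m (H C)) ` F"
  have "\<exists>\<C>. finite \<C> \<and> card \<C> \<le> card F \<and>
    (\<forall>C\<in>\<C>. \<exists>a\<in>carrier (K m). \<exists>B\<in>\<B>. C = a <#\<^bsub>K m\<^esub> B) \<and>
    (\<forall>y\<in>tuples (carrier M) m. \<forall>y'\<in>tuples (carrier M) m.
       (\<forall>C\<in>\<C>. y \<in> C \<longleftrightarrow> y' \<in> C) \<longrightarrow> (tcat k x y \<in> D \<longleftrightarrow> tcat k x y' \<in> D))"
    if x: "x \<in> tuples (carrier M) k" for x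
  proof -
    define s where "s C = {y \<in> tuples (carrier M) m. tcat k x y \<in> C}" for C
    \<comment> \<open>An empty section is not a coset; dropping it loses nothing, as it contains
      neither \<open>y\<close> nor \<open>y'\<close>.\<close>
    define \<C> where "\<C> = s ` F - {{}}"
    have 1: "finite \<C>" unfolding \<C>_def using F(2) by simp
    have "card \<C> \<le> card (s ` F)" unfolding \<C>_def using F(2) by (intro card_mono) auto
    then have 2: "card \<C> \<le> card F" using card_image_le[OF F(2), of s] by linarith
    have 3: "\<exists>a\<in>carrier (K m). \<exists>B\<in>\<B>. E = a <#\<^bsub>K m\<^esub> B" if E: "E \<in> \<C>" for E
    proof -
      obtain C where C: "C \<in> F" "E = s C" "E \<noteq> {}" using E unfolding \<C>_def by auto
      then obtain y0 where y0: "y0 \<in> tuples (carrier M) m" "tcat k x y0 \<in> C" unfolding s_def by auto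
      have aC: "C = a C <#\<^bsub>K (k + m)\<^esub> H C" "a C \<in> carrier (K (k + m))" "H C \<in> \<H> (k + m)" using aH[OF C(1)] by auto
      have "E = y0 <#\<^bsub>K m\<^esub> fibre k m (H C)"
        using section_lcos[OF subgroup_\<H>[OF aC(3)] aC(2) x y0(1)] y0(2) C(2) aC(1) unfolding s_def by metis
      moreover have "fibre k m (H C) \<in> \<B>" unfolding \<B>_def using C(1) by (rule imageI)
      moreover have "y0 \<in> carrier (K m)" using y0(1) carrier_K by simp
      ultimately show ?thesis by blast
    qed
    have 4: "tcat k x y \<in> D \<longleftrightarrow> tcat k x y' \<in> D"
      if y: "y \<in> tuples (carrier M) m" "y' \<in> tuples (carrier M) m" and e: "\<forall>C\<in>\<C>. y \<in> C \<longleftrightarrow> y' \<in> C" for y y'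
    proof (rule F(3))
      show "tcat k x y \<in> carrier (K (k + m))" "tcat k x y' \<in> carrier (K (k + m))"
        unfolding carrier_K by (rule tcat_tuples[OF x y(1)], rule tcat_tuples[OF x y(2)])
      show "\<forall>C\<in>F. tcat k x y \<in> C \<longleftrightarrow> tcat k x y' \<in> C"
      proof
        fix C assume C: "C \<in> F"
        have "y \<in> s C \<longleftrightarrow> y' \<in> s C"
        proof (cases "s C = {}")
          case False
          then have "s C \<in> \<C>" unfolding \<C>_def using C by auto
          then show ?thesis using e by blast
        qed simp
        then show "tcat k x y \<in> C \<longleftrightarrow> tcat k x y' \<in> C" unfolding s_def using y by simp
      qed
    qed
    show ?thesis
      by (intro exI[of _ \<C>] conjI ballI impI) (rule 1, rule 2, erule 3, rule 4)
  qed
  note sections = this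
  have "finite \<B>" "\<B> \<subseteq> \<H> m"
    unfolding \<B>_def using F(2) aH fibre_\<H> by auto
  then show ?thesis
    by (rule_tac x = \<B> in exI, rule_tac x = "card F" in exI, intro conjI ballI) (assumption, assumption, rule sections)
qed

text \<open>\<open>T\<close> labels the pieces of a partition of \<open>G^m\<close> that decides all
  fibres over the sets \<open>A \<alpha>\<close>. The index set \<open>J\<close> is there because
  the rows of an inp-pattern may have different formulas and parameter lengths.\<close>

definition traces_le :: "nat \<Rightarrow> 'i set \<Rightarrow> ('i \<Rightarrow> nat) \<Rightarrow> ('i \<Rightarrow> (nat \<Rightarrow> 'a) set) \<Rightarrow> ('i \<Rightarrow> (nat \<Rightarrow> 'a) set) \<Rightarrow> nat \<Rightarrow> bool" where
  "traces_le m J k D A n \<longleftrightarrow> (\<exists>T :: (nat \<Rightarrow> 'a) \<Rightarrow> (nat \<Rightarrow> 'a) set set. finite (T ` tuples (carrier M) m) \<and>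
      card (T ` tuples (carrier M) m) \<le> n \<and>
      (\<forall>\<alpha>\<in>J. \<forall>x\<in>A \<alpha>. \<forall>y\<in>tuples (carrier M) m. \<forall>y'\<in>tuples (carrier M) m. T y = T y' \<longrightarrow>
         (tcat (k \<alpha>) x y \<in> D \<alpha> \<longleftrightarrow> tcat (k \<alpha>) x y' \<in> D \<alpha>)))"

text \<open>Each fibre costs at most \<open>N \<alpha>\<close> cosets, so their number is linear in
  the number of parameters, and \<open>count_coset_traces\<close> turns this into degree
  \<open>d\<close>. The constant is chosen before \<open>A\<close>.\<close>

lemma count_traces:
  fixes D :: "'i \<Rightarrow> (nat \<Rightarrow> 'a) set"
  assumes b: "comm_breadth L M G m \<le> enat d" and J: "finite J"
    and D: "\<And>\<alpha>. \<alpha> \<in> J \<Longrightarrow> definable L M (carrier M) (k \<alpha> + m) (D \<alpha>)"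
  shows "\<exists>c. \<forall>A. (\<forall>\<alpha>\<in>J. finite (A \<alpha>) \<and> A \<alpha> \<subseteq> tuples (carrier M) (k \<alpha>)) \<longrightarrow>
    traces_le m J k D A (c * (1 + (\<Sum>\<alpha>\<in>J. card (A \<alpha>))) ^ d)"
proof -
  define Q where "Q \<alpha> \<B> N x \<C> \<longleftrightarrow> finite \<C> \<and> card \<C> \<le> N \<and>
      (\<forall>C\<in>\<C>. \<exists>a\<in>carrier (K m). \<exists>B\<in>\<B>. C = a <#\<^bsub>K m\<^esub> B) \<and>
      (\<forall>y\<in>tuples (carrier M) m. \<forall>y'\<in>tuples (carrier M) m.
         (\<forall>C\<in>\<C>. y \<in> C \<longleftrightarrow> y' \<in> C) \<longrightarrow> (tcat (k \<alpha>) x y \<in> D \<alpha> \<longleftrightarrow> tcat (k \<alpha>) x y' \<in> D \<alpha>))" for \<alpha> \<B> N x \<C>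
  have "\<exists>\<B> N. finite \<B> \<and> \<B> \<subseteq> \<H> m \<and> (\<forall>x\<in>tuples (carrier M) (k \<alpha>). \<exists>\<C>. Q \<alpha> \<B> N x \<C>)" if "\<alpha> \<in> J" for \<alpha>
    unfolding Q_def by (rule definable_fibres[OF D[OF that]])
  then obtain \<B> N where \<B>N: "\<And>\<alpha>. \<alpha> \<in> J \<Longrightarrow> finite (\<B> \<alpha>) \<and> \<B> \<alpha> \<subseteq> \<H> m \<and>
      (\<forall>x\<in>tuples (carrier M) (k \<alpha>). \<exists>\<C>. Q \<alpha> (\<B> \<alpha>) (N \<alpha>) x \<C>)"
    by metis
  then obtain \<C> where \<C>: "\<And>\<alpha> x. \<lbrakk>\<alpha> \<in> J; x \<in> tuples (carrier M) (k \<alpha>)\<rbrakk> \<Longrightarrow> Q \<alpha> (\<B> \<alpha>) (N \<alpha>) x (\<C> \<alpha> x)"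
    by metis
  define BB where "BB = (\<Union>\<alpha>\<in>J. \<B> \<alpha>)"
  have BB: "finite BB" "BB \<subseteq> \<H> m" unfolding BB_def using J \<B>N by auto
  have "\<exists>c. \<forall>\<C>. finite \<C> \<and> (\<forall>C\<in>\<C>. \<exists>a\<in>carrier (K m). \<exists>B\<in>BB. C = a <#\<^bsub>K m\<^esub> B) \<longrightarrow>
           finite ((\<lambda>y. {C \<in> \<C>. y \<in> C}) ` carrier (K m)) \<and>
           card ((\<lambda>y. {C \<in> \<C>. y \<in> C}) ` carrier (K m)) \<le> c * (card \<C> + 1) ^ d"
  proof (rule group.count_coset_traces[OF group_K BB(1)])
    show "subgroup B (K m)" if "B \<in> BB" for B using that BB(2) subgroup_\<H> by auto
    fix I assume I: "I \<subseteq> BB"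
    show "\<exists>J\<subseteq>I. card J \<le> d \<and> virt_le (K m) (meet_of (K m) J) (meet_of (K m) I)"
      by (rule comm_breadth_leD[OF b finite_subset[OF I BB(1)] subset_trans[OF I BB(2)]])
  qed
  then obtain c where c: "\<And>\<C>. finite \<C> \<Longrightarrow> (\<forall>C\<in>\<C>. \<exists>a\<in>carrier (K m). \<exists>B\<in>BB. C = a <#\<^bsub>K m\<^esub> B) \<Longrightarrow>
      finite ((\<lambda>y. {C \<in> \<C>. y \<in> C}) ` carrier (K m)) \<and>
      card ((\<lambda>y. {C \<in> \<C>. y \<in> C}) ` carrier (K m)) \<le> c * (card \<C> + 1) ^ d"
    by blast
  define n where "n = (\<Sum>\<alpha>\<in>J. N \<alpha>)"
  show ?thesis
  proof (intro exI[of _ "c * (n + 1) ^ d"] allI impI)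
    fix A assume A: "\<forall>\<alpha>\<in>J. finite (A \<alpha>) \<and> A \<alpha> \<subseteq> tuples (carrier M) (k \<alpha>)"
    define CC where "CC = (\<Union>\<alpha>\<in>J. \<Union>x\<in>A \<alpha>. \<C> \<alpha> x)"
    have Qx: "Q \<alpha> (\<B> \<alpha>) (N \<alpha>) x (\<C> \<alpha> x)" if "\<alpha> \<in> J" "x \<in> A \<alpha>" for \<alpha> x
      using \<C> A that by blast
    have CCf: "finite CC" unfolding CC_def using J A Qx unfolding Q_def by auto
    have CCc: "\<forall>C\<in>CC. \<exists>a\<in>carrier (K m). \<exists>B\<in>BB. C = a <#\<^bsub>K m\<^esub> B"
    proof
      fix C assume "C \<in> CC"
      then obtain \<alpha> x where ax: "\<alpha> \<in> J" "x \<in> A \<alpha>" "C \<in> \<C> \<alpha> x" unfolding CC_def by auto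
      then have "\<exists>a\<in>carrier (K m). \<exists>B\<in>\<B> \<alpha>. C = a <#\<^bsub>K m\<^esub> B" using Qx[OF ax(1,2)] unfolding Q_def by blast
      then show "\<exists>a\<in>carrier (K m). \<exists>B\<in>BB. C = a <#\<^bsub>K m\<^esub> B" using ax(1) unfolding BB_def by blast
    qed
    have "card CC \<le> (\<Sum>\<alpha>\<in>J. card (\<Union>x\<in>A \<alpha>. \<C> \<alpha> x))" unfolding CC_def by (rule card_UN_le[OF J])
    also have "\<dots> \<le> (\<Sum>\<alpha>\<in>J. n * card (A \<alpha>))"
    proof (rule sum_mono)
      fix \<alpha> assume \<alpha>: "\<alpha> \<in> J"
      have "card (\<Union>x\<in>A \<alpha>. \<C> \<alpha> x) \<le> (\<Sum>x\<in>A \<alpha>. card (\<C> \<alpha> x))" by (rule card_UN_le) (use A \<alpha> in auto)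
      also have "\<dots> \<le> (\<Sum>x\<in>A \<alpha>. N \<alpha>)" by (rule sum_mono) (use Qx[OF \<alpha>] in \<open>auto simp: Q_def\<close>)
      also have "\<dots> = N \<alpha> * card (A \<alpha>)" by simp
      also have "\<dots> \<le> n * card (A \<alpha>)" unfolding n_def using member_le_sum[OF \<alpha>, of N] J by (intro mult_right_mono) auto
      finally show "card (\<Union>x\<in>A \<alpha>. \<C> \<alpha> x) \<le> n * card (A \<alpha>)" .
    qed
    also have "\<dots> = n * (\<Sum>\<alpha>\<in>J. card (A \<alpha>))" by (simp add: sum_distrib_left)
    finally have "card CC + 1 \<le> (n + 1) * (1 + (\<Sum>\<alpha>\<in>J. card (A \<alpha>)))" by simp
    then have "(card CC + 1) ^ d \<le> (n + 1) ^ d * (1 + (\<Sum>\<alpha>\<in>J. card (A \<alpha>))) ^ d"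
      unfolding power_mult_distrib[symmetric] by (intro power_mono) auto
    then have bound: "c * (card CC + 1) ^ d \<le> c * (n + 1) ^ d * (1 + (\<Sum>\<alpha>\<in>J. card (A \<alpha>))) ^ d"
      unfolding mult.assoc by (intro mult_left_mono) auto
    let ?T = "\<lambda>y. {C \<in> CC. y \<in> C}"
    have "tcat (k \<alpha>) x y \<in> D \<alpha> \<longleftrightarrow> tcat (k \<alpha>) x y' \<in> D \<alpha>"
      if "\<alpha> \<in> J" "x \<in> A \<alpha>" "y \<in> tuples (carrier M) m" "y' \<in> tuples (carrier M) m" "?T y = ?T y'" for \<alpha> x y y'
    proof -
      have "\<forall>C\<in>\<C> \<alpha> x. y \<in> C \<longleftrightarrow> y' \<in> C"
      proof
        fix C assume "C \<in> \<C> \<alpha> x"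
        then have "C \<in> CC" unfolding CC_def using that(1,2) by blast
        then show "y \<in> C \<longleftrightarrow> y' \<in> C" using that(5) by blast
      qed
      then show ?thesis using Qx[OF that(1,2)] that(3,4) unfolding Q_def by blast
    qed
    note traces = this
    have "finite (?T ` carrier (K m)) \<and> card (?T ` carrier (K m)) \<le> c * (n + 1) ^ d * (1 + (\<Sum>\<alpha>\<in>J. card (A \<alpha>))) ^ d"
      using c[OF CCf CCc] bound by linarith
    then show "traces_le m J k D A (c * (n + 1) ^ d * (1 + (\<Sum>\<alpha>\<in>J. card (A \<alpha>))) ^ d)"
      unfolding traces_le_def carrier_K
    proof (intro exI[of _ ?T] conjI ballI impI)
      fix \<alpha> x y y'
      assume "\<alpha> \<in> J" "x \<in> A \<alpha>" "y \<in> tuples (carrier M) m" "y' \<in> tuples (carrier M) m" "?T y = ?T y'"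
      then show "tcat (k \<alpha>) x y \<in> D \<alpha> \<longleftrightarrow> tcat (k \<alpha>) x y' \<in> D \<alpha>" by (rule traces)
    qed simp_all
  qed
qed

text \<open>The sets of the family are indexed by \<open>y\<close> in \<open>G^m\<close>. So the
  points of \<open>A\<close> act as the parameters of the fibres, and the pieces of
  \<open>G^m\<close> bound the number of traces on \<open>A\<close>.\<close>

lemma vc_density_le:
  assumes b: "comm_breadth L M G m \<le> enat d"
  shows "vc_density L M m \<le> ereal (real d)"
  unfolding vc_density_def
proof (rule Sup_least)
  fix v assume "v \<in> {vc (tuples (carrier M) k) (solset M k \<phi> ` tuples (carrier M) m) | k \<phi>. \<phi> \<in> formulas L k m}"
  then obtain k \<phi> where \<phi>: "\<phi> \<in> formulas L k m"
    and v: "v = vc (tuples (carrier M) k) (solset M k \<phi> ` tuples (carrier M) m)" by auto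
  let ?S = "solset M k \<phi> ` tuples (carrier M) m" and ?X = "tuples (carrier M) k"
  let ?D = "{z \<in> tuples (carrier M) (k + m). sat M z \<phi>}"
  obtain c where c: "\<forall>A. (\<forall>\<alpha>\<in>{0::nat}. finite (A \<alpha>) \<and> A \<alpha> \<subseteq> ?X) \<longrightarrow>
      traces_le m {0::nat} (\<lambda>_. k) (\<lambda>_. ?D) A (c * (1 + (\<Sum>\<alpha>\<in>{0::nat}. card (A \<alpha>))) ^ d)"
    using count_traces[OF b, of "{0::nat}" "\<lambda>_. k" "\<lambda>_. ?D", OF _ definable_sat[OF \<phi>]] by blast
  have tr: "card ((\<lambda>C. C \<inter> A) ` ?S) \<le> c * (1 + n) ^ d" if A: "A \<subseteq> ?X" "finite A" "card A = n" for A n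
  proof -
    have tl: "traces_le m {0::nat} (\<lambda>_. k) (\<lambda>_. ?D) (\<lambda>_. A) (c * (1 + n) ^ d)"
      using spec[OF c, of "\<lambda>_. A"] A by simp
    obtain T :: "(nat \<Rightarrow> 'a) \<Rightarrow> (nat \<Rightarrow> 'a) set set" where T0: "finite (T ` tuples (carrier M) m) \<and>
      card (T ` tuples (carrier M) m) \<le> c * (1 + n) ^ d \<and>
      (\<forall>\<alpha>\<in>{0::nat}. \<forall>x\<in>A. \<forall>y\<in>tuples (carrier M) m. \<forall>y'\<in>tuples (carrier M) m. T y = T y' \<longrightarrow>
         (tcat k x y \<in> ?D \<longleftrightarrow> tcat k x y' \<in> ?D))"
      using tl unfolding traces_le_def ..
    have T: "finite (T ` tuples (carrier M) m)" "card (T ` tuples (carrier M) m) \<le> c * (1 + n) ^ d"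
      using T0 by blast+
    have T3: "tcat k x y \<in> ?D \<longleftrightarrow> tcat k x y' \<in> ?D"
      if "x \<in> A" "y \<in> tuples (carrier M) m" "y' \<in> tuples (carrier M) m" "T y = T y'" for x y y'
      using T0 that by blast
    have "card ((\<lambda>y. solset M k \<phi> y \<inter> A) ` tuples (carrier M) m) \<le> card (T ` tuples (carrier M) m)"
    proof (rule card_image_factor(2)[OF T(1)])
      fix y y' assume y: "y \<in> tuples (carrier M) m" "y' \<in> tuples (carrier M) m" "T y = T y'"
      have "sat M (tcat k x y) \<phi> \<longleftrightarrow> sat M (tcat k x y') \<phi>" if x: "x \<in> A" for x
        using T3[OF x y] tcat_tuples[of x k "carrier M" y m] tcat_tuples[of x k "carrier M" y' m] x A(1) y by auto
      then show "solset M k \<phi> y \<inter> A = solset M k \<phi> y' \<inter> A" unfolding solset_def by auto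
    qed
    then show ?thesis using T(2) by (simp add: image_image)
  qed
  have sf: "shatter_fun ?X ?S n \<le> c * (1 + n) ^ d" for n
  proof (cases "{card ((\<lambda>C. C \<inter> A) ` ?S) | A. A \<subseteq> ?X \<and> finite A \<and> card A = n} = {}")
    \<comment> \<open>For \<open>k = 0\<close> there may be no set of \<open>n\<close> points; the
      supremum of the empty set of naturals is 0.\<close>
    case True
    then show ?thesis unfolding shatter_fun_def by (simp only: Sup_nat_empty)
  next
    case False
    then show ?thesis unfolding shatter_fun_def by (rule cSup_least) (use tr in auto)
  qed
  have "(\<lambda>n. real (shatter_fun ?X ?S n)) \<in> O(\<lambda>n. real n powr real d)"
  \<comment> \<open>From \<open>n = 1\<close> on, \<open>1 + n\<close> is at most
    \<open>2 n\<close>, which produces the factor \<open>2 ^ d\<close>.\<close>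
  proof (rule bigoI[of _ "real (c * 2 ^ d)"], rule eventually_sequentiallyI[of 1])
    fix n :: nat assume n: "1 \<le> n"
    have "shatter_fun ?X ?S n \<le> c * (2 * n) ^ d"
      using sf[of n] n by (elim order_trans) (intro mult_left_mono power_mono, auto)
    then have "real (shatter_fun ?X ?S n) \<le> real (c * 2 ^ d) * real n ^ d"
      by (metis of_nat_le_iff of_nat_mult of_nat_power mult.assoc power_mult_distrib)
    then show "norm (real (shatter_fun ?X ?S n)) \<le> real (c * 2 ^ d) * norm (real n powr real d)"
      using n by (simp add: powr_realpow)
  qed
  then show "v \<le> ereal (real d)" unfolding v vc_def by (intro Inf_lower) auto
qed

text \<open>Suppose the depth is at least \<open>d + 1\<close>. The \<open>n ^ (d + 1)\<close> paths
  through the first \<open>n\<close> columns have realizations in \<open>G^m\<close>. No point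
  satisfies \<open>q \<alpha>\<close> instances of row \<open>\<alpha>\<close>, so one piece
  accommodates at most the product of the \<open>q \<alpha>\<close> paths. With
  \<open>O(n ^ d)\<close> pieces this fails for large \<open>n\<close>.\<close>

lemma dp_pow_le:
  assumes b: "comm_breadth L M G m \<le> enat d"
  shows "dp_pow L M m \<le> enat d"
  unfolding dp_pow_def dp_rank_def
proof (rule Sup_least)
  fix v assume "v \<in> {if finite I then enat (card I) else \<infinity> | I :: nat set. inp_pattern L M m (trivial_type m) I}"
  then obtain I :: "nat set" where I: "v = (if finite I then enat (card I) else \<infinity>)" "inp_pattern L M m (trivial_type m) I" by blast
  show "v \<le> enat d"
  proof (rule ccontr)
    assume "\<not> v \<le> enat d"
    then have "finite I \<Longrightarrow> Suc d \<le> card I" using I(1) by auto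
    then obtain J where J: "J \<subseteq> I" "card J = Suc d" "finite J"
      by (metis obtain_subset_with_card_n infinite_arbitrarily_large)
    have "inp_pattern L M m (trivial_type m) J"
      by (rule inp_pattern_reindex[OF I(2), of id]) (use J in auto)
    then obtain \<phi> l q b where
      wf0: "\<forall>\<alpha>\<in>J. \<phi> \<alpha> \<in> formulas L m (l \<alpha>) \<and> (\<forall>i. b \<alpha> i \<in> tuples (carrier M) (l \<alpha>))" and
      row0: "\<forall>\<alpha>\<in>J. \<forall>I. finite I \<and> card I = q \<alpha> \<longrightarrow> \<not> consistent M m ((\<lambda>i. (\<phi> \<alpha>, b \<alpha> i)) ` I)" and
      path: "\<And>\<eta> :: nat \<Rightarrow> nat. consistent M m (trivial_type m \<union> (\<lambda>\<alpha>. (\<phi> \<alpha>, b \<alpha> (\<eta> \<alpha>))) ` J)"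
      unfolding inp_pattern_def by auto
    have wf: "\<And>\<alpha>. \<alpha> \<in> J \<Longrightarrow> \<phi> \<alpha> \<in> formulas L m (l \<alpha>)" "\<And>\<alpha> i. \<alpha> \<in> J \<Longrightarrow> b \<alpha> i \<in> tuples (carrier M) (l \<alpha>)"
      and row: "\<And>\<alpha> I. \<alpha> \<in> J \<Longrightarrow> finite I \<Longrightarrow> card I = q \<alpha> \<Longrightarrow> \<not> consistent M m ((\<lambda>i. (\<phi> \<alpha>, b \<alpha> i)) ` I)"
      using wf0 row0 by blast+
    \<comment> \<open>The variables are swapped: parameters come first, so that the instances of a
      row become fibres in \<open>G^m\<close>.\<close>
    have "\<exists>\<psi>. \<psi> \<in> formulas L (l \<alpha>) m \<and> (\<forall>x y. sat M (tcat (l \<alpha>) x y) \<psi> \<longleftrightarrow> sat M (tcat m y x) (\<phi> \<alpha>))" if \<alpha>: "\<alpha> \<in> J" for \<alpha>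
    proof -
      let ?\<rho> = "\<lambda>i. if i < m then l \<alpha> + i else i - m"
      obtain \<psi> where \<psi>: "wf_fm L \<psi>" "fv \<psi> \<subseteq> ?\<rho> ` fv (\<phi> \<alpha>)" "\<And>e. sat M e \<psi> \<longleftrightarrow> sat M (e \<circ> ?\<rho>) (\<phi> \<alpha>)"
        using rename_fm[of L "\<phi> \<alpha>" ?\<rho> M] wf(1)[OF \<alpha>] unfolding formulas_def by auto
      have f: "fv (\<phi> \<alpha>) \<subseteq> {..<m + l \<alpha>}" using wf(1)[OF \<alpha>] by (simp add: formulas_def)
      have "x < l \<alpha> + m" if x: "x \<in> fv \<psi>" for x
      proof -
        obtain i where "i \<in> fv (\<phi> \<alpha>)" "x = ?\<rho> i" using \<psi>(2) x by blast
        then show ?thesis using f by (cases "i < m") auto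
      qed
      then have "\<psi> \<in> formulas L (l \<alpha>) m" using \<psi>(1) unfolding formulas_def by auto
      moreover have "sat M (tcat (l \<alpha>) x y) \<psi> \<longleftrightarrow> sat M (tcat m y x) (\<phi> \<alpha>)" for x y
        unfolding \<psi>(3) by (rule sat_cong) (use f in \<open>auto simp: tcat_def\<close>)
      ultimately show ?thesis by blast
    qed
    then obtain \<psi> where \<psi>: "\<And>\<alpha>. \<alpha> \<in> J \<Longrightarrow> \<psi> \<alpha> \<in> formulas L (l \<alpha>) m"
      "\<And>\<alpha> x y. \<alpha> \<in> J \<Longrightarrow> sat M (tcat (l \<alpha>) x y) (\<psi> \<alpha>) \<longleftrightarrow> sat M (tcat m y x) (\<phi> \<alpha>)"
      by metis
    define D where "D \<alpha> = {z \<in> tuples (carrier M) (l \<alpha> + m). sat M z (\<psi> \<alpha>)}" for \<alpha>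
    have Dd: "definable L M (carrier M) (l \<alpha> + m) (D \<alpha>)" if "\<alpha> \<in> J" for \<alpha>
      unfolding D_def by (rule definable_sat[OF \<psi>(1)[OF that]])
    obtain c where c: "\<forall>A. (\<forall>\<alpha>\<in>J. finite (A \<alpha>) \<and> A \<alpha> \<subseteq> tuples (carrier M) (l \<alpha>)) \<longrightarrow>
        traces_le m J l D A (c * (1 + (\<Sum>\<alpha>\<in>J. card (A \<alpha>))) ^ d)"
      using count_traces[where J = J and k = l and D = D, OF assms J(3) Dd] ..
    \<comment> \<open>\<open>d + 2\<close> comes from \<open>1 + (d + 1) n \<le> (d + 2) n\<close>.
      With this \<open>w\<close> the count reads \<open>n ^ (d + 1) \<le> w * n ^ d\<close>, which
      \<open>n = Suc w\<close> refutes.\<close>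
    define w where "w = c * (d + 2) ^ d * (\<Prod>\<alpha>\<in>J. q \<alpha>)"
    define n where "n = Suc w"
    have tl: "traces_le m J l D (\<lambda>\<alpha>. b \<alpha> ` {..<n}) (c * (1 + (\<Sum>\<alpha>\<in>J. card (b \<alpha> ` {..<n}))) ^ d)"
      by (rule mp[OF spec[OF c, of "\<lambda>\<alpha>. b \<alpha> ` {..<n}"]]) (use wf(2) in blast)
    obtain T :: "(nat \<Rightarrow> 'a) \<Rightarrow> (nat \<Rightarrow> 'a) set set" where T0: "finite (T ` tuples (carrier M) m) \<and>
        card (T ` tuples (carrier M) m) \<le> c * (1 + (\<Sum>\<alpha>\<in>J. card (b \<alpha> ` {..<n}))) ^ d \<and>
        (\<forall>\<alpha>\<in>J. \<forall>x\<in>b \<alpha> ` {..<n}. \<forall>y\<in>tuples (carrier M) m. \<forall>y'\<in>tuples (carrier M) m. T y = T y' \<longrightarrow>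
           (tcat (l \<alpha>) x y \<in> D \<alpha> \<longleftrightarrow> tcat (l \<alpha>) x y' \<in> D \<alpha>))"
      using tl unfolding traces_le_def ..
    have T: "finite (T ` tuples (carrier M) m)"
        "card (T ` tuples (carrier M) m) \<le> c * (1 + (\<Sum>\<alpha>\<in>J. card (b \<alpha> ` {..<n}))) ^ d"
      using T0 by blast+
    have T3: "tcat (l \<alpha>) (b \<alpha> i) y \<in> D \<alpha> \<longleftrightarrow> tcat (l \<alpha>) (b \<alpha> i) y' \<in> D \<alpha>"
      if "\<alpha> \<in> J" "i < n" "y \<in> tuples (carrier M) m" "y' \<in> tuples (carrier M) m" "T y = T y'" for \<alpha> i y y'
    proof -
      have "b \<alpha> i \<in> b \<alpha> ` {..<n}" using that(2) by simp
      then show ?thesis using T0 that by blast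
    qed
    have T': "sat M (tcat m y (b \<alpha> i)) (\<phi> \<alpha>) \<longleftrightarrow> sat M (tcat m y' (b \<alpha> i)) (\<phi> \<alpha>)"
      if "\<alpha> \<in> J" "i < n" "y \<in> tuples (carrier M) m" "y' \<in> tuples (carrier M) m" "T y = T y'" for \<alpha> i y y'
      using T3[OF that] \<psi>(2)[OF that(1)] tcat_tuples[OF wf(2)[OF that(1)] that(3)] tcat_tuples[OF wf(2)[OF that(1)] that(4)]
      unfolding D_def by simp
    have "\<exists>y\<in>tuples (carrier M) m. \<forall>\<alpha>\<in>J. sat M (tcat m y (b \<alpha> (\<eta> \<alpha>))) (\<phi> \<alpha>)" for \<eta>
    proof -
      have "finite (trivial_type m \<union> (\<lambda>\<alpha>. (\<phi> \<alpha>, b \<alpha> (\<eta> \<alpha>))) ` J)" using J(3) by (simp add: trivial_type_def)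
      then obtain y where y: "y \<in> tuples (carrier M) m" "realizes M m y (trivial_type m \<union> (\<lambda>\<alpha>. (\<phi> \<alpha>, b \<alpha> (\<eta> \<alpha>))) ` J)"
        using path[of \<eta>] unfolding consistent_def by blast
      have "sat M (tcat m y (b \<alpha> (\<eta> \<alpha>))) (\<phi> \<alpha>)" if "\<alpha> \<in> J" for \<alpha>
        using y(2) that unfolding realizes_def by auto
      then show ?thesis using y(1) by blast
    qed
    then obtain y where y: "\<And>\<eta>. y \<eta> \<in> tuples (carrier M) m" "\<And>\<eta> \<alpha>. \<alpha> \<in> J \<Longrightarrow> sat M (tcat m (y \<eta>) (b \<alpha> (\<eta> \<alpha>))) (\<phi> \<alpha>)"
      by metis
    define P where "P = J \<rightarrow>\<^sub>E {..<n}"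
    have Pf: "finite P" unfolding P_def using J(3) by (intro finite_PiE) auto
    have "card P \<le> (\<Prod>\<alpha>\<in>J. q \<alpha>) * card ((\<lambda>\<eta>. T (y \<eta>)) ` P)"
    proof (rule card_le_fibres[OF Pf])
      fix t assume "t \<in> (\<lambda>\<eta>. T (y \<eta>)) ` P"
      then obtain \<eta>0 where \<eta>0: "\<eta>0 \<in> P" "t = T (y \<eta>0)" by auto
      \<comment> \<open>The columns of row \<open>\<alpha>\<close> satisfied by
        \<open>y \<eta>0\<close>. A path in the same piece runs inside them, because its own
        realization cannot be told apart from \<open>y \<eta>0\<close>.\<close>
      define S where "S \<alpha> = {i. i < n \<and> sat M (tcat m (y \<eta>0) (b \<alpha> i)) (\<phi> \<alpha>)}" for \<alpha>
      have Sf: "finite (S \<alpha>)" for \<alpha> unfolding S_def by auto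
      have "{\<eta> \<in> P. T (y \<eta>) = t} \<subseteq> PiE J S"
      proof
        fix \<eta> assume "\<eta> \<in> {\<eta> \<in> P. T (y \<eta>) = t}"
        then have \<eta>: "\<eta> \<in> P" "T (y \<eta>) = T (y \<eta>0)" using \<eta>0 by auto
        have "\<eta> \<alpha> \<in> S \<alpha>" if \<alpha>: "\<alpha> \<in> J" for \<alpha>
        proof -
          have "\<eta> \<alpha> < n" using \<eta>(1) \<alpha> unfolding P_def by auto
          then show ?thesis unfolding S_def using T'[OF \<alpha> _ y(1) y(1) \<eta>(2)] y(2)[OF \<alpha>, of \<eta>] by simp
        qed
        moreover have "\<eta> \<in> extensional J" using \<eta>(1) unfolding P_def by (simp add: PiE_iff)
        ultimately show "\<eta> \<in> PiE J S" by (simp add: PiE_iff)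
      qed
      then have "card {\<eta> \<in> P. T (y \<eta>) = t} \<le> card (PiE J S)" using J(3) Sf by (intro card_mono finite_PiE)
      also have "\<dots> = (\<Prod>\<alpha>\<in>J. card (S \<alpha>))" by (rule card_PiE[OF J(3)])
      also have "\<dots> \<le> (\<Prod>\<alpha>\<in>J. q \<alpha>)"
      proof (rule prod_mono)
        fix \<alpha> assume \<alpha>: "\<alpha> \<in> J"
        have "card (S \<alpha>) \<le> q \<alpha>"
        proof (rule ccontr)
          assume "\<not> card (S \<alpha>) \<le> q \<alpha>"
          then obtain I where I: "I \<subseteq> S \<alpha>" "card I = q \<alpha>" "finite I"
            using obtain_subset_with_card_n[of "q \<alpha>" "S \<alpha>"] by auto
          have "realizes M m (y \<eta>0) ((\<lambda>i. (\<phi> \<alpha>, b \<alpha> i)) ` I)" using I(1) unfolding realizes_def S_def by auto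
          then have "consistent M m ((\<lambda>i. (\<phi> \<alpha>, b \<alpha> i)) ` I)"
            unfolding consistent_def realizes_def using y(1)[of \<eta>0] by blast
          then show False using row[OF \<alpha> I(3,2)] by simp
        qed
        then show "0 \<le> card (S \<alpha>) \<and> card (S \<alpha>) \<le> q \<alpha>" by simp
      qed
      finally show "card {\<eta> \<in> P. T (y \<eta>) = t} \<le> (\<Prod>\<alpha>\<in>J. q \<alpha>)" .
    qed
    also have "card ((\<lambda>\<eta>. T (y \<eta>)) ` P) \<le> card (T ` tuples (carrier M) m)"
      using y(1) by (intro card_mono T(1)) auto
    also have "\<dots> \<le> c * (1 + (\<Sum>\<alpha>\<in>J. card (b \<alpha> ` {..<n}))) ^ d" by (rule T(2))
    also have "\<dots> \<le> c * ((d + 2) * n) ^ d"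
    proof -
      have "(\<Sum>\<alpha>\<in>J. card (b \<alpha> ` {..<n})) \<le> (\<Sum>\<alpha>\<in>J. n)"
        by (rule sum_mono) (metis card_image_le card_lessThan finite_lessThan)
      then have "1 + (\<Sum>\<alpha>\<in>J. card (b \<alpha> ` {..<n})) \<le> (d + 2) * n" using J(2) by (simp add: n_def)
      then show ?thesis by (intro mult_left_mono power_mono) auto
    qed
    finally have "card P \<le> (\<Prod>\<alpha>\<in>J. q \<alpha>) * (c * ((d + 2) * n) ^ d)" by simp
    also have "\<dots> = w * n ^ d" unfolding w_def power_mult_distrib by (simp only: ac_simps)
    finally have "n * n ^ d \<le> w * n ^ d" using J by (simp add: P_def card_PiE)
    then show False by (simp add: n_def)
  qed
qed

end

section \<open>Lower bounds\<close>

lemma (in group) gprod_closed: "(\<And>i. i < n \<Longrightarrow> g i \<in> carrier G) \<Longrightarrow> gprod g n \<in> carrier G"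
  by (induction n) auto

lemma formulas_bex:
  fixes d :: nat
  assumes "0 < k + n" "\<And>i. i < d \<Longrightarrow> \<phi> i \<in> formulas L k n"
  shows "\<exists>\<psi>\<in>formulas L k n. \<forall>e. sat M e \<psi> \<longleftrightarrow> (\<exists>i<d. sat M e (\<phi> i))"
  using assms(2)
proof (induction d)
  case 0
  \<comment> \<open>The false formula chosen here mentions \<open>Var 0\<close>, which therefore has
    to be one of the \<open>k + n\<close> variables.\<close>
  show ?case
    by (intro bexI[of _ "Neg (Equal (Var 0) (Var 0))"]) (use assms(1) in \<open>auto simp: formulas_def\<close>)
next
  case (Suc d)
  then obtain \<psi> where "\<psi> \<in> formulas L k n" "\<forall>e. sat M e \<psi> \<longleftrightarrow> (\<exists>i<d. sat M e (\<phi> i))" by auto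
  moreover have "\<phi> d \<in> formulas L k n" using Suc.prems by auto
  ultimately show ?case
    by (intro bexI[of _ "Neg (Conj (Neg \<psi>) (Neg (\<phi> d)))"]) (auto simp: formulas_def less_Suc_eq)
qed

lemma powr_growth:
  assumes "a > (0::real)" "\<And>n::nat. n \<ge> N \<Longrightarrow> real n powr a \<le> C"
  shows False
proof -
  define B where "B = (\<bar>C\<bar> + 1) powr (1 / a)"
  obtain n :: nat where n: "B \<le> real n" using real_arch_simple by blast
  have "\<bar>C\<bar> + 1 = B powr a" using assms(1) by (simp add: B_def powr_powr)
  also have "\<dots> \<le> real (max N n) powr a" using n assms(1) by (intro powr_mono2) (auto simp: B_def)
  also have "\<dots> \<le> C" by (rule assms(2)) simp
  finally show False by simp
qed

context group_structure
begin

section \<open>Formulas for double cosets and conjugates\<close>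

lemma expressible_mult_eq:
  "expressible L M (\<lambda>e. fn M mu [e i, e j] = fn M mu [e i', e j'])"
  using expressible_sat[of L "Equal (Fn mu [Var i, Var j]) (Fn mu [Var i', Var j'])" M] mu
  by (simp add: numeral_2_eq_2)

lemma expressible_mult2_eq:
  "expressible L M (\<lambda>e. e v = fn M mu [fn M mu [e i, e j], e k])"
  using expressible_sat[of L "Equal (Var v) (Fn mu [Fn mu [Var i, Var j], Var k])" M] mu
  by (simp add: numeral_2_eq_2)

lemma tuple_mult_nth:
  assumes "x \<in> tuples (carrier M) m" "y \<in> tuples (carrier M) m" "i < m"
  shows "(x \<otimes>\<^bsub>K m\<^esub> y) i = fn M mu [x i, y i]"
  using assms mu_eq[of "x i" "y i"] by (simp add: PiE_iff)

lemma K_closed: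
  assumes "x \<in> tuples (carrier M) m" "y \<in> tuples (carrier M) m"
  shows "x \<otimes>\<^bsub>K m\<^esub> y \<in> tuples (carrier M) m"
  using monoid.m_closed[OF group.is_monoid[OF group_K[of m]], of x y] assms unfolding carrier_K .

lemma tuple_eq_iff:
  assumes "x \<in> tuples A m" "y \<in> tuples A m"
  shows "x = y \<longleftrightarrow> (\<forall>i\<in>{..<m}. x i = y i)"
  using PiE_ext[OF assms] by auto

text \<open>Uniform in \<open>g\<close>: the double cosets of \<open>H\<close> are the instances of
  one formula with \<open>g\<close> among its parameters, as a row of a pattern demands.\<close>

lemma dcos_expressible:
  assumes H: "H \<in> \<H> m"
  shows "\<exists>P c. expressible L M P \<and> range c \<subseteq> carrier M \<and>
    (\<forall>x\<in>tuples (carrier M) m. \<forall>g\<in>tuples (carrier M) m. P (tcat m x (tcat m g c)) \<longleftrightarrow> x \<in> group.dcos (K m) H g)"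
proof -
  obtain P c where P: "expressible L M P" "range c \<subseteq> carrier M" "H = {x \<in> tuples (carrier M) m. P (tcat m x c)}"
    using acleq0_definable_expressible[OF struct] H unfolding acleq0_subgroups_def by blast
  \<comment> \<open>Variable layout: \<open>h'\<close>, \<open>h\<close>, \<open>x\<close>,
    \<open>g\<close> in blocks of length \<open>m\<close>, then \<open>c\<close>. The definition of
    \<open>H\<close> is read at \<open>h\<close> through \<open>\<rho>\<close> and at
    \<open>h'\<close> through \<open>\<sigma>\<close>.\<close>
  define \<rho> where "\<rho> j = (if j < m then m + j else j + 3 * m)" for j
  define \<sigma> where "\<sigma> j = (if j < m then j else j + 3 * m)" for j
  define Q where "Q e \<longleftrightarrow> (\<exists>h\<in>tuples (carrier M) m. \<exists>h'\<in>tuples (carrier M) m.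
      P (tcat m h' (tcat m h e) \<circ> \<rho>) \<and> P (tcat m h' (tcat m h e) \<circ> \<sigma>) \<and>
      (\<forall>i\<in>{..<m}. tcat m h' (tcat m h e) (2 * m + i) = fn M mu [fn M mu [tcat m h' (tcat m h e) (m + i),
         tcat m h' (tcat m h e) (3 * m + i)], tcat m h' (tcat m h e) i]))" for e
  have "expressible L M (\<lambda>e. P (e \<circ> \<rho>) \<and> P (e \<circ> \<sigma>) \<and>
      (\<forall>i\<in>{..<m}. e (2 * m + i) = fn M mu [fn M mu [e (m + i), e (3 * m + i)], e i]))"
    by (intro expressible_conj expressible_rename[OF P(1)] expressible_ball expressible_mult2_eq) auto
  from expressible_ex_tuple[OF expressible_ex_tuple[OF this, of m], of m]
  have Q: "expressible L M Q" unfolding Q_def[abs_def] .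
  have "Q (tcat m x (tcat m g c)) \<longleftrightarrow> x \<in> group.dcos (K m) H g"
    if x: "x \<in> tuples (carrier M) m" and g: "g \<in> tuples (carrier M) m" for x g
  proof -
    have r: "tcat m h' (tcat m h (tcat m x (tcat m g c))) \<circ> \<rho> = tcat m h c" for h h'
      by (auto simp: \<rho>_def tcat_def fun_eq_iff)
    have s: "tcat m h' (tcat m h (tcat m x (tcat m g c))) \<circ> \<sigma> = tcat m h' c" for h h'
      by (auto simp: \<sigma>_def tcat_def fun_eq_iff)
    have n: "tcat m h' (tcat m h (tcat m x (tcat m g c))) (2 * m + i) = x i"
      "tcat m h' (tcat m h (tcat m x (tcat m g c))) (m + i) = h i"
      "tcat m h' (tcat m h (tcat m x (tcat m g c))) (3 * m + i) = g i"
      "tcat m h' (tcat m h (tcat m x (tcat m g c))) i = h' i" if "i < m" for h h' i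
      using that by (auto simp: tcat_def)
    have m: "(\<forall>i\<in>{..<m}. x i = fn M mu [fn M mu [h i, g i], h' i]) \<longleftrightarrow> x = h \<otimes>\<^bsub>K m\<^esub> g \<otimes>\<^bsub>K m\<^esub> h'"
      if h: "h \<in> tuples (carrier M) m" "h' \<in> tuples (carrier M) m" for h h'
      unfolding tuple_eq_iff[OF x K_closed[OF K_closed[OF h(1) g] h(2)]]
      by (rule ball_cong[OF refl]) (simp only: lessThan_iff tuple_mult_nth[OF K_closed[OF h(1) g] h(2)] tuple_mult_nth[OF h(1) g])
    have "Q (tcat m x (tcat m g c)) \<longleftrightarrow> (\<exists>h\<in>tuples (carrier M) m. \<exists>h'\<in>tuples (carrier M) m.
        P (tcat m h c) \<and> P (tcat m h' c) \<and> x = h \<otimes>\<^bsub>K m\<^esub> g \<otimes>\<^bsub>K m\<^esub> h')"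
      unfolding Q_def r s using n m by (intro bex_cong refl) (simp del: mult_product_group)
    also have "\<dots> \<longleftrightarrow> (\<exists>h\<in>H. \<exists>h'\<in>H. x = h \<otimes>\<^bsub>K m\<^esub> g \<otimes>\<^bsub>K m\<^esub> h')" unfolding P(3) by blast
    also have "\<dots> \<longleftrightarrow> x \<in> group.dcos (K m) H g" unfolding group.dcos_def[OF group_K] by blast
    finally show ?thesis .
  qed
  then show ?thesis using Q P(2) by (intro exI[of _ Q] exI[of _ c]) blast
qed

end

context one_based_structure
begin

text \<open>\<open>g\<close> occupies the first block, so that the conjugates of \<open>H\<close>
  are the fibres of one definable set and \<open>definable_fibres\<close> applies to them
  uniformly.\<close>

lemma conj_definable:
  assumes H: "H \<in> \<H> m"
  shows "\<exists>D. definable L M (carrier M) (m + m) D \<and>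
    (\<forall>g\<in>tuples (carrier M) m. \<forall>x\<in>tuples (carrier M) m. tcat m g x \<in> D \<longleftrightarrow> x \<in> conj_set (K m) g H)"
proof -
  obtain P c where P: "expressible L M P" "range c \<subseteq> carrier M" "H = {x \<in> tuples (carrier M) m. P (tcat m x c)}"
    using acleq0_definable_expressible[OF struct] H unfolding acleq0_subgroups_def by blast
  \<comment> \<open>Variable layout: \<open>h\<close>, \<open>g\<close>, \<open>x\<close>, then
    \<open>c\<close>. Conjugacy is written as \<open>x g = g h\<close>.\<close>
  define \<rho> where "\<rho> j = (if j < m then j else j + 2 * m)" for j
  define Q where "Q e \<longleftrightarrow> (\<exists>h\<in>tuples (carrier M) m. P (tcat m h e \<circ> \<rho>) \<and>
      (\<forall>i\<in>{..<m}. fn M mu [tcat m h e (2 * m + i), tcat m h e (m + i)] = fn M mu [tcat m h e (m + i), tcat m h e i]))" for e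
  have "expressible L M (\<lambda>e. P (e \<circ> \<rho>) \<and>
      (\<forall>i\<in>{..<m}. fn M mu [e (2 * m + i), e (m + i)] = fn M mu [e (m + i), e i]))"
    by (intro expressible_conj expressible_rename[OF P(1)] expressible_ball expressible_mult_eq) auto
  from expressible_ex_tuple[OF this, of m]
  have Q: "expressible L M Q" unfolding Q_def[abs_def] .
  let ?D = "{z \<in> tuples (carrier M) (m + m). Q (tcat (m + m) z c)}"
  have "tcat m g x \<in> ?D \<longleftrightarrow> x \<in> conj_set (K m) g H"
    if g: "g \<in> tuples (carrier M) m" and x: "x \<in> tuples (carrier M) m" for g x
  proof -
    let ?e = "tcat (m + m) (tcat m g x) c"
    have r: "tcat m h ?e \<circ> \<rho> = tcat m h c" for h
      by (auto simp: \<rho>_def tcat_def fun_eq_iff)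
    have n: "tcat m h ?e (2 * m + i) = x i" "tcat m h ?e (m + i) = g i" "tcat m h ?e i = h i" if "i < m" for h i
      using that by (auto simp: tcat_def)
    have m: "(\<forall>i\<in>{..<m}. fn M mu [x i, g i] = fn M mu [g i, h i]) \<longleftrightarrow> x \<otimes>\<^bsub>K m\<^esub> g = g \<otimes>\<^bsub>K m\<^esub> h"
      if h: "h \<in> tuples (carrier M) m" for h
      unfolding tuple_eq_iff[OF K_closed[OF x g] K_closed[OF g h]]
      by (rule ball_cong[OF refl]) (simp only: lessThan_iff tuple_mult_nth[OF x g] tuple_mult_nth[OF g h])
    have "tcat m g x \<in> ?D \<longleftrightarrow> Q ?e" using tcat_tuples[OF g x] by simp
    also have "\<dots> \<longleftrightarrow> (\<exists>h\<in>tuples (carrier M) m. P (tcat m h c) \<and> x \<otimes>\<^bsub>K m\<^esub> g = g \<otimes>\<^bsub>K m\<^esub> h)"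
      unfolding Q_def r using n m by (intro bex_cong refl) (simp del: mult_product_group)
    also have "\<dots> \<longleftrightarrow> (\<exists>h\<in>H. x \<otimes>\<^bsub>K m\<^esub> g = g \<otimes>\<^bsub>K m\<^esub> h)" unfolding P(3) by blast
    also have "\<dots> \<longleftrightarrow> x \<in> conj_set (K m) g H"
      by (rule group.mem_conj_set_iff[OF group_K \<H>_subset[OF H], symmetric]) (use g x carrier_K in simp_all)
    finally show ?thesis .
  qed
  moreover have "definable L M (carrier M) (m + m) ?D"
    unfolding M_definable_iff using Q P(2) by (intro exI[of _ Q] exI[of _ c]) simp
  ultimately show ?thesis by blast
qed

text \<open>By \<open>definable_fibres\<close> all conjugates are decided by cosets of the same
  finite \<open>\<B>\<close>; by \<open>boolean_comb_subgroup\<close> each is commensurable with the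
  meet of a subset of \<open>\<B>\<close>.\<close>

lemma conj_commensurable:
  assumes H: "H \<in> \<H> m"
  shows "\<exists>\<D>. finite \<D> \<and> (\<forall>D\<in>\<D>. D \<subseteq> carrier (K m)) \<and> (\<forall>g\<in>carrier (K m). \<exists>D\<in>\<D>.
    virt_le (K m) (conj_set (K m) g H) D \<and> virt_le (K m) D (conj_set (K m) g H))"
proof -
  obtain D where D: "definable L M (carrier M) (m + m) D"
    "\<forall>g\<in>tuples (carrier M) m. \<forall>x\<in>tuples (carrier M) m. tcat m g x \<in> D \<longleftrightarrow> x \<in> conj_set (K m) g H"
    using conj_definable[OF H] by blast
  obtain \<B> N where \<B>: "finite \<B>" "\<B> \<subseteq> \<H> m" and C: "\<forall>x\<in>tuples (carrier M) m. \<exists>\<C>. finite \<C> \<and> card \<C> \<le> N \<and>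
    (\<forall>C\<in>\<C>. \<exists>a\<in>carrier (K m). \<exists>B\<in>\<B>. C = a <#\<^bsub>K m\<^esub> B) \<and>
    (\<forall>y\<in>tuples (carrier M) m. \<forall>y'\<in>tuples (carrier M) m.
       (\<forall>C\<in>\<C>. y \<in> C \<longleftrightarrow> y' \<in> C) \<longrightarrow> (tcat m x y \<in> D \<longleftrightarrow> tcat m x y' \<in> D))"
    using definable_fibres[OF D(1)] by (elim exE conjE) (rule that)
  let ?\<D> = "meet_of (K m) ` Pow \<B>"
  have "\<exists>E\<in>?\<D>. virt_le (K m) (conj_set (K m) g H) E \<and> virt_le (K m) E (conj_set (K m) g H)"
    if g: "g \<in> carrier (K m)" for g
  proof -
    have gt: "g \<in> tuples (carrier M) m" using g carrier_K by simp
    obtain \<C> where \<C>: "finite \<C>" "\<forall>C\<in>\<C>. \<exists>a\<in>carrier (K m). \<exists>B\<in>\<B>. C = a <#\<^bsub>K m\<^esub> B"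
      and inv: "\<forall>y\<in>tuples (carrier M) m. \<forall>y'\<in>tuples (carrier M) m.
       (\<forall>C\<in>\<C>. y \<in> C \<longleftrightarrow> y' \<in> C) \<longrightarrow> (tcat m g y \<in> D \<longleftrightarrow> tcat m g y' \<in> D)"
      using bspec[OF C gt] by (elim exE conjE) (rule that)
    let ?S = "conj_set (K m) g H"
    have S: "subgroup ?S (K m)" by (rule group.conj_set_subgroup[OF group_K subgroup_\<H>[OF H] g])
    have inv': "y' \<in> ?S" if "y \<in> carrier (K m)" "y' \<in> carrier (K m)" "\<And>C. C \<in> \<C> \<Longrightarrow> y \<in> C \<longleftrightarrow> y' \<in> C" "y \<in> ?S" for y y'
    proof -
      have y: "y \<in> tuples (carrier M) m" "y' \<in> tuples (carrier M) m" using that(1,2) carrier_K by simp_all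
      have "tcat m g y \<in> D \<longleftrightarrow> tcat m g y' \<in> D" using inv y that(3) by blast
      then show ?thesis using D(2) gt y that(4) by blast
    qed
    have cos: "\<exists>a\<in>carrier (K m). \<exists>B\<in>\<B>. C = a <#\<^bsub>K m\<^esub> B" if "C \<in> \<C>" for C using \<C>(2) that by blast
    have sub: "subgroup B (K m)" if "B \<in> \<B>" for B using \<B>(2) that subgroup_\<H> by blast
    have bc: "virt_le (K m) ?S (meet_of (K m) {B \<in> \<B>. virt_le (K m) ?S B})"
    proof (rule group.boolean_comb_subgroup(1)[OF group_K \<B>(1) _ S \<C>(1)])
      show "subgroup B (K m)" if "B \<in> \<B>" for B using sub that by blast
      show "\<exists>a\<in>carrier (K m). \<exists>B\<in>\<B>. C = a <#\<^bsub>K m\<^esub> B" if "C \<in> \<C>" for C using cos that by blast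
      show "y' \<in> ?S" if "y \<in> carrier (K m)" "y' \<in> carrier (K m)" "\<And>C. C \<in> \<C> \<Longrightarrow> y \<in> C \<longleftrightarrow> y' \<in> C" "y \<in> ?S" for y y'
        by (rule inv'[OF that])
    qed
    have bc': "virt_le (K m) (meet_of (K m) {B \<in> \<B>. virt_le (K m) ?S B}) ?S"
    proof (rule group.boolean_comb_subgroup(2)[OF group_K \<B>(1) _ S \<C>(1)])
      show "subgroup B (K m)" if "B \<in> \<B>" for B using sub that by blast
      show "\<exists>a\<in>carrier (K m). \<exists>B\<in>\<B>. C = a <#\<^bsub>K m\<^esub> B" if "C \<in> \<C>" for C using cos that by blast
      show "y' \<in> ?S" if "y \<in> carrier (K m)" "y' \<in> carrier (K m)" "\<And>C. C \<in> \<C> \<Longrightarrow> y \<in> C \<longleftrightarrow> y' \<in> C" "y \<in> ?S" for y y'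
        by (rule inv'[OF that])
    qed
    show ?thesis
    proof (rule bexI[of _ "meet_of (K m) {B \<in> \<B>. virt_le (K m) ?S B}"])
      show "virt_le (K m) ?S (meet_of (K m) {B \<in> \<B>. virt_le (K m) ?S B}) \<and>
          virt_le (K m) (meet_of (K m) {B \<in> \<B>. virt_le (K m) ?S B}) ?S"
        using bc bc' by blast
    qed blast
  qed
  moreover have "finite ?\<D>" using \<B>(1) by simp
  moreover have "\<forall>E\<in>?\<D>. E \<subseteq> carrier (K m)" by (auto simp: meet_of_def)
  ultimately show ?thesis by (rule_tac x = ?\<D> in exI) blast
qed

text \<open>Common source of both lower bounds: the instances in a row exclude each other, and all
  rows share one parameter length \<open>l\<close>, so that \<open>vc_density_ge\<close> can merge
  them into a single formula.\<close>

definition array :: "nat \<Rightarrow> nat \<Rightarrow> (nat \<Rightarrow> ('f, 'r) fm) \<Rightarrow> nat \<Rightarrow> (nat \<Rightarrow> nat \<Rightarrow> nat \<Rightarrow> 'a) \<Rightarrow> bool" where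
  "array m d \<chi> l b \<longleftrightarrow> (\<forall>i<d. \<chi> i \<in> formulas L m l) \<and> (\<forall>i<d. \<forall>s. b i s \<in> tuples (carrier M) l) \<and>
    (\<forall>i<d. \<forall>y\<in>tuples (carrier M) m. \<forall>s s'. sat M (tcat m y (b i s)) (\<chi> i) \<and> sat M (tcat m y (b i s')) (\<chi> i) \<longrightarrow> s = s') \<and>
    (\<forall>\<eta>. \<exists>y\<in>tuples (carrier M) m. \<forall>i<d. sat M (tcat m y (b i (\<eta> i))) (\<chi> i))"

lemma array_of_irredundant:
  assumes irr: "irredundant m d H"
  shows "\<exists>\<chi> l b. array m d \<chi> l b"
proof -
  interpret Km: group "K m" by (rule group_K)
  have H: "H i \<in> \<H> m" if "i < d" for i using irr that by (simp add: irredundant_def)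
  have Hs: "subgroup (H i) (K m)" if "i < d" for i using H[OF that] by (rule subgroup_\<H>)
  define X where "X i = meet_of (K m) (H ` ({..<d} - {i}))" for i
  have Xs: "subgroup (X i) (K m)" for i
    unfolding X_def by (rule Km.subgroup_meet_of) (use Hs in auto)
  have XH: "X j \<subseteq> H i" if "i < d" "i \<noteq> j" for i j using that unfolding X_def meet_of_def by auto
  have Xc: "X i \<subseteq> carrier (K m)" for i using Xs by (rule subgroup.subset)
  have "\<exists>g :: nat \<Rightarrow> nat \<Rightarrow> 'a. (\<forall>s. g s \<in> X i) \<and> (\<forall>s s'. Km.dcos (H i) (g s) = Km.dcos (H i) (g s') \<longrightarrow> s = s')"
    if i: "i < d" for i
  proof -
    obtain \<D> where \<D>: "finite \<D>" "\<forall>D\<in>\<D>. D \<subseteq> carrier (K m)" "\<forall>g\<in>carrier (K m). \<exists>D\<in>\<D>.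
        virt_le (K m) (conj_set (K m) g (H i)) D \<and> virt_le (K m) D (conj_set (K m) g (H i))"
      using conj_commensurable[OF H[OF i]] by blast
    have "infinite (Km.dcos (H i) ` X i)"
    proof (rule Km.infinite_dcos[OF Hs[OF i] Xs _ \<D>(1)])
      show "\<not> virt_le (K m) (X i) (H i)" using irr i unfolding irredundant_def X_def by blast
    qed (use \<D>(2,3) in blast)+
    then obtain f :: "nat \<Rightarrow> (nat \<Rightarrow> 'a) set" where f: "inj f" "range f \<subseteq> Km.dcos (H i) ` X i"
      using infinite_countable_subset by blast
    have "\<forall>s. \<exists>x. x \<in> X i \<and> f s = Km.dcos (H i) x" using f(2) by blast
    then obtain g where g: "\<And>s. g s \<in> X i \<and> f s = Km.dcos (H i) (g s)" by metis
    have "s = s'" if "Km.dcos (H i) (g s) = Km.dcos (H i) (g s')" for s s'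
      using g[of s] g[of s'] that injD[OF f(1), of s s'] by simp
    then show ?thesis using g by blast
  qed
  then obtain g :: "nat \<Rightarrow> nat \<Rightarrow> nat \<Rightarrow> 'a" where g: "\<And>i s. i < d \<Longrightarrow> g i s \<in> X i"
    "\<And>i s s'. \<lbrakk>i < d; Km.dcos (H i) (g i s) = Km.dcos (H i) (g i s')\<rbrakk> \<Longrightarrow> s = s'"
    by metis
  have gc: "g i s \<in> carrier (K m)" if "i < d" for i s using g(1)[OF that] Xc by blast
  have gt: "g i s \<in> tuples (carrier M) m" if "i < d" for i s using gc[OF that] carrier_K by simp
  have prod: "\<exists>y\<in>tuples (carrier M) m. \<forall>i<d. y \<in> Km.dcos (H i) (g i (\<eta> i))" for \<eta>
  proof (rule bexI[of _ "Km.gprod (\<lambda>i. g i (\<eta> i)) d"], intro allI impI)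
    fix i assume i: "i < d"
    have "if i < d then Km.gprod (\<lambda>i. g i (\<eta> i)) d \<in> Km.dcos (H i) (g i (\<eta> i)) else Km.gprod (\<lambda>i. g i (\<eta> i)) d \<in> H i"
    proof (rule Km.gprod_mem_dcos[where d = d])
      show "g j (\<eta> j) \<in> H i" if "i < d" "j < d" "j \<noteq> i" for i j
        using g(1)[OF that(2)] XH[of i j] that by auto
    qed (use Hs gc i in auto)
    then show "Km.gprod (\<lambda>i. g i (\<eta> i)) d \<in> Km.dcos (H i) (g i (\<eta> i))" using i by simp
  next
    show "Km.gprod (\<lambda>i. g i (\<eta> i)) d \<in> tuples (carrier M) m"
      using Km.gprod_closed[of d "\<lambda>i. g i (\<eta> i)"] gc unfolding carrier_K by blast
  qed
  have "\<exists>\<phi> c. wf_fm L \<phi> \<and> range c \<subseteq> carrier M \<and>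
      (\<forall>x\<in>tuples (carrier M) m. \<forall>h\<in>tuples (carrier M) m. sat M (tcat m x (tcat m h c)) \<phi> \<longleftrightarrow> x \<in> Km.dcos (H i) h)"
    if i: "i < d" for i
  proof -
    obtain P c where P: "expressible L M P" "range c \<subseteq> carrier M"
      "\<forall>x\<in>tuples (carrier M) m. \<forall>h\<in>tuples (carrier M) m. P (tcat m x (tcat m h c)) \<longleftrightarrow> x \<in> Km.dcos (H i) h"
      using dcos_expressible[OF H[OF i]] by blast
    obtain \<phi> where \<phi>: "wf_fm L \<phi>" "\<And>e. range e \<subseteq> carrier M \<Longrightarrow> sat M e \<phi> \<longleftrightarrow> P e"
      using P(1) unfolding expressible_def by blast
    have "sat M (tcat m x (tcat m h c)) \<phi> \<longleftrightarrow> x \<in> Km.dcos (H i) h"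
      if "x \<in> tuples (carrier M) m" "h \<in> tuples (carrier M) m" for x h
      using \<phi>(2)[OF range_tcat[OF that(1) range_tcat[OF that(2) P(2)]]] P(3) that by blast
    then show ?thesis using \<phi>(1) P(2) by blast
  qed
  then obtain \<phi> c where \<phi>: "\<And>i. i < d \<Longrightarrow> wf_fm L (\<phi> i) \<and> range (c i) \<subseteq> carrier M \<and>
      (\<forall>x\<in>tuples (carrier M) m. \<forall>h\<in>tuples (carrier M) m. sat M (tcat m x (tcat m h (c i))) (\<phi> i) \<longleftrightarrow> x \<in> Km.dcos (H i) h)"
    by metis
  have "finite (\<Union>i<d. fv (\<phi> i))" by (auto simp: finite_fv)
  \<comment> \<open>A bound for all variables of all rows also bounds the number of parameters in
    each of them.\<close>
  then obtain l where l: "(\<Union>i<d. fv (\<phi> i)) \<subseteq> {..<l}" using finite_nat_bounded by blast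
  define b where "b i s = restrict (tcat m (g i s) (c i)) {..<l}" for i s
  have fm: "\<phi> i \<in> formulas L m l" if "i < d" for i
    using \<phi>[OF that] l that unfolding formulas_def by (auto simp: subset_iff trans_less_add2)
  have bt: "b i s \<in> tuples (carrier M) l" if "i < d" for i s
  proof -
    have "range (tcat m (g i s) (c i)) \<subseteq> carrier M" using range_tcat[OF gt[OF that]] \<phi>[OF that] by blast
    then show ?thesis unfolding b_def by auto
  qed
  have sat: "sat M (tcat m y (b i s)) (\<phi> i) \<longleftrightarrow> y \<in> Km.dcos (H i) (g i s)"
    if i: "i < d" and y: "y \<in> tuples (carrier M) m" for i s y
  proof -
    have "fv (\<phi> i) \<subseteq> {..<l}" using l i by blast
    then have "sat M (tcat m y (b i s)) (\<phi> i) \<longleftrightarrow> sat M (tcat m y (tcat m (g i s) (c i))) (\<phi> i)"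
      by (intro sat_cong) (auto simp: b_def tcat_def)
    then show ?thesis using \<phi>[OF i] y gt[OF i] by blast
  qed
  have "array m d \<phi> l b" unfolding array_def
  proof (intro conjI allI impI ballI)
    fix \<eta>
    obtain y where "y \<in> tuples (carrier M) m" "\<forall>i<d. y \<in> Km.dcos (H i) (g i (\<eta> i))" using prod by blast
    then show "\<exists>y\<in>tuples (carrier M) m. \<forall>i<d. sat M (tcat m y (b i (\<eta> i))) (\<phi> i)" using sat by blast
  next
    fix i y s s' assume i: "i < d" and y: "y \<in> tuples (carrier M) m"
      and s: "sat M (tcat m y (b i s)) (\<phi> i) \<and> sat M (tcat m y (b i s')) (\<phi> i)"
    then have "y \<in> Km.dcos (H i) (g i s)" "y \<in> Km.dcos (H i) (g i s')" using sat[OF i y] by auto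
    then have "Km.dcos (H i) (g i s) = Km.dcos (H i) (g i s')"
      using Km.dcos_eq[OF Hs[OF i] gc[OF i]] by metis
    then show "s = s'" by (rule g(2)[OF i])
  qed (use fm bt in auto)
  then show ?thesis by blast
qed

lemma arrayD:
  assumes "array m d \<chi> l b"
  shows "\<And>i. i < d \<Longrightarrow> \<chi> i \<in> formulas L m l" "\<And>i s. i < d \<Longrightarrow> b i s \<in> tuples (carrier M) l"
    "\<And>i s s' y. \<lbrakk>i < d; y \<in> tuples (carrier M) m; sat M (tcat m y (b i s)) (\<chi> i); sat M (tcat m y (b i s')) (\<chi> i)\<rbrakk> \<Longrightarrow> s = s'"
    "\<And>\<eta>. \<exists>y\<in>tuples (carrier M) m. \<forall>i<d. sat M (tcat m y (b i (\<eta> i))) (\<chi> i)"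
  using assms unfolding array_def by blast+

lemma dp_pow_ge:
  assumes a: "array m d \<chi> l b"
  shows "enat d \<le> dp_pow L M m"
proof -
  have "inp_pattern L M m (trivial_type m) {..<d}" unfolding inp_pattern_def
  proof (rule exI[of _ \<chi>], rule exI[of _ "\<lambda>_. l"], rule exI[of _ "\<lambda>_. 2"], rule exI[of _ b], intro conjI ballI allI impI)
    fix \<alpha> assume \<alpha>: "\<alpha> \<in> {..<d}"
    show "\<chi> \<alpha> \<in> formulas L m l" using arrayD(1)[OF a] \<alpha> by simp
    show "b \<alpha> i \<in> tuples (carrier M) l" for i using arrayD(2)[OF a] \<alpha> by simp
    fix I :: "nat set" assume "finite I \<and> card I = 2"
    then obtain s s' where I: "I = {s, s'}" "s \<noteq> s'" by (auto simp: card_2_iff)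
    show "\<not> consistent M m ((\<lambda>i. (\<chi> \<alpha>, b \<alpha> i)) ` I)"
    proof
      assume "consistent M m ((\<lambda>i. (\<chi> \<alpha>, b \<alpha> i)) ` I)"
      moreover have "finite ((\<lambda>i. (\<chi> \<alpha>, b \<alpha> i)) ` I)" using I by simp
      ultimately obtain y where y: "y \<in> tuples (carrier M) m" "realizes M m y ((\<lambda>i. (\<chi> \<alpha>, b \<alpha> i)) ` I)"
        unfolding consistent_def by blast
      then have "sat M (tcat m y (b \<alpha> s)) (\<chi> \<alpha>)" "sat M (tcat m y (b \<alpha> s')) (\<chi> \<alpha>)"
        unfolding realizes_def I by auto
      then show False using arrayD(3)[OF a _ y(1)] \<alpha> I(2) by blast
    qed
  next
    fix \<eta> :: "nat \<Rightarrow> nat"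
    obtain y where y: "y \<in> tuples (carrier M) m" "\<forall>i<d. sat M (tcat m y (b i (\<eta> i))) (\<chi> i)"
      using arrayD(4)[OF a] by blast
    have "realizes M m y (trivial_type m \<union> (\<lambda>\<alpha>. (\<chi> \<alpha>, b \<alpha> (\<eta> \<alpha>))) ` {..<d})"
      using y(2) unfolding realizes_def trivial_type_def by auto
    then show "consistent M m (trivial_type m \<union> (\<lambda>\<alpha>. (\<chi> \<alpha>, b \<alpha> (\<eta> \<alpha>))) ` {..<d})"
      unfolding consistent_def realizes_def using y(1) by blast
  qed
  then show ?thesis unfolding dp_pow_def dp_rank_def
    by (intro Sup_upper) (auto intro!: exI[of _ "{..<d}"])
qed

text \<open>Points and parameters exchange roles: elements of \<open>G^m\<close> become parameters.
  The formula is the disjunction over \<open>j\<close> of \<open>\<chi> j\<close> at the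
  \<open>j\<close>-th of \<open>d\<close> blocks of length \<open>l\<close>. The point
  \<open>p i s\<close> carries column \<open>s\<close> in block \<open>i\<close> and column 0 in the
  others; so for a path \<open>\<eta>\<close> that avoids column 0 the formula holds at
  \<open>p i s\<close> and \<open>Y \<eta>\<close> exactly if \<open>s = \<eta> i\<close>. Hence
  \<open>d n\<close> points have at least \<open>n ^ d\<close> traces.\<close>

lemma vc_density_ge:
  assumes a: "array m d \<chi> l b" and m: "0 < m"
  shows "ereal (real d) \<le> vc_density L M m"
proof -
  define k where "k = d * l"
  \<comment> \<open>The \<open>m\<close> object variables of \<open>\<chi> j\<close> become the last
    \<open>m\<close> variables, its parameters go to block \<open>j\<close>.\<close>
  define \<rho> where "\<rho> j v = (if v < m then k + v else j * l + (v - m))" for j v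
  have jl: "j * l + w < k" if "j < d" "w < l" for j w
  proof -
    have "j * l + w < Suc j * l" using that(2) by simp
    also have "\<dots> \<le> d * l" using that(1) by (intro mult_le_mono1) simp
    finally show ?thesis by (simp add: k_def)
  qed
  have fvx: "fv (\<chi> j) \<subseteq> {..<m + l}" if "j < d" for j using arrayD(1)[OF a that] by (simp add: formulas_def)
  have "\<exists>\<psi>. \<psi> \<in> formulas L k m \<and> (\<forall>e. sat M e \<psi> \<longleftrightarrow> sat M (e \<circ> \<rho> j) (\<chi> j))" if j: "j < d" for j
  proof -
    obtain \<psi> where \<psi>: "wf_fm L \<psi>" "fv \<psi> \<subseteq> \<rho> j ` fv (\<chi> j)" "\<And>e. sat M e \<psi> \<longleftrightarrow> sat M (e \<circ> \<rho> j) (\<chi> j)"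
      using rename_fm[of L "\<chi> j" "\<rho> j" M] arrayD(1)[OF a j] unfolding formulas_def by auto
    have "\<rho> j v < k + m" if "v \<in> fv (\<chi> j)" for v
    proof (cases "v < m")
      case False
      then have "j * l + (v - m) < k" using fvx[OF j] that by (intro jl[OF j]) auto
      then show ?thesis using False by (simp add: \<rho>_def)
    qed (simp add: \<rho>_def)
    then have "\<psi> \<in> formulas L k m" using \<psi>(1,2) unfolding formulas_def by auto
    then show ?thesis using \<psi>(3) by blast
  qed
  then obtain \<psi> where \<psi>: "\<And>j. j < d \<Longrightarrow> \<psi> j \<in> formulas L k m"
    "\<And>j e. j < d \<Longrightarrow> sat M e (\<psi> j) \<longleftrightarrow> sat M (e \<circ> \<rho> j) (\<chi> j)" by metis
  obtain \<phi> where \<phi>: "\<phi> \<in> formulas L k m" "\<And>e. sat M e \<phi> \<longleftrightarrow> (\<exists>j<d. sat M e (\<psi> j))"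
    using formulas_bex[of k m d \<psi> L M] \<psi>(1) m by auto
  \<comment> \<open>\<open>q div l\<close> is the block and \<open>q mod l\<close> the place in it;
    column 0 is kept as an idle filler.\<close>
  define p where "p i s = (\<lambda>q\<in>{..<k}. b (q div l) (if q div l = i then s else 0) (q mod l))" for i s
  have pt: "p i s \<in> tuples (carrier M) k" for i s
  proof -
    have "b (q div l) s' (q mod l) \<in> carrier M" if "q < k" for q s'
    proof -
      have "0 < l" using that unfolding k_def by (cases l) auto
      moreover have "q div l < d" using that unfolding k_def by (simp add: less_mult_imp_div_less)
      ultimately show ?thesis using arrayD(2)[OF a, of "q div l" s'] by (auto simp: PiE_iff)
    qed
    then show ?thesis unfolding p_def by auto
  qed
  have psat: "sat M (tcat k (p i s) y) \<phi> \<longleftrightarrow> (\<exists>j<d. sat M (tcat m y (b j (if j = i then s else 0))) (\<chi> j))" for i s y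
  proof -
    have "sat M (tcat k (p i s) y \<circ> \<rho> j) (\<chi> j) \<longleftrightarrow> sat M (tcat m y (b j (if j = i then s else 0))) (\<chi> j)" if j: "j < d" for j
    proof (rule sat_cong)
      fix v assume v: "v \<in> fv (\<chi> j)"
      show "(tcat k (p i s) y \<circ> \<rho> j) v = tcat m y (b j (if j = i then s else 0)) v"
      proof (cases "v < m")
        case False
        then have w: "v - m < l" using v fvx[OF j] by auto
        have "(j * l + (v - m)) div l = j" "(j * l + (v - m)) mod l = v - m" using w by simp_all
        then show ?thesis using False jl[OF j w] by (simp add: \<rho>_def p_def)
      qed (simp add: \<rho>_def)
    qed
    then show ?thesis unfolding \<phi>(2) using \<psi>(2) by blast
  qed
  have "\<forall>\<eta>. \<exists>y. y \<in> tuples (carrier M) m \<and> (\<forall>i<d. sat M (tcat m y (b i (\<eta> i))) (\<chi> i))"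
    using arrayD(4)[OF a] by blast
  then obtain Y where Y: "\<And>\<eta>. Y \<eta> \<in> tuples (carrier M) m" "\<And>\<eta> i. i < d \<Longrightarrow> sat M (tcat m (Y \<eta>) (b i (\<eta> i))) (\<chi> i)"
    by metis
  have key: "sat M (tcat k (p i s) (Y \<eta>)) \<phi> \<longleftrightarrow> s = \<eta> i"
    if i: "i < d" and s: "1 \<le> s" and \<eta>: "\<And>j. j < d \<Longrightarrow> 1 \<le> \<eta> j" for i s \<eta>
  proof -
    have "sat M (tcat m (Y \<eta>) (b j s')) (\<chi> j) \<longleftrightarrow> s' = \<eta> j" if "j < d" for j s'
      using arrayD(3)[OF a that Y(1)] Y(2)[OF that] by blast
    then have "sat M (tcat k (p i s) (Y \<eta>)) \<phi> \<longleftrightarrow> (\<exists>j<d. (if j = i then s else 0) = \<eta> j)" unfolding psat by blast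
    also have "\<dots> \<longleftrightarrow> s = \<eta> i"
    proof
      assume "\<exists>j<d. (if j = i then s else 0) = \<eta> j"
      then obtain j where j: "j < d" "(if j = i then s else 0) = \<eta> j" by blast
      then show "s = \<eta> i" using \<eta>[OF j(1)] by (cases "j = i") auto
    qed (use i in auto)
    finally show ?thesis .
  qed
  let ?X = "tuples (carrier M) k" and ?S = "solset M k \<phi> ` tuples (carrier M) m"
  have sh: "n ^ d \<le> shatter_fun ?X ?S (d * n)" for n
  proof -
    define I where "I = {..<d} \<times> {1..n}"
    define A where "A = (\<lambda>(i, s). p i s) ` I"
    have "inj_on (\<lambda>(i, s). p i s) I"
    proof (rule inj_onI, clarify)
      fix i s i' s' assume "(i, s) \<in> I" "(i', s') \<in> I" and e: "p i s = p i' s'"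
      then have i: "i < d" "i' < d" "1 \<le> s" "1 \<le> s'" unfolding I_def by auto
      \<comment> \<open>A path through column \<open>s\<close> in row \<open>i\<close> that misses
        column \<open>s'\<close> in every other row separates the two points.\<close>
      define \<eta> where "\<eta> j = (if j = i then s else Suc s')" for j
      have \<eta>1: "1 \<le> \<eta> j" for j using i(3) by (simp add: \<eta>_def)
      have "s = \<eta> i \<longleftrightarrow> s' = \<eta> i'"
        using key[of i s \<eta>] key[of i' s' \<eta>] i \<eta>1 unfolding e by simp
      then show "i = i' \<and> s = s'" by (auto simp: \<eta>_def split: if_splits)
    qed
    then have cA: "card A = d * n" "finite A" unfolding A_def by (auto simp: card_image I_def)
    have AX: "A \<subseteq> ?X" unfolding A_def using pt by auto
    define P where "P = {..<d} \<rightarrow>\<^sub>E {1..n}"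
    have \<eta>P: "1 \<le> \<eta> j" if "\<eta> \<in> P" "j < d" for \<eta> j using that unfolding P_def by (auto simp: PiE_iff)
    define f where "f \<eta> = solset M k \<phi> (Y \<eta>) \<inter> A" for \<eta>
    have "inj_on f P"
    proof (rule inj_onI)
      fix \<eta> \<eta>' assume e: "\<eta> \<in> P" "\<eta>' \<in> P" "f \<eta> = f \<eta>'"
      have "\<eta> i = \<eta>' i" if i: "i < d" for i
      proof -
        have "\<eta> i \<in> {1..n}" using PiE_mem[OF e(1)[unfolded P_def], of i] i by simp
        then have "(i, \<eta> i) \<in> I" unfolding I_def using i by simp
        then have "p i (\<eta> i) \<in> A" unfolding A_def by (rule image_eqI[rotated]) simp
        moreover have "sat M (tcat k (p i (\<eta> i)) (Y \<eta>)) \<phi>"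
          using key[of i "\<eta> i" \<eta>, OF i \<eta>P[OF e(1) i] \<eta>P[OF e(1)]] by simp
        ultimately have "p i (\<eta> i) \<in> f \<eta>" unfolding f_def solset_def using pt by simp
        then have "sat M (tcat k (p i (\<eta> i)) (Y \<eta>')) \<phi>" unfolding e(3) unfolding f_def solset_def by simp
        then show ?thesis using key[of i "\<eta> i" \<eta>', OF i \<eta>P[OF e(1) i] \<eta>P[OF e(2)]] by simp
      qed
      then show "\<eta> = \<eta>'" using e(1,2) unfolding P_def by (intro PiE_ext) auto
    qed
    then have "card (f ` P) = n ^ d" by (simp add: card_image P_def card_PiE)
    moreover have "f ` P \<subseteq> (\<lambda>C. C \<inter> A) ` ?S" unfolding f_def using Y(1) by auto
    moreover have fin: "finite ((\<lambda>C. C \<inter> A) ` ?S)"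
      by (rule finite_subset[of _ "Pow A"]) (use cA in auto)
    ultimately have "n ^ d \<le> card ((\<lambda>C. C \<inter> A) ` ?S)" by (metis card_mono)
    also have "\<dots> \<le> shatter_fun ?X ?S (d * n)" unfolding shatter_fun_def
    proof (rule cSup_upper)
      show "card ((\<lambda>C. C \<inter> A) ` ?S) \<in> {card ((\<lambda>C. C \<inter> A) ` ?S) |A. A \<subseteq> ?X \<and> finite A \<and> card A = d * n}"
        using AX cA by blast
      show "bdd_above {card ((\<lambda>C. C \<inter> A) ` ?S) |A. A \<subseteq> ?X \<and> finite A \<and> card A = d * n}"
      proof (rule bdd_aboveI[of _ "2 ^ (d * n)"])
        fix v assume "v \<in> {card ((\<lambda>C. C \<inter> A) ` ?S) |A. A \<subseteq> ?X \<and> finite A \<and> card A = d * n}"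
        then obtain B where B: "v = card ((\<lambda>C. C \<inter> B) ` ?S)" "finite B" "card B = d * n" by blast
        have "card ((\<lambda>C. C \<inter> B) ` ?S) \<le> card (Pow B)" by (rule card_mono) (use B in auto)
        then show "v \<le> 2 ^ (d * n)" using B by (simp add: card_Pow)
      qed
    qed
    finally show ?thesis .
  qed
  have "ereal (real d) \<le> vc ?X ?S" unfolding vc_def
  proof (rule Inf_greatest)
    fix v assume "v \<in> {ereal r |r. 0 \<le> r \<and> (\<lambda>n. real (shatter_fun ?X ?S n)) \<in> O(\<lambda>n. real n powr r)}"
    then obtain r where r: "v = ereal r" "0 \<le> r" "(\<lambda>n. real (shatter_fun ?X ?S n)) \<in> O(\<lambda>n. real n powr r)" by blast
    have "real d \<le> r"
    proof (rule ccontr)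
      assume "\<not> real d \<le> r"
      then have rd: "real d - r > 0" by simp
      then have d: "d \<ge> 1" using r(2) by (cases d) auto
      obtain C where C: "C > 0" "eventually (\<lambda>n. norm (real (shatter_fun ?X ?S n)) \<le> C * norm (real n powr r)) sequentially"
        using landau_o.bigE[OF r(3)] by blast
      then obtain N where N: "\<And>n. n \<ge> N \<Longrightarrow> real (shatter_fun ?X ?S n) \<le> C * real n powr r"
        unfolding eventually_sequentially by auto
      \<comment> \<open>\<open>n ^ d\<close> traces on \<open>d n\<close> points, against the bound
        \<open>C (d n) ^ r\<close>, would keep a positive power of \<open>n\<close> bounded. Since
        \<open>d \<ge> 1\<close>, the size \<open>d n\<close> is past the threshold
        \<open>N\<close>.\<close>
      have "real n powr (real d - r) \<le> C * real d powr r" if n: "n \<ge> max N 1" for n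
      proof -
        have n1: "n \<ge> 1" "n \<ge> N" using n by auto
        have "n \<le> d * n" using d by simp
        then have "d * n \<ge> N" using n1(2) by linarith
        then have "real (shatter_fun ?X ?S (d * n)) \<le> C * real (d * n) powr r" by (rule N)
        moreover have "real (n ^ d) \<le> real (shatter_fun ?X ?S (d * n))" using sh[of n] by (simp only: of_nat_le_iff)
        moreover have "real n powr real d = real (n ^ d)" using n1 by (simp add: powr_realpow)
        ultimately have "real n powr real d \<le> C * real (d * n) powr r" by linarith
        also have "\<dots> = C * real d powr r * real n powr r" by (simp add: powr_mult)
        finally show ?thesis using n1 by (simp add: powr_diff divide_le_eq)
      qed
      then show False by (rule powr_growth[OF rd])
    qed
    then show "ereal (real d) \<le> v" using r(1) by simp
  qed
  also have "\<dots> \<le> vc_density L M m" unfolding vc_density_def by (intro Sup_upper) (use \<phi>(1) in blast)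
  finally show ?thesis .
qed

section \<open>Both invariants equal the breadth\<close>

lemma dp_pow_eq_comm_breadth: "dp_pow L M m = comm_breadth L M G m"
proof (rule antisym)
  show "dp_pow L M m \<le> comm_breadth L M G m"
    using dp_pow_le by (cases "comm_breadth L M G m") auto
  have *: "enat d \<le> dp_pow L M m" if "enat d \<le> comm_breadth L M G m" for d
    using comm_breadth_geD[OF that] array_of_irredundant dp_pow_ge by blast
  show "comm_breadth L M G m \<le> dp_pow L M m"
  proof (cases "comm_breadth L M G m")
    case (enat d)
    then show ?thesis using * by simp
  next
    \<comment> \<open>With infinite breadth there is an array for every \<open>d\<close>, which
      excludes all finite values.\<close>
    case infinity
    then have "enat d \<le> dp_pow L M m" for d using * by simp
    then show ?thesis by (cases "dp_pow L M m") (metis enat_ord_simps(1) not_less_eq_eq order_refl, simp)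
  qed
qed

lemma vc_density_eq_comm_breadth:
  assumes "0 < m"
  shows "vc_density L M m = ereal_of_enat (comm_breadth L M G m)"
proof -
  have *: "ereal (real d) \<le> vc_density L M m" if "enat d \<le> comm_breadth L M G m" for d
    using comm_breadth_geD[OF that] array_of_irredundant vc_density_ge[OF _ assms] by blast
  show ?thesis
  proof (cases "comm_breadth L M G m")
    case (enat d)
    then show ?thesis using *[of d] vc_density_le[of m d] by (simp add: antisym)
  next
    case infinity
    then have "ereal (real d) \<le> vc_density L M m" for d using * by simp
    then have "vc_density L M m = \<infinity>" by (meson ereal_top less_imp_le order_trans ereal_less_eq(3) reals_Archimedean2)
    then show ?thesis using infinity by simp
  qed
qed

end

theorem theorem3p7:
  fixes L :: "('f, 'r) lang" and M :: "('a, 'f, 'r) fo_struct" and G :: "'a monoid"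
    and mu :: 'f and m :: nat
  assumes "group_struct L mu M G" and "infinite (carrier M)" and "sufficiently_saturated L M"
    and "one_based L M G" and "m > 0"
  shows "ereal_of_enat (dp_pow L M m) = vc_density L M m \<and>
         (dp_pow L M m \<noteq> \<infinity> \<and> vc_density L M m \<noteq> \<infinity> \<longrightarrow>
            dp_pow L M m = comm_breadth L M G m \<and>
            vc_density L M m = ereal_of_enat (comm_breadth L M G m))"
proof -
  interpret one_based_structure L M G mu
    using assms(1,2,4) by unfold_locales
  show ?thesis
    using dp_pow_eq_comm_breadth[of m] vc_density_eq_comm_breadth[OF assms(5)] by simp
qed

end
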